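(* Let $K$ be a symmetric cone in a finite-dimensional Euclidean space $E$, with irreducible decomposition $K=K_1\oplus\cdots\oplus K_m$, $K_i\subseteq E_i$, $E=E_1\oplus\cdots\oplus E_m$. Let $F$ be a self-scaled barrier function for $K$. Then there exist constants $c_0\in\mathbb{R}$ and $c_1\ge 1,\dots,c_m\ge 1$ such that $$F=c_0-\bigoplus_{i=1}^m c_i\ln\det\nolimits_{K_i},$$ that is, $F(x)=c_0-\sum_{i=1}^m c_i\ln\det_{K_i}(x_i)$ for all $x=\sum_{i=1}^m x_i\in\operatorname{int}(K)$ with $x_i\in\operatorname{ri}(K_i)$. Conversely, any function of this form is a self-scaled barrier for $K$.
   Context: Cones. A cone $K$ in a finite-dimensional Euclidean space $(E,\langle\cdot,\cdot\rangle)$ is regular if it is closed, convex, pointed (contains no line) and solid (non-empty interior). Its dual cone is $K^*=\{s\in E:\langle x,s\rangle\ge 0\ \forall x\in K\}$. $\operatorname{Aut}(K)=\{A\in \mathrm{GL}(E):A(K)=K\}$. A regular cone $K$ is symmetric (homogeneous self-dual) if $\operatorname{Aut}(K)$ acts transitively on $\operatorname{int}(K)$ and $E$ can be endowed with an inner product for which $K^*=K$. $\operatorname{ri}(K_i)$ is the relative interior of $K_i$, i.e. its interior in $E_i$. Decompositions. $K=K_1\oplus\cdots\oplus K_m$ means $E=E_1\oplus\cdots\oplus E_m$ with non-zero subspaces $E_i$, cones $K_i\subseteq E_i$, and $K=K_1+\cdots+K_m$. A cone is irreducible if it admits no such decomposition with $m\ge2$; an irreducible decomposition is one in which each $K_i$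 is irreducible in $E_i$ ($m=1$ if $K$ itself is irreducible). The irreducible components $K_i$ of a symmetric cone are symmetric cones in $E_i$. Determinants. For each $i$, $E_i$ carries the structure of a Euclidean Jordan algebra whose cone of squares is $K_i$; fix one. $\det_{K_i}x_i$ is the Jordan-algebraic determinant: if $x_i=\sum_j\lambda_j d_j$ is a spectral decomposition of $x_i$ with respect to a Jordan frame $\{d_j\}$ (a complete system of orthogonal primitive idempotents), then $\det_{K_i}x_i=\prod_j\lambda_j$. Self-scaled barriers. Let $K$ be a regular cone. A function $F:\operatorname{int}(K)\to\mathbb{R}$ is a self-concordant barrier if it is $C^3$, convex, $F(x_k)\to\infty$ whenever $x_k\in\operatorname{int}(K)$ converges to a boundary point of $K$, $|D^3F(x)[h,h,h]|\le 2\,(D^2F(x)[h,h])^{3/2}$ for all $x\in\operatorname{int}(K)$, $h\in E$, and $|DF(x)[h]|^2\le\nu\, D^2F(x)[h,h]$ for some constant $\nu$. The Hessian $F''(x)$ is the symmetric operator with $\langle F''(x)u,v\rangle=D^2F(x)[u,v]$. A self-concordant barrier $F$ is self-scaled if $F''(x)$ is non-singular for all $x\in\operatorname{int}(K)$, there is $\nu>0$ with $F(tx)=F(x)-\nu\ln t$ for all $x\in\operatorname{int}(K)$, $t>0$, and for all $x,w\in\operatorname{int}(K)$: $F''(w)x\in\operatorname{int}(K^* )$ and $F_*(F''(w)x)=F(x)-2F(w)-\nu$, where $F_*(s)=\sup\{-\langle x,s\rangle-F(x):x\in\operatorname{int}(K)\}$ for $s\in\operatorname{int}(K^* )$. This notion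 does not depend on the choice of inner product. *)

theory Defs
  imports "HOL-Analysis.Analysis"
begin

section \<open>Cones\<close>

definition inner_product_on :: "'a::real_vector set \<Rightarrow> ('a \<Rightarrow> 'a \<Rightarrow> real) \<Rightarrow> bool" where
  "inner_product_on V B \<longleftrightarrow>
     (\<forall>x\<in>V. \<forall>y\<in>V. B x y = B y x) \<and>
     (\<forall>x\<in>V. \<forall>y\<in>V. \<forall>z\<in>V. B (x + y) z = B x z + B y z) \<and>
     (\<forall>x\<in>V. \<forall>y\<in>V. \<forall>c. B (c *\<^sub>R x) y = c * B x y) \<and>
     (\<forall>x\<in>V. x \<noteq> 0 \<longrightarrow> B x x > 0)"

definition dual_cone :: "('a \<Rightarrow> 'a \<Rightarrow> real) \<Rightarrow> 'a set \<Rightarrow> 'a set" where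
  "dual_cone B K = {s. \<forall>x\<in>K. B x s \<ge> 0}"

definition contains_line :: "'a::real_vector set \<Rightarrow> bool" where
  "contains_line S \<longleftrightarrow> (\<exists>x v. v \<noteq> 0 \<and> (\<forall>t::real. x + t *\<^sub>R v \<in> S))"

definition regular_cone :: "'a::euclidean_space set \<Rightarrow> bool" where
  "regular_cone K \<longleftrightarrow>
     cone K \<and> closed K \<and> convex K \<and> \<not> contains_line K \<and> interior K \<noteq> {}"

definition cone_automorphisms :: "'a::real_vector set \<Rightarrow> ('a \<Rightarrow> 'a) set" where
  "cone_automorphisms K = {A. linear A \<and> bij A \<and> A ` K = K}"

definition symmetric_cone :: "'a::euclidean_space set \<Rightarrow> bool" where
  "symmetric_cone K \<longleftrightarrow> regular_cone K \<and>
     (\<forall>x\<in>interior K. \<forall>y\<in>interior K. \<exists>A\<in>cone_automorphisms K. A x = y) \<and>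
     (\<exists>B. inner_product_on UNIV B \<and> dual_cone B K = K)"

section \<open>Decompositions\<close>

text \<open>Sums of sets are Minkowski sums. The summands are indexed by \<open>{1..m}\<close>;
  values of \<open>E\<close> and \<open>C\<close> outside that range are irrelevant.\<close>

definition direct_sum_of :: "'a::real_vector set \<Rightarrow> nat \<Rightarrow> (nat \<Rightarrow> 'a set) \<Rightarrow> bool" where
  "direct_sum_of V m E \<longleftrightarrow>
     (\<forall>i\<in>{1..m}. subspace (E i)) \<and> V = (\<Sum>i=1..m. E i) \<and>
     (\<forall>x. (\<forall>i\<in>{1..m}. x i \<in> E i) \<and> (\<Sum>i=1..m. x i) = 0 \<longrightarrow> (\<forall>i\<in>{1..m}. x i = 0))"

definition cone_decomposition ::
    "'a::real_vector set \<Rightarrow> 'a set \<Rightarrow> nat \<Rightarrow> (nat \<Rightarrow> 'a set) \<Rightarrow> (nat \<Rightarrow> 'a set) \<Rightarrow> bool" where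
  "cone_decomposition V K m E C \<longleftrightarrow>
     direct_sum_of V m E \<and> (\<forall>i\<in>{1..m}. E i \<noteq> {0}) \<and>
     (\<forall>i\<in>{1..m}. cone (C i) \<and> C i \<subseteq> E i) \<and> K = (\<Sum>i=1..m. C i)"

definition irreducible_cone_in :: "'a::real_vector set \<Rightarrow> 'a set \<Rightarrow> bool" where
  "irreducible_cone_in V K \<longleftrightarrow> \<not> (\<exists>m E C. m \<ge> 2 \<and> cone_decomposition V K m E C)"

definition irreducible_decomposition ::
    "'a::real_vector set \<Rightarrow> nat \<Rightarrow> (nat \<Rightarrow> 'a set) \<Rightarrow> (nat \<Rightarrow> 'a set) \<Rightarrow> bool" where
  "irreducible_decomposition K m E C \<longleftrightarrow>
     cone_decomposition UNIV K m E C \<and> (\<forall>i\<in>{1..m}. irreducible_cone_in (E i) (C i))"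

section \<open>Euclidean Jordan algebras on a subspace\<close>

text \<open>\<open>P\<close> is the Jordan product and \<open>e\<close> the unit; \<open>P\<close> is only constrained on \<open>V\<close>.
  The last conjunct asks for an associative inner product.\<close>

definition euclidean_jordan_algebra ::
    "'a::real_vector set \<Rightarrow> ('a \<Rightarrow> 'a \<Rightarrow> 'a) \<Rightarrow> 'a \<Rightarrow> bool" where
  "euclidean_jordan_algebra V P e \<longleftrightarrow>
     subspace V \<and> e \<in> V \<and>
     (\<forall>x\<in>V. \<forall>y\<in>V. P x y \<in> V \<and> P x y = P y x) \<and>
     (\<forall>x\<in>V. \<forall>y\<in>V. \<forall>z\<in>V. P (x + y) z = P x z + P y z) \<and>
     (\<forall>x\<in>V. \<forall>y\<in>V. \<forall>c. P (c *\<^sub>R x) y = c *\<^sub>R P x y) \<and>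
     (\<forall>x\<in>V. \<forall>y\<in>V. P x (P (P x x) y) = P (P x x) (P x y)) \<and>
     (\<forall>x\<in>V. P e x = x) \<and>
     (\<exists>B. inner_product_on V B \<and> (\<forall>x\<in>V. \<forall>y\<in>V. \<forall>z\<in>V. B (P x y) z = B y (P x z)))"

definition cone_of_squares :: "'a set \<Rightarrow> ('a \<Rightarrow> 'a \<Rightarrow> 'a) \<Rightarrow> 'a set" where
  "cone_of_squares V P = {P x x | x. x \<in> V}"

definition idempotent_in :: "'a set \<Rightarrow> ('a \<Rightarrow> 'a \<Rightarrow> 'a) \<Rightarrow> 'a \<Rightarrow> bool" where
  "idempotent_in V P d \<longleftrightarrow> d \<in> V \<and> P d d = d"

definition primitive_idempotent ::
    "'a::real_vector set \<Rightarrow> ('a \<Rightarrow> 'a \<Rightarrow> 'a) \<Rightarrow> 'a \<Rightarrow> bool" where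
  "primitive_idempotent V P d \<longleftrightarrow> idempotent_in V P d \<and> d \<noteq> 0 \<and>
     \<not> (\<exists>a b. idempotent_in V P a \<and> a \<noteq> 0 \<and> idempotent_in V P b \<and> b \<noteq> 0 \<and> d = a + b)"

text \<open>A frame can be given as a set: orthogonal nonzero idempotents are distinct.\<close>

definition jordan_frame ::
    "'a::real_vector set \<Rightarrow> ('a \<Rightarrow> 'a \<Rightarrow> 'a) \<Rightarrow> 'a \<Rightarrow> 'a set \<Rightarrow> bool" where
  "jordan_frame V P e D \<longleftrightarrow> finite D \<and> (\<forall>d\<in>D. primitive_idempotent V P d) \<and>
     (\<forall>c\<in>D. \<forall>d\<in>D. c \<noteq> d \<longrightarrow> P c d = 0) \<and> (\<Sum>d\<in>D. d) = e"

definition jordan_det ::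
    "'a::real_vector set \<Rightarrow> ('a \<Rightarrow> 'a \<Rightarrow> 'a) \<Rightarrow> 'a \<Rightarrow> 'a \<Rightarrow> real" where
  "jordan_det V P e x =
     (THE t. \<exists>D l. jordan_frame V P e D \<and> x = (\<Sum>d\<in>D. l d *\<^sub>R d) \<and> t = (\<Prod>d\<in>D. l d))"

section \<open>Self-scaled barriers\<close>

text \<open>Functions on the interior of a cone are represented by total functions. All notions
  below depend only on the values on the (open) interior.\<close>

definition D1 :: "('a::euclidean_space \<Rightarrow> real) \<Rightarrow> 'a \<Rightarrow> 'a \<Rightarrow> real" where
  "D1 F x u = frechet_derivative F (at x) u"

definition D2 :: "('a::euclidean_space \<Rightarrow> real) \<Rightarrow> 'a \<Rightarrow> 'a \<Rightarrow> 'a \<Rightarrow> real" where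
  "D2 F x u v = D1 (\<lambda>y. D1 F y u) x v"

definition D3 :: "('a::euclidean_space \<Rightarrow> real) \<Rightarrow> 'a \<Rightarrow> 'a \<Rightarrow> 'a \<Rightarrow> 'a \<Rightarrow> real" where
  "D3 F x u v w = D1 (\<lambda>y. D2 F y u v) x w"

text \<open>\<open>C\<^sup>k\<close> on an open set. In finite dimension, continuity of the derivative as an
  operator is continuity of all its evaluations.\<close>

primrec Ck_on :: "nat \<Rightarrow> ('a::euclidean_space \<Rightarrow> real) \<Rightarrow> 'a set \<Rightarrow> bool" where
  "Ck_on 0 F S \<longleftrightarrow> continuous_on S F"
| "Ck_on (Suc k) F S \<longleftrightarrow>
     (\<forall>x\<in>S. F differentiable (at x)) \<and> (\<forall>u. Ck_on k (\<lambda>x. D1 F x u) S)"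

definition self_concordant_barrier ::
    "'a::euclidean_space set \<Rightarrow> ('a \<Rightarrow> real) \<Rightarrow> bool" where
  "self_concordant_barrier K F \<longleftrightarrow>
     Ck_on 3 F (interior K) \<and>
     convex_on (interior K) F \<and>
     (\<forall>X z. (\<forall>k::nat. X k \<in> interior K) \<and> X \<longlonglongrightarrow> z \<and> z \<in> frontier K
        \<longrightarrow> filterlim (\<lambda>k. F (X k)) at_top sequentially) \<and>
     (\<forall>x\<in>interior K. \<forall>h. \<bar>D3 F x h h h\<bar> \<le> 2 * (D2 F x h h) powr (3/2)) \<and>
     (\<exists>\<nu>. \<forall>x\<in>interior K. \<forall>h. \<bar>D1 F x h\<bar>\<^sup>2 \<le> \<nu> * D2 F x h h)"

definition hessian :: "('a::euclidean_space \<Rightarrow> real) \<Rightarrow> 'a \<Rightarrow> 'a \<Rightarrow> 'a" where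
  "hessian F x = (THE A. linear A \<and> (\<forall>u v. A u \<bullet> v = D2 F x u v))"

text \<open>The conjugate takes extended real values, so that an unbounded supremum is
  \<open>\<infinity>\<close> rather than an unspecified real.\<close>

definition conjugate_barrier ::
    "'a::euclidean_space set \<Rightarrow> ('a \<Rightarrow> real) \<Rightarrow> 'a \<Rightarrow> ereal" where
  "conjugate_barrier K F s = (SUP x\<in>interior K. ereal (- (x \<bullet> s) - F x))"

definition self_scaled_barrier :: "'a::euclidean_space set \<Rightarrow> ('a \<Rightarrow> real) \<Rightarrow> bool" where
  "self_scaled_barrier K F \<longleftrightarrow>
     self_concordant_barrier K F \<and>
     (\<forall>x\<in>interior K. bij (hessian F x)) \<and>
     (\<exists>\<nu>>0.
        (\<forall>x\<in>interior K. \<forall>t>0. F (t *\<^sub>R x) = F x - \<nu> * ln t) \<and>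
        (\<forall>x\<in>interior K. \<forall>w\<in>interior K.
           hessian F w x \<in> interior (dual_cone (\<bullet>) K) \<and>
           conjugate_barrier K F (hessian F w x) = ereal (F x - 2 * F w - \<nu>)))"

end

theory Submission
  imports Defs
begin

text \<open>
  The products of the \<open>E\<^sub>i\<close> make the whole space a Jordan algebra with unit \<open>e\<close> and cone of squares \<open>K\<close>.
  Both directions rest on its associative inner products, that is, on the inner products \<open>B\<close> with
  \<open>B (x \<odot> y) z = B y (x \<odot> z)\<close>. For \<open>x = \<Sum> l\<^sub>d d\<close> in a Jordan frame put
  \<open>logdet x = \<Sum> B d d ln l\<^sub>d\<close>. Nonorthogonal primitive idempotents have the same length
  (\<open>primitive_norm_eq\<close>), so if two primitive idempotents of \<open>E\<^sub>i\<close> had different lengths, \<open>C\<^sub>i\<close> would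
  decompose; hence \<open>B d d\<close> is a constant \<open>c\<^sub>i\<close> on the primitive idempotents of \<open>E\<^sub>i\<close>
  (\<open>prim_norm_const\<close>), and \<open>logdet = \<Sum> c\<^sub>i ln det\<^sub>i\<close> (\<open>logdet_eq_sum\<close>). It remains to show that the
  self-scaled barriers are the functions \<open>c\<^sub>0 - logdet\<close> for the associative inner products
  with \<open>B d d \<ge> 1\<close> for all primitive \<open>d\<close>.

  Such a function is a self-scaled barrier (\<open>logdet_self_scaled\<close>). Klein's inequality
  \<open>logdet y \<le> logdet x + B (jinv x) y - B e e\<close>, with equality for \<open>x = y\<close>, yields the concavity of
  \<open>logdet\<close>, its gradient \<open>jinv x\<close>, and the conjugate function; smoothness follows because
  \<open>jinv x\<close> is the solution \<open>u\<close> of the linear equation \<open>x \<odot> u = e\<close>. For an idempotent \<open>c\<close> the flow of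
  \<open>y' = 2 \<sigma> c \<odot> y\<close> changes \<open>logdet\<close> at a constant rate, so it cannot reach the boundary,
  where \<open>logdet\<close> tends to minus infinity (\<open>peirce_scale_flow\<close>). These flows generate automorphisms of \<open>K\<close>
  that act transitively on the interior and change \<open>logdet\<close> by constants, which reduces every
  property to the point \<open>e\<close>. There the second derivative of the barrier is \<open>B\<close> and the third is
  \<open>- 2 B (h \<odot> h) h\<close>, and the condition \<open>B d d \<ge> 1\<close> gives the inequality between them.

  Conversely, let \<open>F\<close> be self-scaled. Its Hessians map \<open>K\<close> onto the dual cone
  (\<open>self_scaled_dual_preimage\<close>). Let \<open>c\<close>, \<open>d\<close> be orthogonal idempotents and let \<open>z \<in> K\<close> be such that
  \<open>D\<^sup>2F(e)[z,-]\<close> is \<open>B d -\<close>. The function \<open>v \<mapsto> D\<^sup>2F(v)[c,z]\<close> is nonnegative and vanishes at \<open>e\<close>, so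
  its derivative at \<open>e\<close> vanishes too. With the spectral theorem these equations force
  \<open>D\<^sup>3F(e)[h,u,v] = - 2 D\<^sup>2F(e)[h \<odot> u,v]\<close> (\<open>self_scaled_third_derivative\<close>), and the symmetry of the third
  derivative shows that \<open>D\<^sup>2F(e)\<close> is associative. The same argument at all other points shows
  that the Hessian is diagonal on the span of a frame. There \<open>F\<close> is therefore a sum of functions of one
  variable, which are logarithms by homogeneity (\<open>self_scaled_imp_logdet\<close>); the coefficients are
  at least 1 because of the bound on the third derivative at idempotents.
\<close>

section \<open>Directional derivatives\<close>

lemma D1_eqI:
  assumes "(f has_derivative f') (at x)"
  shows "D1 f x u = f' u"
  using frechet_derivative_at[OF assms] by (simp add: D1_def)

lemma has_derivative_D1:
  assumes "f differentiable (at x)"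
  shows "(f has_derivative D1 f x) (at x)"
proof -
  have "D1 f x = frechet_derivative f (at x)"
    by (rule ext) (simp add: D1_def)
  then show ?thesis
    using assms by (simp add: frechet_derivative_works)
qed

lemma linear_D1: "f differentiable (at x) \<Longrightarrow> linear (D1 f x)"
  using has_derivative_D1 has_derivative_linear by blast

lemma D1_cong:
  assumes "open S" "x \<in> S" "\<And>y. y \<in> S \<Longrightarrow> f y = g y"
  shows "D1 f x u = D1 g x u"
proof -
  have "(f has_derivative f') (at x) \<longleftrightarrow> (g has_derivative f') (at x)" for f'
    using has_derivative_transform_within_open[OF _ assms(1,2), where t=UNIV] assms(3)
    by (metis)
  then show ?thesis
    by (simp add: D1_def frechet_derivative_def)
qed

lemma Ck_on_cong:
  assumes "open S" "\<And>y. y \<in> S \<Longrightarrow> f y = g y" "Ck_on k f S"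
  shows "Ck_on k g S"
  using assms
proof (induction k arbitrary: f g)
  case 0
  then show ?case
    by (metis Ck_on.simps(1) continuous_on_cong)
next
  case (Suc k)
  have "g differentiable (at x)" if "x \<in> S" for x
  proof -
    have "f differentiable (at x)" using Suc.prems that by simp
    then show ?thesis
      using has_derivative_transform_within_open[OF _ Suc.prems(1) that, where t=UNIV and f=f and g=g] Suc.prems(2)
      unfolding differentiable_def by blast
  qed
  moreover have "Ck_on k (\<lambda>x. D1 g x u) S" for u
    using Suc.IH[of "\<lambda>x. D1 f x u" "\<lambda>x. D1 g x u"] Suc.prems D1_cong[of S _ f g] by auto
  ultimately show ?case by simp
qed

lemma Ck_on_3D:
  assumes "Ck_on 3 F S" "x \<in> S"
  shows "F differentiable (at x)" "(\<lambda>y. D1 F y u) differentiable (at x)"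
    "(\<lambda>y. D2 F y u v) differentiable (at x)"
  using assms by (simp_all add: numeral_3_eq_3 D2_def)

lemma Ck_on_Suc_imp_Ck_on: "Ck_on (Suc k) F S \<Longrightarrow> Ck_on k F S"
proof (induction k arbitrary: F)
  case 0
  then show ?case
    by (metis Ck_on.simps continuous_at_imp_continuous_on differentiable_imp_continuous_within)
next
  case (Suc k)
  then show ?case by (metis Ck_on.simps(2))
qed

lemma Ck_on_3_imp_2: "Ck_on 3 F S \<Longrightarrow> Ck_on 2 F S"
  using Ck_on_Suc_imp_Ck_on[of 2 F S] by (simp only: Suc_numeral add_num_simps)

text \<open>All invariance and homogeneity properties of derivatives below come from functional equations
  of this shape, applied in turn to the function and to its derivatives.\<close>

lemma D1_affine_compose:
  assumes "open S" "x \<in> S" "\<And>y. y \<in> S \<Longrightarrow> g y = c * f (A y) + k" "linear A"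
    "f differentiable (at (A x))"
  shows "D1 g x u = c * D1 f (A x) (A u)"
proof -
  have A: "(A has_derivative A) (at x)"
    using assms(4) by (simp add: linear_imp_has_derivative)
  have "(f \<circ> A has_derivative D1 f (A x) \<circ> A) (at x)"
    using diff_chain_at[OF A has_derivative_D1[OF assms(5)]] .
  then have "((\<lambda>y. c * f (A y) + k) has_derivative (\<lambda>u. c * D1 f (A x) (A u))) (at x)"
    by (auto intro!: derivative_eq_intros simp: o_def)
  then have "(g has_derivative (\<lambda>u. c * D1 f (A x) (A u))) (at x)"
    by (rule has_derivative_transform_within_open[OF _ assms(1,2)]) (simp add: assms(3))
  then show ?thesis by (rule D1_eqI)
qed

lemma Ck_on_affine:
  assumes "open S" "Ck_on k f S"
  shows "Ck_on k (\<lambda>x. a * f x + b) S"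
  using assms(2)
proof (induction k arbitrary: f b)
  case 0
  then show ?case by (auto intro!: continuous_intros)
next
  case (Suc k)
  have diff: "f differentiable (at x)" if "x \<in> S" for x using Suc.prems that by simp
  have lin: "linear (\<lambda>x::'a. x)" by (simp add: linear_iff)
  have D1: "D1 (\<lambda>x. a * f x + b) x u = a * D1 f x u + 0" if "x \<in> S" for x u
    using D1_affine_compose[OF assms(1) that _ lin, of "\<lambda>x. a * f x + b" a f b u] diff[OF that] by simp
  have "Ck_on k (\<lambda>x. D1 (\<lambda>x. a * f x + b) x u) S" for u
  proof (rule Ck_on_cong[OF assms(1) D1[symmetric]])
    show "Ck_on k (\<lambda>x. a * D1 f x u + 0) S" by (rule Suc.IH) (use Suc.prems in simp)
  qed
  moreover have "(\<lambda>x. a * f x + b) differentiable (at x)" if "x \<in> S" for x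
    using diff[OF that] by (intro derivative_intros)
  ultimately show ?case by simp
qed

lemma DERIV_along_curve:
  assumes w: "(w has_derivative (\<lambda>h. h *\<^sub>R v)) (at t)" and f: "f differentiable (at (w t))"
  shows "((\<lambda>s. f (w s)) has_real_derivative D1 f (w t) v) (at t)"
proof -
  have "(f \<circ> w has_derivative D1 f (w t) \<circ> (\<lambda>h. h *\<^sub>R v)) (at t)"
    by (rule diff_chain_at[OF w has_derivative_D1[OF f]])
  then show ?thesis
    by (simp add: has_field_derivative_def o_def linear_cmul[OF linear_D1[OF f]] mult_commute_abs)
qed

lemma DERIV_along_line:
  assumes "f differentiable (at (x + t *\<^sub>R u))"
  shows "((\<lambda>s. f (x + s *\<^sub>R u)) has_real_derivative D1 f (x + t *\<^sub>R u) u) (at t)"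
  using assms by (intro DERIV_along_curve[where w = "\<lambda>s. x + s *\<^sub>R u"]) (auto intro!: derivative_eq_intros)

lemma second_difference_mean_value:
  assumes C: "Ck_on 2 f S" and s: "s > 0"
    and sub: "\<And>a b. 0 \<le> a \<Longrightarrow> a \<le> s \<Longrightarrow> 0 \<le> b \<Longrightarrow> b \<le> s \<Longrightarrow> x + a *\<^sub>R u + b *\<^sub>R v \<in> S"
  shows "\<exists>a b. 0 \<le> a \<and> a \<le> s \<and> 0 \<le> b \<and> b \<le> s \<and>
    f (x + s *\<^sub>R u + s *\<^sub>R v) - f (x + s *\<^sub>R u) - f (x + s *\<^sub>R v) + f x
      = s * s * D2 f (x + a *\<^sub>R u + b *\<^sub>R v) u v"
proof -
  have d1: "f differentiable (at y)" and d2: "(\<lambda>z. D1 f z u) differentiable (at y)" if "y \<in> S" for y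
    using C that by (simp_all add: numeral_2_eq_2)
  define \<phi> where "\<phi> = (\<lambda>a. f ((x + s *\<^sub>R v) + a *\<^sub>R u) - f (x + a *\<^sub>R u))"
  have "(\<phi> has_real_derivative (D1 f ((x + s *\<^sub>R v) + a *\<^sub>R u) u - D1 f (x + a *\<^sub>R u) u)) (at a)"
    if "0 \<le> a" "a \<le> s" for a
    unfolding \<phi>_def
    using sub[OF that, of s] sub[OF that, of 0] s
    by (intro derivative_intros DERIV_along_line d1) (simp_all add: algebra_simps)
  from MVT2[OF s this] obtain a where a: "0 < a" "a < s"
    and 1: "\<phi> s - \<phi> 0 = s * (D1 f ((x + s *\<^sub>R v) + a *\<^sub>R u) u - D1 f (x + a *\<^sub>R u) u)"
    by auto
  have "((\<lambda>b. D1 f ((x + a *\<^sub>R u) + b *\<^sub>R v) u) has_real_derivative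
      D2 f ((x + a *\<^sub>R u) + b *\<^sub>R v) u v) (at b)" if "0 \<le> b" "b \<le> s" for b
    unfolding D2_def
    using sub[of a b] that a
    by (intro DERIV_along_line[where f="\<lambda>y. D1 f y u"] d2) (simp_all add: algebra_simps)
  from MVT2[OF s this] obtain b where b: "0 < b" "b < s"
    and 2: "D1 f ((x + a *\<^sub>R u) + s *\<^sub>R v) u - D1 f ((x + a *\<^sub>R u) + 0 *\<^sub>R v) u
      = s * D2 f ((x + a *\<^sub>R u) + b *\<^sub>R v) u v"
    by auto
  have "f (x + s *\<^sub>R u + s *\<^sub>R v) - f (x + s *\<^sub>R u) - f (x + s *\<^sub>R v) + f x = \<phi> s - \<phi> 0"
    by (simp add: \<phi>_def algebra_simps)
  also have "\<dots> = s * s * D2 f (x + a *\<^sub>R u + b *\<^sub>R v) u v"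
    using 1 2 by (simp add: algebra_simps)
  finally show ?thesis using a b by (intro exI[of _ a] exI[of _ b]) auto
qed

text \<open>Both mixed derivatives are limits of the same second difference quotient
  \<open>(f(x+su+sv) - f(x+su) - f(x+sv) + f(x)) / s\<^sup>2\<close>, by the mean value theorem applied in the
  two possible orders.\<close>

lemma D2_symmetric:
  assumes "open S" and C: "Ck_on 2 f S" and x: "x \<in> S"
  shows "D2 f x u v = D2 f x v u"
proof (rule ccontr)
  assume neq: "D2 f x u v \<noteq> D2 f x v u"
  define \<epsilon> where "\<epsilon> = \<bar>D2 f x u v - D2 f x v u\<bar> / 2"
  have \<epsilon>: "\<epsilon> > 0" using neq by (simp add: \<epsilon>_def)
  have cont: "continuous_on S (\<lambda>y. D2 f y u v)" for u v
    using C by (simp add: numeral_2_eq_2 D2_def)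
  have close: "\<exists>d>0. \<forall>y. dist y x < d \<longrightarrow> y \<in> S \<and> dist (D2 f y u v) (D2 f x u v) < \<epsilon>" for u v
  proof -
    obtain d1 where d1: "d1 > 0" "\<forall>y\<in>S. dist y x < d1 \<longrightarrow> dist (D2 f y u v) (D2 f x u v) < \<epsilon>"
      using cont[of u v] x \<epsilon> unfolding continuous_on_iff by meson
    obtain d2 where d2: "d2 > 0" "\<forall>y. dist y x < d2 \<longrightarrow> y \<in> S"
      using \<open>open S\<close> x unfolding open_dist by meson
    show ?thesis using d1 d2 by (intro exI[of _ "min d1 d2"]) auto
  qed
  obtain d1 where d1: "d1 > 0"
    "\<And>y. dist y x < d1 \<Longrightarrow> y \<in> S \<and> dist (D2 f y u v) (D2 f x u v) < \<epsilon>"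
    using close[of u v] by blast
  obtain d2 where d2: "d2 > 0"
    "\<And>y. dist y x < d2 \<Longrightarrow> y \<in> S \<and> dist (D2 f y v u) (D2 f x v u) < \<epsilon>"
    using close[of v u] by blast
  define d where "d = min d1 d2"
  define s where "s = d / (2 * (norm u + norm v + 1))"
  have d: "d > 0" using d1 d2 by (simp add: d_def)
  have den: "norm u + norm v + 1 > 0"
    by (simp add: add_nonneg_pos)
  have s: "s > 0" unfolding s_def using d den by simp
  have near: "dist (x + a *\<^sub>R u' + b *\<^sub>R v') x < d"
    if "0 \<le> a" "a \<le> s" "0 \<le> b" "b \<le> s" "norm u' + norm v' = norm u + norm v" for a b u' v'
  proof -
    have "dist (x + a *\<^sub>R u' + b *\<^sub>R v') x \<le> a * norm u' + b * norm v'"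
      using that norm_triangle_ineq[of "a *\<^sub>R u'" "b *\<^sub>R v'"] by (simp add: dist_norm add.assoc)
    also have "\<dots> \<le> s * norm u' + s * norm v'"
      using that by (intro add_mono mult_right_mono) auto
    also have "\<dots> = s * (norm u + norm v)" using that by (simp flip: distrib_left)
    also have "\<dots> \<le> s * (norm u + norm v + 1)" using s by simp
    also have "\<dots> = d / 2"
    proof -
      have "d / (2 * n) * n = d / 2" if "n > 0" for n :: real
        using that by (simp add: field_simps)
      then show ?thesis unfolding s_def using den by blast
    qed
    finally show ?thesis using d by simp
  qed
  obtain a b where ab: "0 \<le> a" "a \<le> s" "0 \<le> b" "b \<le> s"
    "f (x + s *\<^sub>R u + s *\<^sub>R v) - f (x + s *\<^sub>R u) - f (x + s *\<^sub>R v) + f x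
      = s * s * D2 f (x + a *\<^sub>R u + b *\<^sub>R v) u v"
    using second_difference_mean_value[OF C s, of x u v] near[of _ _ u v] d1(2)
    unfolding d_def by (smt (verit, ccfv_SIG))
  obtain a' b' where ab': "0 \<le> a'" "a' \<le> s" "0 \<le> b'" "b' \<le> s"
    "f (x + s *\<^sub>R v + s *\<^sub>R u) - f (x + s *\<^sub>R v) - f (x + s *\<^sub>R u) + f x
      = s * s * D2 f (x + a' *\<^sub>R v + b' *\<^sub>R u) v u"
    using second_difference_mean_value[OF C s, of x v u] near[of _ _ v u] d1(2)
    unfolding d_def by (smt (verit, ccfv_SIG))
  have eq: "x + s *\<^sub>R v + s *\<^sub>R u = x + s *\<^sub>R u + s *\<^sub>R v" by simp
  have "s * s * D2 f (x + a *\<^sub>R u + b *\<^sub>R v) u v = s * s * D2 f (x + a' *\<^sub>R v + b' *\<^sub>R u) v u"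
    using ab(5) ab'(5) unfolding eq by linarith
  then have "D2 f (x + a *\<^sub>R u + b *\<^sub>R v) u v = D2 f (x + a' *\<^sub>R v + b' *\<^sub>R u) v u"
    using s by simp
  moreover have "dist (D2 f (x + a *\<^sub>R u + b *\<^sub>R v) u v) (D2 f x u v) < \<epsilon>"
    using d1(2) near[OF ab(1-4), of u v] by (simp add: d_def)
  moreover have "dist (D2 f (x + a' *\<^sub>R v + b' *\<^sub>R u) v u) (D2 f x v u) < \<epsilon>"
    using d2(2) near[OF ab'(1-4), of v u] by (simp add: d_def)
  ultimately show False
    unfolding \<epsilon>_def dist_real_def by (smt (verit) field_sum_of_halves)
qed

lemma D3_symmetric:
  assumes "open S" and C: "Ck_on 3 f S" and x: "x \<in> S"
  shows "D3 f x u v w = D3 f x v u w" "D3 f x u v w = D3 f x u w v"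
proof -
  have C2: "Ck_on 2 f S"
    using C by (rule Ck_on_3_imp_2)
  show "D3 f x u v w = D3 f x v u w"
    unfolding D3_def by (rule D1_cong[OF assms(1) x]) (rule D2_symmetric[OF assms(1) C2])
  have "Ck_on 2 (\<lambda>y. D1 f y u) S"
    using C by (simp add: numeral_3_eq_3 numeral_2_eq_2)
  from D2_symmetric[OF assms(1) this x, of v w]
  show "D3 f x u v w = D3 f x u w v"
    by (simp add: D3_def D2_def)
qed

lemma linear_D2_right:
  "(\<lambda>y. D1 f y u) differentiable (at x) \<Longrightarrow> linear (D2 f x u)"
  unfolding D2_def[abs_def] by (rule linear_D1)

lemma bilinear_D2:
  assumes "open S" and C: "Ck_on 3 f S" and x: "x \<in> S"
  shows "bilinear (D2 f x)"
proof -
  have C2: "Ck_on 2 f S"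
    using C by (rule Ck_on_3_imp_2)
  have *: "linear (D2 f x u)" for u
    by (rule linear_D2_right) (rule Ck_on_3D[OF C x])
  moreover have "(\<lambda>u. D2 f x u v) = D2 f x v" for v
    by (rule ext) (rule D2_symmetric[OF assms(1) C2 x])
  ultimately show ?thesis
    by (simp add: bilinear_def)
qed

lemma linear_D3:
  assumes "open S" and C: "Ck_on 3 f S" and x: "x \<in> S"
  shows "linear (\<lambda>u. D3 f x u v w)" "linear (\<lambda>v. D3 f x u v w)" "linear (\<lambda>w. D3 f x u v w)"
proof -
  have *: "linear (\<lambda>w. D3 f x u v w)" for u v
    unfolding D3_def by (rule linear_D1) (rule Ck_on_3D[OF C x])
  then show "linear (\<lambda>w. D3 f x u v w)" .
  show "linear (\<lambda>v. D3 f x u v w)"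
    using *[of u w] by (subst D3_symmetric(2)[OF assms])
  show "linear (\<lambda>u. D3 f x u v w)"
    using *[of v w] by (subst D3_symmetric(1)[OF assms], subst D3_symmetric(2)[OF assms])
qed

text \<open>Justifies the definite description in the definition of the Hessian.\<close>

lemma hessian_inner:
  assumes b: "bilinear (D2 F x)"
  shows "linear (hessian F x)" "hessian F x u \<bullet> v = D2 F x u v"
proof -
  define H where "H = (\<lambda>u. \<Sum>i\<in>Basis. D2 F x u i *\<^sub>R i)"
  have "linear H"
    unfolding H_def
    by (rule linearI) (simp_all add: bilinear_ladd[OF b] bilinear_lmul[OF b] scaleR_add_left sum.distrib scaleR_right.sum)
  moreover have H: "H u \<bullet> v = D2 F x u v" for u v
  proof -
    have "D2 F x u v = D2 F x u (\<Sum>i\<in>Basis. (v \<bullet> i) *\<^sub>R i)" by (simp add: euclidean_representation)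
    also have "\<dots> = (\<Sum>i\<in>Basis. (v \<bullet> i) * D2 F x u i)"
      using b by (simp add: bilinear_def linear_sum linear_cmul)
    also have "\<dots> = H u \<bullet> v"
      unfolding H_def inner_sum_left by (intro sum.cong) (simp_all add: inner_commute mult.commute)
    finally show ?thesis by simp
  qed
  moreover have "A = H" if "linear A \<and> (\<forall>u v. A u \<bullet> v = D2 F x u v)" for A
    using that H by (metis ext vector_eq_rdot)
  ultimately have "\<exists>!A. linear A \<and> (\<forall>u v. A u \<bullet> v = D2 F x u v)" by blast
  then have "linear (hessian F x) \<and> (\<forall>u v. hessian F x u \<bullet> v = D2 F x u v)"
    unfolding hessian_def by (rule theI')
  then show "linear (hessian F x)" "hessian F x u \<bullet> v = D2 F x u v" by blast+
qed

section \<open>Linear algebra\<close>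

lemma linear_inv_bij:
  assumes "linear A" "bij A"
  shows "linear (inv A)"
  by (rule linearI; rule inv_f_eq[OF bij_is_inj[OF assms(2)]])
    (simp_all add: linear_add[OF assms(1)] linear_cmul[OF assms(1)] surj_f_inv_f[OF bij_is_surj[OF assms(2)]])

text \<open>A trilinear form that is symmetric in its first two arguments and alternating in its
  last two vanishes.\<close>

lemma symmetric_alternating_zero:
  fixes \<tau> :: "'b \<Rightarrow> 'b \<Rightarrow> 'b \<Rightarrow> real"
  assumes "\<And>x y z. \<tau> x y z = \<tau> y x z" "\<And>x y z. \<tau> x y z = - \<tau> x z y"
  shows "\<tau> x y z = 0"
proof -
  have "\<tau> x y z = - \<tau> x z y" by (rule assms(2))
  also have "\<dots> = - \<tau> z x y" using assms(1)[of x z y] by simp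
  also have "\<dots> = \<tau> z y x" using assms(2)[of z x y] by simp
  also have "\<dots> = \<tau> y z x" by (rule assms(1))
  also have "\<dots> = - \<tau> y x z" by (rule assms(2))
  also have "\<dots> = - \<tau> x y z" using assms(1)[of y x z] by simp
  finally show ?thesis by simp
qed

text \<open>The first-order condition at a minimum of a quadratic polynomial; the witness \<open>t = - r / (1 + \<bar>s\<bar>)\<close>
  makes the linear term dominate.\<close>

lemma quadratic_nonneg_imp_linear_zero:
  fixes r s :: real
  assumes "\<And>t. 2 * t * r + t\<^sup>2 * s \<ge> 0"
  shows "r = 0"
proof (rule ccontr)
  assume "r \<noteq> 0"
  define n where "n = 1 + \<bar>s\<bar>"
  have n: "n > 0" "s \<le> n" by (simp_all add: n_def)
  have "2 * (- r / n) * r + (- r / n)\<^sup>2 * s \<le> 2 * (- r / n) * r + (- r / n)\<^sup>2 * n"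
    using n by (intro add_left_mono mult_left_mono) auto
  also have "\<dots> = - (r\<^sup>2 / n)"
    using n by (simp add: power2_eq_square field_simps)
  also have "\<dots> < 0" using n \<open>r \<noteq> 0\<close> by simp
  finally show False using assms[of "- r / n"] by simp
qed

text \<open>At a maximum \<open>u\<close> of the Rayleigh quotient, with value \<open>\<mu>\<close>, the form \<open>\<mu> B v v - B (T v) v\<close> is nonnegative
  and vanishes at \<open>u\<close>. By the previous lemma \<open>u\<close> lies in its kernel, that is, \<open>T u = \<mu> u\<close>.\<close>

lemma selfadjoint_eigenvector:
  fixes T :: "'a::euclidean_space \<Rightarrow> 'a" and B :: "'a \<Rightarrow> 'a \<Rightarrow> real"
  assumes B: "bilinear B" and sym: "\<And>x y. B x y = B y x" and pos: "\<And>x. x \<noteq> 0 \<Longrightarrow> B x x > 0"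
    and T: "linear T" and self: "\<And>x y. B (T x) y = B x (T y)"
    and S: "subspace S" "T ` S \<subseteq> S" "\<exists>x\<in>S. x \<noteq> 0"
  shows "\<exists>u\<in>S. u \<noteq> 0 \<and> (\<exists>\<mu>. T u = \<mu> *\<^sub>R u)"
proof -
  define q where "q = (\<lambda>u. B (T u) u / B u u)"
  have contB: "continuous_on A (\<lambda>u. B (g u) (h u))"
    if "continuous_on A g" "continuous_on A h" for A and g h :: "'a \<Rightarrow> 'a"
    using bounded_bilinear.continuous_on[OF _ that] B bilinear_conv_bounded_bilinear by blast
  have contT: "continuous_on A T" for A
    using T by (simp add: linear_continuous_on linear_conv_bounded_linear)
  obtain z where z: "z \<in> S" "z \<noteq> 0" using S by auto
  have nonzero: "\<forall>u\<in>S \<inter> sphere 0 1. B u u \<noteq> 0"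
    using pos by (metis IntD2 dist_0_norm less_irrefl mem_sphere norm_zero zero_neq_one)
  have "compact (S \<inter> sphere 0 1)"
    using S(1) by (simp add: closed_Int_compact closed_subspace)
  moreover have "(1 / norm z) *\<^sub>R z \<in> S \<inter> sphere 0 1"
    using z S(1) by (simp add: subspace_scale)
  then have "S \<inter> sphere 0 1 \<noteq> {}" by blast
  moreover have "continuous_on (S \<inter> sphere 0 1) q"
    unfolding q_def by (intro continuous_on_divide contB contT continuous_on_id nonzero)
  ultimately obtain u where "u \<in> S \<inter> sphere 0 1" "\<forall>v\<in>S \<inter> sphere 0 1. q v \<le> q u"
    using continuous_attains_sup[of "S \<inter> sphere 0 1" q] by blast
  then have u: "u \<in> S" "norm u = 1" and
    max: "\<And>v. v \<in> S \<Longrightarrow> norm v = 1 \<Longrightarrow> q v \<le> q u"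
    by auto
  define \<mu> where "\<mu> = q u"
  have u0: "u \<noteq> 0" using u by auto
  have le: "B (T v) v \<le> \<mu> * B v v" if "v \<in> S" for v
  proof (cases "v = 0")
    case True
    then show ?thesis by (simp add: bilinear_rzero[OF B])
  next
    case False
    define w where "w = (1 / norm v) *\<^sub>R v"
    have w: "w \<in> S" "norm w = 1" "w \<noteq> 0"
      using False that S(1) by (auto simp: w_def subspace_scale)
    have vw: "v = norm v *\<^sub>R w" using False by (simp add: w_def)
    have "q w = B (T w) w / B w w" by (simp add: q_def)
    then have "B (T w) w \<le> \<mu> * B w w"
      using max[OF w(1,2)] pos[OF w(3)] by (simp add: \<mu>_def divide_le_eq)
    then have "norm v * norm v * B (T w) w \<le> norm v * norm v * (\<mu> * B w w)"
      by (intro mult_left_mono) auto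
    moreover have "B (T (n *\<^sub>R w)) (n *\<^sub>R w) = n * n * B (T w) w"
      "B (n *\<^sub>R w) (n *\<^sub>R w) = n * n * B w w" for n
      by (simp_all add: linear_cmul[OF T] bilinear_lmul[OF B] bilinear_rmul[OF B])
    from this[of "norm v"] have "B (T v) v = norm v * norm v * B (T w) w"
      "B v v = norm v * norm v * B w w"
      by (simp_all only: vw[symmetric])
    ultimately show ?thesis by (simp add: algebra_simps)
  qed
  have eq: "B (T u) u = \<mu> * B u u"
    using pos[OF u0] by (simp add: \<mu>_def q_def)
  have zero: "\<mu> * B u v - B (T u) v = 0" if v: "v \<in> S" for v
  proof (rule quadratic_nonneg_imp_linear_zero)
    fix t :: real
    have mem: "u + t *\<^sub>R v \<in> S" using u v S(1) by (simp add: subspace_add subspace_scale)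
    have Tvu: "B (T v) u = B (T u) v" using self sym by metis
    have "0 \<le> \<mu> * B (u + t *\<^sub>R v) (u + t *\<^sub>R v) - B (T (u + t *\<^sub>R v)) (u + t *\<^sub>R v)"
      using le[OF mem] by simp
    also have "\<dots> = 2 * t * (\<mu> * B u v - B (T u) v) + t\<^sup>2 * (\<mu> * B v v - B (T v) v)"
      using eq sym[of v u] Tvu
      by (simp add: linear_add[OF T] linear_cmul[OF T] bilinear_ladd[OF B] bilinear_radd[OF B]
          bilinear_lmul[OF B] bilinear_rmul[OF B] power2_eq_square algebra_simps)
    finally show "0 \<le> 2 * t * (\<mu> * B u v - B (T u) v) + t\<^sup>2 * (\<mu> * B v v - B (T v) v)" .
  qed
  define r where "r = \<mu> *\<^sub>R u - T u"
  have "r \<in> S" using u S unfolding r_def by (auto simp: subspace_diff subspace_scale)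
  then have "B r r = 0"
    using zero[of r] by (simp add: r_def bilinear_lsub[OF B] bilinear_lmul[OF B])
  then have "r = 0" using pos[of r] by force
  then have "T u = \<mu> *\<^sub>R u" by (simp add: r_def)
  then show ?thesis using u u0 by blast
qed

text \<open>Induction on the dimension, splitting off an eigenvector and passing to its orthogonal
  complement. The summands are indexed by their eigenvalues, so that different summands
  belong to different eigenvalues.\<close>

lemma selfadjoint_eigen_decomposition:
  fixes T :: "'a::euclidean_space \<Rightarrow> 'a" and B :: "'a \<Rightarrow> 'a \<Rightarrow> real"
  assumes B: "bilinear B" and sym: "\<And>x y. B x y = B y x" and pos: "\<And>x. x \<noteq> 0 \<Longrightarrow> B x x > 0"
    and T: "linear T" and self: "\<And>x y. B (T x) y = B x (T y)"
    and "subspace S" "T ` S \<subseteq> S" "v \<in> S"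
  shows "\<exists>c \<Lambda>. finite \<Lambda> \<and> (\<forall>l. c l \<in> S \<and> T (c l) = l *\<^sub>R c l) \<and> v = (\<Sum>l\<in>\<Lambda>. c l)"
  using assms(6-)
proof (induction "dim S" arbitrary: S v rule: less_induct)
  case less
  show ?case
  proof (cases "\<exists>x\<in>S. x \<noteq> 0")
    case False
    then have "v = 0" using less.prems by blast
    then show ?thesis
      using less.prems(1)
      by (intro exI[of _ "\<lambda>_. 0"] exI[of _ "{}"]) (simp add: subspace_0 linear_0[OF T])
  next
    case True
    obtain u \<mu> where u: "u \<in> S" "u \<noteq> 0" "T u = \<mu> *\<^sub>R u"
      using selfadjoint_eigenvector[OF B sym pos T self less.prems(1,2) True] by blast
    define S' where "S' = {x \<in> S. B u x = 0}"
    have S': "subspace S'"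
      using less.prems(1) unfolding S'_def subspace_def
      by (simp add: bilinear_rzero[OF B] bilinear_radd[OF B] bilinear_rmul[OF B])
    have inv: "T ` S' \<subseteq> S'"
    proof
      fix y assume "y \<in> T ` S'"
      then obtain x where x: "x \<in> S" "B u x = 0" "y = T x" by (auto simp: S'_def)
      have "B u (T x) = \<mu> * B u x" by (simp add: self[symmetric] u bilinear_lmul[OF B])
      then show "y \<in> S'" using x less.prems(2) by (auto simp: S'_def)
    qed
    have "S' \<subseteq> S" "u \<notin> S'" using pos[OF u(2)] by (auto simp: S'_def)
    then have "S' \<subset> S" using u(1) by blast
    moreover have "span S' = S'" "span S = S" using S' less.prems(1) by (simp_all add: span_eq_iff)
    ultimately have dim: "dim S' < dim S" by (metis dim_psubset)
    define \<alpha> where "\<alpha> = B u v / B u u"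
    have "v - \<alpha> *\<^sub>R u \<in> S'"
      using less.prems u pos[OF u(2)]
      by (simp add: S'_def subspace_diff subspace_scale \<alpha>_def bilinear_rsub[OF B] bilinear_rmul[OF B])
    from less.hyps[OF dim S' inv this] obtain c \<Lambda> where
      c: "finite \<Lambda>" "\<And>l. c l \<in> S'" "\<And>l. T (c l) = l *\<^sub>R c l" "v - \<alpha> *\<^sub>R u = (\<Sum>l\<in>\<Lambda>. c l)"
      by blast
    define c' where "c' = c(\<mu> := (if \<mu> \<in> \<Lambda> then c \<mu> else 0) + \<alpha> *\<^sub>R u)"
    have "(\<Sum>l\<in>insert \<mu> \<Lambda>. c' l) = c' \<mu> + (\<Sum>l\<in>\<Lambda>-{\<mu>}. c l)"
      using c(1) by (subst sum.insert_remove) (auto simp: c'_def intro!: sum.cong)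
    also have "\<dots> = \<alpha> *\<^sub>R u + (\<Sum>l\<in>\<Lambda>. c l)"
      using c(1) by (simp add: c'_def sum.remove[of \<Lambda> \<mu>])
    finally have "v = (\<Sum>l\<in>insert \<mu> \<Lambda>. c' l)" using c(4) by (simp add: algebra_simps)
    moreover have "c' l \<in> S \<and> T (c' l) = l *\<^sub>R c' l" for l
      using c(2)[of l] c(2)[of \<mu>] c(3)[of l] c(3)[of \<mu>] u less.prems(1) \<open>S' \<subseteq> S\<close>
      by (auto simp: c'_def subspace_add subspace_scale linear_add[OF T] linear_cmul[OF T] linear_0[OF T] scaleR_add_right subset_iff)
    ultimately show ?thesis using c(1) by (intro exI[of _ c'] exI[of _ "insert \<mu> \<Lambda>"]) auto
  qed
qed

section \<open>Euclidean Jordan algebras\<close>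

locale euclidean_jordan =
  fixes P :: "'a::euclidean_space \<Rightarrow> 'a \<Rightarrow> 'a"  (infixl "\<odot>" 70)
    and e :: 'a
    and B :: "'a \<Rightarrow> 'a \<Rightarrow> real"
  assumes bilinear_P: "bilinear P"
    and comm: "x \<odot> y = y \<odot> x"
    and jordan: "x \<odot> ((x \<odot> x) \<odot> y) = (x \<odot> x) \<odot> (x \<odot> y)"
    and unit: "e \<odot> x = x"
    and bilinear_B: "bilinear B"
    and B_sym: "B x y = B y x"
    and B_pos: "x \<noteq> 0 \<Longrightarrow> B x x > 0"
    and B_assoc: "B (x \<odot> y) z = B y (x \<odot> z)"
begin

lemmas P_linear = bilinear_ladd[OF bilinear_P] bilinear_radd[OF bilinear_P]
  bilinear_lmul[OF bilinear_P] bilinear_rmul[OF bilinear_P]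
  bilinear_lsub[OF bilinear_P] bilinear_rsub[OF bilinear_P]
  bilinear_lzero[OF bilinear_P] bilinear_rzero[OF bilinear_P]

lemmas B_linear = bilinear_ladd[OF bilinear_B] bilinear_radd[OF bilinear_B]
  bilinear_lmul[OF bilinear_B] bilinear_rmul[OF bilinear_B]
  bilinear_lsub[OF bilinear_B] bilinear_rsub[OF bilinear_B]
  bilinear_lzero[OF bilinear_B] bilinear_rzero[OF bilinear_B]

lemma linear_P_right: "linear (P x)"
  using bilinear_P by (simp add: bilinear_def)

lemma P_sum_right: "x \<odot> (\<Sum>i\<in>I. f i) = (\<Sum>i\<in>I. x \<odot> f i)"
  by (rule linear_sum[OF linear_P_right])

lemma P_sum_left: "(\<Sum>i\<in>I. f i) \<odot> x = (\<Sum>i\<in>I. f i \<odot> x)"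
  by (simp add: comm[of _ x] P_sum_right)

lemma linear_B_right: "linear (B x)"
  using bilinear_B by (simp add: bilinear_def)

lemma B_sum_right: "B x (\<Sum>i\<in>I. f i) = (\<Sum>i\<in>I. B x (f i))"
  by (rule linear_sum[OF linear_B_right])

lemma B_sum_left: "B (\<Sum>i\<in>I. f i) x = (\<Sum>i\<in>I. B (f i) x)"
  by (simp add: B_sym[of _ x] B_sum_right)

lemma B_eq_0_iff: "B x x = 0 \<longleftrightarrow> x = 0"
  by (metis B_pos B_linear(7) less_irrefl)

lemma B_ge_0: "B x x \<ge> 0"
  using B_pos[of x] by (cases "x = 0") (auto simp: B_linear)

lemma unit_right: "x \<odot> e = x"
  by (simp add: comm[of x] unit)

subsection \<open>Power associativity\<close>

text \<open>The Jordan identity is cubic in \<open>x\<close>; inclusion and exclusion over sums of \<open>a\<close>, \<open>b\<close>, \<open>c\<close> extracts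
  the part that is linear in each of them.\<close>

lemma jordan_linearized:
  "a \<odot> ((b \<odot> c) \<odot> y) + b \<odot> ((c \<odot> a) \<odot> y) + c \<odot> ((a \<odot> b) \<odot> y)
   = (b \<odot> c) \<odot> (a \<odot> y) + (c \<odot> a) \<odot> (b \<odot> y) + (a \<odot> b) \<odot> (c \<odot> y)" (is "?l = ?r")
proof -
  define f where "f = (\<lambda>x. x \<odot> ((x \<odot> x) \<odot> y) - (x \<odot> x) \<odot> (x \<odot> y))"
  have f: "f x = 0" for x by (simp add: f_def jordan)
  have "f (a + b + c) - f (a + b) - f (b + c) - f (a + c) + f a + f b + f c = 2 *\<^sub>R (?l - ?r)"
    by (simp add: f_def P_linear scaleR_2 comm[of b a] comm[of c a] comm[of c b] algebra_simps)
  then show ?thesis by (simp add: f)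
qed

text \<open>The linearized identity read as a formula for the multiplication operator of a product of
  three elements.\<close>

lemma mult_product:
  "((x \<odot> y) \<odot> a) \<odot> z = (x \<odot> a) \<odot> (y \<odot> z) + (y \<odot> a) \<odot> (x \<odot> z) + (x \<odot> y) \<odot> (a \<odot> z)
     - x \<odot> (a \<odot> (y \<odot> z)) - y \<odot> (a \<odot> (x \<odot> z))"
  using jordan_linearized[of x y z a] by (simp add: comm algebra_simps)

definition jpower :: "'a \<Rightarrow> nat \<Rightarrow> 'a" where
  "jpower x n = (P x ^^ n) e"

lemma jpower_simps: "jpower x 0 = e" "jpower x (Suc n) = x \<odot> jpower x n"
  by (simp_all add: jpower_def)

lemma square_mult_jpower: "(x \<odot> x) \<odot> jpower x n = jpower x (Suc (Suc n))"
  by (induction n) (simp_all add: jpower_simps unit_right flip: jordan)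

text \<open>Multiplication by \<open>x\<^bsup>n+2\<^esup> = (x \<odot> x) \<odot> x\<^bsup>n\<^esup>\<close> is, by \<open>mult_product\<close>, a polynomial in the operators of
  \<open>x\<close>, \<open>x \<odot> x\<close>, \<open>x\<^bsup>n\<^esup>\<close> and \<open>x\<^bsup>n+1\<^esup>\<close>, all of which commute with that of \<open>x\<close> by induction.\<close>

lemma jpower_operator_commute: "jpower x n \<odot> (x \<odot> z) = x \<odot> (jpower x n \<odot> z)"
proof (induction n arbitrary: z rule: less_induct)
  case (less n)
  consider "n = 0" | "n = 1" | k where "n = Suc (Suc k)"
    by (metis One_nat_def not0_implies_Suc)
  then show ?case
  proof cases
    case 3
    have a: "jpower x k \<odot> (x \<odot> z) = x \<odot> (jpower x k \<odot> z)" for z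
      using less.IH 3 by simp
    have b: "jpower x (Suc k) \<odot> (x \<odot> z) = x \<odot> (jpower x (Suc k) \<odot> z)" for z
      using less.IH 3 by simp
    have c: "(x \<odot> x) \<odot> (x \<odot> z) = x \<odot> ((x \<odot> x) \<odot> z)" for z
      by (rule jordan[symmetric])
    have *: "jpower x n \<odot> w = 2 *\<^sub>R (jpower x (Suc k) \<odot> (x \<odot> w)) + (x \<odot> x) \<odot> (jpower x k \<odot> w)
        - 2 *\<^sub>R (x \<odot> (jpower x k \<odot> (x \<odot> w)))" for w
      using mult_product[of x x "jpower x k" w]
      by (simp add: 3 square_mult_jpower scaleR_2 jpower_simps(2)[of x k, symmetric] algebra_simps)
    show ?thesis
      unfolding * by (simp add: P_linear a b c)
  qed (simp_all add: jpower_simps unit unit_right)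
qed

subsection \<open>Idempotents\<close>

abbreviation idem :: "'a \<Rightarrow> bool" where
  "idem c \<equiv> c \<odot> c = c"

text \<open>Multiplication by an idempotent \<open>c\<close> has only the eigenvalues 1, 1/2 and 0 (\<open>idem_cubic\<close>). The
  following are the interpolation polynomials in that operator that project to its eigenspaces.\<close>

definition peirce1 :: "'a \<Rightarrow> 'a \<Rightarrow> 'a" where
  "peirce1 c v = 2 *\<^sub>R (c \<odot> (c \<odot> v)) - c \<odot> v"

definition peirce_half :: "'a \<Rightarrow> 'a \<Rightarrow> 'a" where
  "peirce_half c v = 4 *\<^sub>R (c \<odot> v) - 4 *\<^sub>R (c \<odot> (c \<odot> v))"

definition peirce0 :: "'a \<Rightarrow> 'a \<Rightarrow> 'a" where
  "peirce0 c v = v - 3 *\<^sub>R (c \<odot> v) + 2 *\<^sub>R (c \<odot> (c \<odot> v))"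

lemmas peirce_defs = peirce1_def peirce_half_def peirce0_def

lemma idem_cubic:
  assumes "idem c"
  shows "2 *\<^sub>R (c \<odot> (c \<odot> (c \<odot> v))) = 3 *\<^sub>R (c \<odot> (c \<odot> v)) - c \<odot> v"
proof -
  have "c \<odot> v = c \<odot> (c \<odot> v) + c \<odot> (c \<odot> v) + c \<odot> (c \<odot> v)
      - c \<odot> (c \<odot> (c \<odot> v)) - c \<odot> (c \<odot> (c \<odot> v))"
    using mult_product[of c c c v] by (simp add: assms)
  moreover have "3 *\<^sub>R w = w + w + w" for w :: 'a
    using scaleR_add_left[of 1 2 w] by (simp add: scaleR_2)
  ultimately show ?thesis by (simp add: scaleR_2 algebra_simps)
qed

lemma peirce_sum: "peirce1 c v + peirce_half c v + peirce0 c v = v"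
proof -
  have "3 *\<^sub>R w = 4 *\<^sub>R w - w" for w :: 'a
    using scaleR_diff_left[of 4 1 w] by simp
  moreover have "4 *\<^sub>R w = 2 *\<^sub>R w + 2 *\<^sub>R w" for w :: 'a
    using scaleR_add_left[of 2 2 w] by simp
  ultimately show ?thesis unfolding peirce_defs by simp
qed

lemma peirce_eigen:
  assumes "idem c"
  shows "c \<odot> peirce1 c v = peirce1 c v"
    "c \<odot> peirce_half c v = (1/2) *\<^sub>R peirce_half c v"
    "c \<odot> peirce0 c v = 0"
proof -
  have 2: "c \<odot> (c \<odot> (c \<odot> v)) = (3/2) *\<^sub>R (c \<odot> (c \<odot> v)) - (1/2) *\<^sub>R (c \<odot> v)"
    using arg_cong[OF idem_cubic[OF assms, of v], of "\<lambda>w. (1/2) *\<^sub>R w"] by (simp add: algebra_simps)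
  show "c \<odot> peirce1 c v = peirce1 c v"
    "c \<odot> peirce_half c v = (1/2) *\<^sub>R peirce_half c v"
    "c \<odot> peirce0 c v = 0"
    unfolding peirce_defs P_linear 2
    by (auto simp: euclidean_eq_iff[where 'a='a] inner_simps algebra_simps)
qed

lemma peirce_orthogonal:
  assumes "idem c"
  shows "B (peirce1 c v) (peirce_half c w) = 0" "B (peirce1 c v) (peirce0 c w) = 0"
    "B (peirce_half c v) (peirce0 c w) = 0"
proof -
  have *: "B x y = 0" if "c \<odot> x = \<alpha> *\<^sub>R x" "c \<odot> y = \<beta> *\<^sub>R y" "\<alpha> \<noteq> \<beta>" for x y \<alpha> \<beta>
    using B_assoc[of c x y] that by (simp add: B_linear)
  show "B (peirce1 c v) (peirce_half c w) = 0" "B (peirce1 c v) (peirce0 c w) = 0"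
    "B (peirce_half c v) (peirce0 c w) = 0"
    using *[of "peirce1 c v" 1 "peirce_half c w" "1/2"] *[of "peirce1 c v" 1 "peirce0 c w" 0]
      *[of "peirce_half c v" "1/2" "peirce0 c w" 0] peirce_eigen[OF assms]
    by simp_all
qed

lemma mult_peirce: "idem c \<Longrightarrow> c \<odot> v = peirce1 c v + (1/2) *\<^sub>R peirce_half c v"
  by (subst peirce_sum[of c v, symmetric]) (simp only: P_linear(2) peirce_eigen add_0_right)

lemma B_idem_mult:
  assumes "idem c"
  shows "B (c \<odot> v) v = B (peirce1 c v) (peirce1 c v) + (1/2) * B (peirce_half c v) (peirce_half c v)"
proof -
  have "B (c \<odot> v) v = B (peirce1 c v + (1/2) *\<^sub>R peirce_half c v)
      (peirce1 c v + peirce_half c v + peirce0 c v)"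
    by (simp only: mult_peirce[OF assms, of v] peirce_sum)
  then show ?thesis
    using peirce_orthogonal[OF assms, of v v] B_sym[of "peirce_half c v" "peirce1 c v"]
    by (simp add: B_linear)
qed

text \<open>In the Peirce decomposition \<open>v = v\<^sub>1 + v\<^sub>2 + v\<^sub>0\<close> the form \<open>B (c \<odot> v) v\<close> is \<open>B v\<^sub>1 v\<^sub>1 + 1/2 B v\<^sub>2 v\<^sub>2\<close>. All
  positivity statements about squares and idempotents derive from this.\<close>

lemma idem_mult_nonneg: "idem c \<Longrightarrow> B (c \<odot> v) v \<ge> 0"
  by (simp add: B_idem_mult B_ge_0)

lemma idem_mult_eq_0:
  assumes "idem c" "B (c \<odot> v) v = 0"
  shows "c \<odot> v = 0"
proof -
  have "B (peirce1 c v) (peirce1 c v) = 0" "B (peirce_half c v) (peirce_half c v) = 0"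
    using assms B_idem_mult[OF assms(1), of v] B_ge_0[of "peirce1 c v"] B_ge_0[of "peirce_half c v"]
    by linarith+
  then show ?thesis using mult_peirce[OF assms(1), of v] by (simp add: B_eq_0_iff)
qed

lemma B_idem_idem:
  assumes "idem c"
  shows "B (d \<odot> c) c = B c d"
  using B_assoc[of c d c] by (simp add: assms comm[of d c] B_sym[of d c])

lemma idem_nonneg: "idem c \<Longrightarrow> idem d \<Longrightarrow> B c d \<ge> 0"
  using idem_mult_nonneg[of d c] by (simp add: B_idem_idem)

lemma idem_orthogonal: "idem c \<Longrightarrow> idem d \<Longrightarrow> B c d = 0 \<Longrightarrow> c \<odot> d = 0"
  using idem_mult_eq_0[of d c] by (simp add: B_idem_idem comm[of c d])

lemma idem_orthogonal_B: "idem c \<Longrightarrow> c \<odot> d = 0 \<Longrightarrow> B c d = 0"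
  using B_assoc[of c c d] by (simp add: B_linear)

lemma idem_sum_orthogonal:
  assumes "idem a" "idem b" "idem (a + b)"
  shows "a \<odot> b = 0"
proof -
  have "2 *\<^sub>R (a \<odot> b) = 0"
    using assms comm[of b a] by (simp add: P_linear scaleR_2)
  then show ?thesis by simp
qed

subsection \<open>The spectral theorem\<close>

definition orthosystem :: "'a \<Rightarrow> 'a set \<Rightarrow> bool" where
  "orthosystem u D \<longleftrightarrow> finite D \<and> (\<forall>d\<in>D. idem d \<and> d \<noteq> 0) \<and>
     (\<forall>c\<in>D. \<forall>d\<in>D. c \<noteq> d \<longrightarrow> c \<odot> d = 0) \<and> (\<Sum>d\<in>D. d) = u"

lemma orthosystem_mult:
  assumes "orthosystem u D" "d \<in> D"
  shows "(\<Sum>c\<in>D. l c *\<^sub>R c) \<odot> d = l d *\<^sub>R d"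
proof -
  have "(\<Sum>c\<in>D. l c *\<^sub>R c) \<odot> d = (\<Sum>c\<in>D. if c = d then l d *\<^sub>R d else 0)"
    unfolding P_sum_left using assms by (intro sum.cong) (auto simp: orthosystem_def P_linear)
  then show ?thesis using assms by (simp add: orthosystem_def)
qed

lemma orthosystem_B:
  assumes "orthosystem u D" "c \<in> D" "d \<in> D" "c \<noteq> d"
  shows "B c d = 0"
  using assms by (simp add: orthosystem_def idem_orthogonal_B)

lemma orthosystem_B_sum:
  assumes "orthosystem u D" "d \<in> D"
  shows "B (\<Sum>c\<in>D. l c *\<^sub>R c) d = l d * B d d"
proof -
  have "B (\<Sum>c\<in>D. l c *\<^sub>R c) d = (\<Sum>c\<in>D. if c = d then l d * B d d else 0)"
    unfolding B_sum_left using assms orthosystem_B[OF assms(1)]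
    by (intro sum.cong) (auto simp: B_linear)
  then show ?thesis using assms by (simp add: orthosystem_def)
qed

lemma orthosystem_mult_sum:
  assumes "orthosystem u D"
  shows "(\<Sum>c\<in>D. l c *\<^sub>R c) \<odot> (\<Sum>d\<in>D. k d *\<^sub>R d) = (\<Sum>d\<in>D. (l d * k d) *\<^sub>R d)"
  unfolding P_sum_right using orthosystem_mult[OF assms]
  by (intro sum.cong) (auto simp: P_linear mult.commute)

lemma orthosystem_card_le:
  assumes D: "orthosystem e D"
  shows "card D \<le> DIM('a)"
proof -
  have "independent D"
  proof
    assume "dependent D"
    then obtain u d where u: "d \<in> D" "u d \<noteq> 0" "(\<Sum>v\<in>D. u v *\<^sub>R v) = 0"
      using D by (auto simp: dependent_finite orthosystem_def)
    then have "u d *\<^sub>R d = 0"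
      using orthosystem_mult[OF D u(1), of u] by (simp add: P_linear)
    then show False using u D by (auto simp: orthosystem_def)
  qed
  then show ?thesis using independent_bound by blast
qed

text \<open>The unit is a sum of eigenvectors \<open>c\<^sub>l\<close> of multiplication by \<open>x\<close> in the span of the powers of \<open>x\<close>.
  Since elements of this span commute with \<open>x\<close> as operators, \<open>x \<odot> (c\<^sub>l \<odot> c\<^sub>k)\<close> is both
  \<open>l (c\<^sub>l \<odot> c\<^sub>k)\<close> and \<open>k (c\<^sub>l \<odot> c\<^sub>k)\<close>; so \<open>c\<^sub>l \<odot> c\<^sub>k = 0\<close> for \<open>l \<noteq> k\<close>, and \<open>c\<^sub>l = e \<odot> c\<^sub>l\<close> is idempotent.\<close>

lemma spectral_orthosystem: "\<exists>D l. orthosystem e D \<and> x = (\<Sum>d\<in>D. l d *\<^sub>R d)"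
proof -
  define S where "S = span (range (jpower x))"
  have S: "subspace S" by (simp add: S_def)
  have "x \<odot> y \<in> S" if "y \<in> S" for y
    using that unfolding S_def
  proof (induction rule: span_induct_alt)
    case base
    show ?case by (simp add: P_linear span_zero)
  next
    case (step c y z)
    obtain n where "y = jpower x n" using step(1) by blast
    then have "x \<odot> y = jpower x (Suc n)" by (simp add: jpower_simps)
    then have "x \<odot> y \<in> span (range (jpower x))" by (simp add: span_base)
    then show ?case using step by (simp add: P_linear span_add span_scale)
  qed
  then have inv: "P x ` S \<subseteq> S" by blast
  have "e \<in> S" unfolding S_def using jpower_simps(1) by (metis rangeI span_base)
  then obtain c \<Lambda> where c: "finite \<Lambda>" "\<And>l. c l \<in> S" "\<And>l. x \<odot> c l = l *\<^sub>R c l" "e = (\<Sum>l\<in>\<Lambda>. c l)"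
    using selfadjoint_eigen_decomposition[OF bilinear_B B_sym B_pos linear_P_right _ S inv]
    by (metis B_assoc B_sym)
  have commute: "a \<odot> (x \<odot> z) = x \<odot> (a \<odot> z)" if "a \<in> S" for a z
    using that unfolding S_def
    by (induction rule: span_induct_alt) (auto simp: P_linear jpower_operator_commute)
  have orth: "c l \<odot> c k = 0" if "l \<noteq> k" for l k
  proof -
    have "k *\<^sub>R (c l \<odot> c k) = x \<odot> (c l \<odot> c k)"
      using commute[OF c(2), of l "c k"] by (simp add: c(3) P_linear)
    also have "\<dots> = l *\<^sub>R (c l \<odot> c k)"
      using commute[OF c(2), of k "c l"] by (simp add: c(3) P_linear comm[of "c k" "c l"])
    finally show ?thesis using that by simp
  qed
  then have orth': "c l \<odot> c k = 0" if "c l \<noteq> c k" for l k using that by metis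
  have idem: "idem (c l)" if "l \<in> \<Lambda>" for l
  proof -
    have "c l = (\<Sum>k\<in>\<Lambda>. c k) \<odot> c l" by (simp add: c(4)[symmetric] unit)
    also have "\<dots> = (\<Sum>k\<in>\<Lambda>. if k = l then c l \<odot> c l else 0)"
      unfolding P_sum_left by (intro sum.cong) (auto simp: orth)
    finally show ?thesis using that c(1) by simp
  qed
  define \<Lambda>' where "\<Lambda>' = {l \<in> \<Lambda>. c l \<noteq> 0}"
  have inj: "inj_on c \<Lambda>'"
    using orth idem unfolding inj_on_def \<Lambda>'_def by (metis (mono_tags, lifting) mem_Collect_eq)
  have fin: "finite \<Lambda>'" using c(1) by (simp add: \<Lambda>'_def)
  have e: "e = (\<Sum>l\<in>\<Lambda>'. c l)"
    unfolding c(4) \<Lambda>'_def using c(1) by (intro sum.mono_neutral_right) auto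
  have D: "orthosystem e (c ` \<Lambda>')"
    unfolding orthosystem_def using fin idem orth' inj
    by (auto simp: \<Lambda>'_def[symmetric] sum.reindex e) (auto simp: \<Lambda>'_def)
  have "x = (\<Sum>l\<in>\<Lambda>'. l *\<^sub>R c l)"
    by (metis (no_types, lifting) P_sum_right c(3) e sum.cong unit_right)
  also have "\<dots> = (\<Sum>d\<in>c ` \<Lambda>'. the_inv_into \<Lambda>' c d *\<^sub>R d)"
    using inj by (simp add: sum.reindex the_inv_into_f_f)
  finally show ?thesis using D by blast
qed

abbreviation frame :: "'a set \<Rightarrow> bool" where
  "frame D \<equiv> jordan_frame UNIV P e D"

abbreviation primitive :: "'a \<Rightarrow> bool" where
  "primitive d \<equiv> primitive_idempotent UNIV P d"

lemma primitive_idem: "primitive d \<Longrightarrow> idem d" "primitive d \<Longrightarrow> d \<noteq> 0"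
  by (auto simp: primitive_idempotent_def idempotent_in_def)

lemma frame_orthosystem: "frame D \<Longrightarrow> orthosystem e D"
  by (auto simp: jordan_frame_def orthosystem_def primitive_idem)

lemma frame_primitive: "frame D \<Longrightarrow> d \<in> D \<Longrightarrow> primitive d"
  by (simp add: jordan_frame_def)

text \<open>If \<open>d = a + b\<close>, then for every other \<open>c\<close> of the system \<open>0 = B d c = B a c + B b c\<close> with both
  summands nonnegative, so \<open>a\<close> and \<open>b\<close> are orthogonal to \<open>c\<close>.\<close>

lemma orthosystem_split:
  assumes D: "orthosystem e D" "x = (\<Sum>d\<in>D. l d *\<^sub>R d)" and d: "d \<in> D" "\<not> primitive d"
  shows "\<exists>D' l'. orthosystem e D' \<and> x = (\<Sum>d\<in>D'. l' d *\<^sub>R d) \<and> card D' > card D"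
proof -
  obtain a b where ab: "idem a" "a \<noteq> 0" "idem b" "b \<noteq> 0" "d = a + b"
    using d D(1) by (auto simp: primitive_idempotent_def idempotent_in_def orthosystem_def)
  have dd: "idem d" and fin: "finite D" using D(1) d by (auto simp: orthosystem_def)
  have orth: "a \<odot> b = 0" using idem_sum_orthogonal ab dd by simp
  define R where "R = D - {d}"
  have R: "idem c" "B a c = 0" "B b c = 0" if "c \<in> R" for c
  proof -
    show c: "idem c" using that D(1) by (auto simp: R_def orthosystem_def)
    have "B d c = 0" using that D(1) d by (auto simp: R_def intro: orthosystem_B[OF D(1)])
    then show "B a c = 0" "B b c = 0"
      using idem_nonneg[OF ab(1) c] idem_nonneg[OF ab(3) c] by (simp_all add: ab(5) B_linear)
  qed
  have R': "a \<odot> c = 0" "b \<odot> c = 0" if "c \<in> R" for c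
    using R[OF that] ab idem_orthogonal by auto
  have "a \<notin> R" using R(2)[of a] ab(2) B_eq_0_iff by blast
  have "b \<notin> R" using R(3)[of b] ab(4) B_eq_0_iff by blast
  have "a \<noteq> b" using orth ab by auto
  have "finite R" using fin by (simp add: R_def)
  have sum: "(\<Sum>c\<in>insert a (insert b R). f c) = f a + (f b + (\<Sum>c\<in>R. f c))" for f :: "'a \<Rightarrow> 'a"
    using \<open>a \<notin> R\<close> \<open>b \<notin> R\<close> \<open>a \<noteq> b\<close> \<open>finite R\<close> by simp
  have card: "card (insert a (insert b R)) = Suc (Suc (card R))"
    using \<open>a \<notin> R\<close> \<open>b \<notin> R\<close> \<open>a \<noteq> b\<close> \<open>finite R\<close> by simp
  have sumD: "(\<Sum>c\<in>D. f c) = f d + (\<Sum>c\<in>R. f c)" for f :: "'a \<Rightarrow> 'a"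
    unfolding R_def using fin d(1) by (rule sum.remove)
  have e: "(\<Sum>c\<in>insert a (insert b R). c) = e"
    unfolding sum using sumD[of "\<lambda>c. c"] D(1) ab by (simp add: orthosystem_def add.assoc)
  have R'': "c \<odot> a = 0" "c \<odot> b = 0" if "c \<in> R" for c
    using R'[OF that] by (simp_all only: comm[of c])
  have RR: "idem c" "c \<noteq> 0" "c' \<in> R \<Longrightarrow> c \<noteq> c' \<Longrightarrow> c \<odot> c' = 0" if "c \<in> R" for c c'
    using that D(1) by (simp_all add: R_def orthosystem_def)
  have "b \<odot> a = 0" using orth by (simp only: comm[of b])
  have "orthosystem e (insert a (insert b R))"
    unfolding orthosystem_def
  proof (intro conjI ballI impI e)
    fix c c' assume "c \<in> insert a (insert b R)" "c' \<in> insert a (insert b R)" "c \<noteq> c'"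
    then show "c \<odot> c' = 0"
      using R' R'' RR(3) orth \<open>b \<odot> a = 0\<close> by (elim insertE) simp_all
  qed (use ab RR(1,2) \<open>finite R\<close> in auto)
  moreover have "x = (\<Sum>c\<in>insert a (insert b R). (l(a := l d, b := l d)) c *\<^sub>R c)"
  proof -
    define l' where "l' = l(a := l d, b := l d)"
    have l': "l' a = l d" "l' b = l d" "c \<in> R \<Longrightarrow> l' c = l c" for c
      using \<open>a \<notin> R\<close> \<open>b \<notin> R\<close> by (auto simp: l'_def)
    have "(\<Sum>c\<in>R. l' c *\<^sub>R c) = (\<Sum>c\<in>R. l c *\<^sub>R c)"
      by (intro sum.cong refl) (simp only: l'(3))
    then have "(\<Sum>c\<in>insert a (insert b R). l' c *\<^sub>R c) = l d *\<^sub>R (a + b) + (\<Sum>c\<in>R. l c *\<^sub>R c)"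
      unfolding sum by (simp only: l' scaleR_add_right add.assoc)
    also have "\<dots> = x" unfolding D(2) sumD ab(5)[symmetric] ..
    finally show ?thesis unfolding l'_def ..
  qed
  moreover have "card D = Suc (card R)" unfolding R_def by (rule card_Suc_Diff1[OF fin d(1), symmetric])
  ultimately show ?thesis using card by (metis lessI)
qed

text \<open>A system that represents \<open>x\<close> and has the largest possible number of elements is a frame, as
  otherwise one of its elements could be split.\<close>

theorem spectral_theorem: "\<exists>D l. frame D \<and> x = (\<Sum>d\<in>D. l d *\<^sub>R d)"
proof -
  define Q where "Q D \<longleftrightarrow> orthosystem e D \<and> (\<exists>l. x = (\<Sum>d\<in>D. l d *\<^sub>R d))" for D
  have "\<exists>D. Q D" using spectral_orthosystem[of x] unfolding Q_def by metis
  then obtain D0 where "Q D0" ..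
  moreover have "\<forall>D. Q D \<longrightarrow> card D < Suc DIM('a)"
    using orthosystem_card_le unfolding Q_def by (metis less_Suc_eq_le)
  ultimately have "\<exists>D. Q D \<and> (\<forall>D'. Q D' \<longrightarrow> card D' \<le> card D)"
    by (rule Lattices_Big.ex_has_greatest_nat)
  then obtain D where D: "Q D" and max: "\<And>D'. Q D' \<Longrightarrow> card D' \<le> card D" by metis
  obtain l where l: "orthosystem e D" "x = (\<Sum>d\<in>D. l d *\<^sub>R d)" using D unfolding Q_def by metis
  have "primitive d" if "d \<in> D" for d
  proof (rule ccontr)
    assume "\<not> primitive d"
    from orthosystem_split[OF l that this] obtain D' where "Q D'" "card D' > card D"
      unfolding Q_def by metis
    then show False using max[of D'] by simp
  qed
  then have "frame D" using l(1) unfolding orthosystem_def jordan_frame_def by metis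
  then show ?thesis using l(2) by metis
qed

subsection \<open>Primitive idempotents\<close>

lemma primitive_below:
  assumes d: "primitive d" and c: "idem c" "c \<noteq> 0" "d \<odot> c = c"
  shows "c = d"
proof (rule ccontr)
  assume "c \<noteq> d"
  have "idem (d - c)"
    using c primitive_idem[OF d] by (simp add: P_linear comm[of c d])
  moreover have "d = (d - c) + c" "d - c \<noteq> 0" using \<open>c \<noteq> d\<close> by simp_all
  ultimately show False
    using d c(1,2) unfolding primitive_idempotent_def idempotent_in_def by blast
qed

text \<open>Any idempotent \<open>c\<close> that occurs with nonzero coefficient in the spectral decomposition of \<open>u\<close> is
  orthogonal to \<open>e - d\<close>, hence lies below \<open>d\<close>, hence equals \<open>d\<close>.\<close>

lemma primitive_eigenspace:
  assumes d: "primitive d" and u: "d \<odot> u = u"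
  shows "\<exists>\<alpha>. u = \<alpha> *\<^sub>R d"
proof -
  obtain D l where D: "frame D" "u = (\<Sum>c\<in>D. l c *\<^sub>R c)" using spectral_theorem by blast
  note os = frame_orthosystem[OF D(1)]
  have idd: "idem d" using primitive_idem d by blast
  have ed: "idem (e - d)" using idd by (simp add: P_linear unit unit_right)
  have eq: "c = d" if "c \<in> D" "l c \<noteq> 0" for c
  proof -
    have c: "idem c" "c \<noteq> 0" using os that by (auto simp: orthosystem_def)
    have uc: "u \<odot> c = l c *\<^sub>R c" using orthosystem_mult[OF os that(1)] D(2) by simp
    have "l c * B c (e - d) = B (u \<odot> c) (e - d)"
      unfolding uc bilinear_lmul[OF bilinear_B] real_scaleR_def ..
    also have "\<dots> = B c (u - u \<odot> d)" by (simp add: B_assoc P_linear unit_right)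
    also have "\<dots> = 0" using u by (simp add: comm[of u d] B_linear)
    finally have "B c (e - d) = 0" using that by simp
    then have "c \<odot> (e - d) = 0" using idem_orthogonal[OF c(1) ed] by blast
    then have "d \<odot> c = c" by (simp add: P_linear unit_right comm[of d c])
    then show ?thesis using primitive_below[OF d c] by simp
  qed
  have "u = (\<Sum>c\<in>D. (if c = d then l c else 0) *\<^sub>R d)"
    unfolding D(2) using eq by (intro sum.cong) auto
  then show ?thesis by (metis scaleR_left.sum)
qed

text \<open>The Peirce projection of \<open>b\<close> to the eigenspace 1 of a primitive \<open>a\<close> is \<open>\<alpha> a\<close>. Pairing it with \<open>a\<close> gives
  \<open>B a b = \<alpha> B a a\<close>, and pairing it with \<open>b\<close> gives \<open>\<alpha> B a b = 2 B (a \<odot> b) (a \<odot> b) - B a b\<close>, which is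
  symmetric in \<open>a\<close> and \<open>b\<close>. So \<open>\<alpha>\<close> does not change if \<open>a\<close> and \<open>b\<close> are exchanged.\<close>

lemma primitive_norm_eq:
  assumes c: "primitive c" and d: "primitive d" and nz: "B c d \<noteq> 0"
  shows "B c c = B d d"
proof -
  have key: "\<exists>\<alpha>. B a b = \<alpha> * B a a \<and> \<alpha> * B a b = 2 * B (a \<odot> b) (a \<odot> b) - B a b"
    if a: "primitive a" and b: "primitive b" for a b
  proof -
    have ia: "idem a" "idem b" using primitive_idem a b by blast+
    obtain \<alpha> where \<alpha>: "peirce1 a b = \<alpha> *\<^sub>R a"
      using primitive_eigenspace[OF a peirce_eigen(1)[OF ia(1)]] by blast
    have aab: "B a (a \<odot> v) = B a v" for v using B_assoc[of a a v] ia by simp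
    have "B a (peirce1 a b) = B a b"
      by (simp add: peirce1_def B_linear aab)
    moreover have "B (peirce1 a b) b = 2 * B (a \<odot> b) (a \<odot> b) - B a b"
    proof -
      have "B (a \<odot> b) b = B a b" using B_assoc[of b a b] ia by (simp add: comm[of b a])
      then show ?thesis by (simp add: peirce1_def B_linear B_assoc[of a "a \<odot> b" b])
    qed
    ultimately show ?thesis using \<alpha> by (intro exI[of _ \<alpha>]) (simp add: B_linear)
  qed
  obtain \<alpha> where \<alpha>: "B c d = \<alpha> * B c c" "\<alpha> * B c d = 2 * B (c \<odot> d) (c \<odot> d) - B c d"
    using key[OF c d] by blast
  obtain \<beta> where \<beta>: "B d c = \<beta> * B d d" "\<beta> * B d c = 2 * B (d \<odot> c) (d \<odot> c) - B d c"
    using key[OF d c] by blast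
  have "\<alpha> * B c d = \<beta> * B c d" using \<alpha> \<beta> by (simp add: comm[of d c] B_sym[of d c])
  then show ?thesis using \<alpha> \<beta> nz by (auto simp: B_sym[of d c])
qed

subsection \<open>The cone of squares\<close>

abbreviation K :: "'a set" where
  "K \<equiv> cone_of_squares UNIV P"

lemma square_in_K: "x \<odot> x \<in> K"
  by (auto simp: cone_of_squares_def)

lemma idem_in_K: "idem c \<Longrightarrow> c \<in> K"
  using square_in_K[of c] by simp

lemma B_square_idem_nonneg: "idem d \<Longrightarrow> B (z \<odot> z) d \<ge> 0"
  using idem_mult_nonneg[of d z] B_assoc[of z z d] by (simp only: comm[of d z] B_sym[of z "z \<odot> d"])

lemma orthosystem_pos: "orthosystem u D \<Longrightarrow> d \<in> D \<Longrightarrow> B d d > 0"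
  by (simp add: orthosystem_def B_pos)

lemma K_iff_coeff_nonneg:
  assumes D: "orthosystem e D" and x: "x = (\<Sum>d\<in>D. l d *\<^sub>R d)"
  shows "x \<in> K \<longleftrightarrow> (\<forall>d\<in>D. l d \<ge> 0)"
proof
  assume "x \<in> K"
  show "\<forall>d\<in>D. l d \<ge> 0"
  proof
    fix d assume d: "d \<in> D"
    have "B x d \<ge> 0"
      using \<open>x \<in> K\<close> d D B_square_idem_nonneg by (auto simp: cone_of_squares_def orthosystem_def)
    then have "l d * B d d \<ge> 0" using orthosystem_B_sum[OF D d, of l] x by simp
    then show "l d \<ge> 0" using orthosystem_pos[OF D d] by (simp add: zero_le_mult_iff)
  qed
next
  assume "\<forall>d\<in>D. l d \<ge> 0"
  then have "x = (\<Sum>d\<in>D. (sqrt (l d) * sqrt (l d)) *\<^sub>R d)" unfolding x by simp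
  also have "\<dots> = (\<Sum>d\<in>D. sqrt (l d) *\<^sub>R d) \<odot> (\<Sum>d\<in>D. sqrt (l d) *\<^sub>R d)"
    by (rule orthosystem_mult_sum[OF D, symmetric])
  finally show "x \<in> K" using square_in_K by metis
qed

lemma K_pairing_nonneg:
  assumes "a \<in> K" "b \<in> K"
  shows "B a b \<ge> 0"
proof -
  obtain D l where D: "frame D" "b = (\<Sum>d\<in>D. l d *\<^sub>R d)" using spectral_theorem by blast
  have os: "orthosystem e D" by (rule frame_orthosystem[OF D(1)])
  have "l d * B a d \<ge> 0" if "d \<in> D" for d
    using K_iff_coeff_nonneg[OF os D(2)] assms that os B_square_idem_nonneg
    by (auto simp: cone_of_squares_def orthosystem_def)
  then show ?thesis unfolding D(2) by (simp add: B_sum_right B_linear sum_nonneg)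
qed

lemma K_self_dual: "x \<in> K \<longleftrightarrow> (\<forall>s\<in>K. B x s \<ge> 0)"
proof
  assume r: "\<forall>s\<in>K. B x s \<ge> 0"
  obtain D l where D: "frame D" "x = (\<Sum>d\<in>D. l d *\<^sub>R d)" using spectral_theorem by blast
  have os: "orthosystem e D" by (rule frame_orthosystem[OF D(1)])
  have "l d \<ge> 0" if "d \<in> D" for d
  proof -
    have "idem d" using os that by (simp add: orthosystem_def)
    then have "B x d \<ge> 0" using r idem_in_K by blast
    then show ?thesis
      using orthosystem_B_sum[OF os that, of l] orthosystem_pos[OF os that] D(2) by (simp add: zero_le_mult_iff)
  qed
  then show "x \<in> K" using K_iff_coeff_nonneg[OF os D(2)] by blast
qed (simp add: K_pairing_nonneg)

lemma K_add: "x \<in> K \<Longrightarrow> y \<in> K \<Longrightarrow> x + y \<in> K"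
  unfolding K_self_dual by (simp add: B_linear)

lemma K_scale: "x \<in> K \<Longrightarrow> c \<ge> 0 \<Longrightarrow> c *\<^sub>R x \<in> K"
  unfolding K_self_dual by (simp add: B_linear)

lemma e_in_K: "e \<in> K"
  by (rule idem_in_K) (rule unit)

lemma convex_K: "convex K"
  unfolding convex_def by (simp add: K_add K_scale)

lemma bounded_bilinear_B: "bounded_bilinear B"
  using bilinear_B bilinear_conv_bounded_bilinear by blast

lemma bounded_bilinear_P: "bounded_bilinear P"
  using bilinear_P bilinear_conv_bounded_bilinear by blast

lemma continuous_on_B [continuous_intros]:
  "continuous_on A f \<Longrightarrow> continuous_on A g \<Longrightarrow> continuous_on A (\<lambda>x. B (f x) (g x))"
  by (rule bounded_bilinear.continuous_on[OF bounded_bilinear_B])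

lemma continuous_on_P [continuous_intros]:
  "continuous_on A f \<Longrightarrow> continuous_on A g \<Longrightarrow> continuous_on A (\<lambda>x. f x \<odot> g x)"
  by (rule bounded_bilinear.continuous_on[OF bounded_bilinear_P])

lemma closed_K: "closed K"
proof -
  have "K = (\<Inter>s\<in>K. {x. B x s \<ge> 0})" using K_self_dual by blast
  moreover have "closed (\<Inter>s\<in>K. {x. 0 \<le> B x s})"
    by (intro closed_INT ballI closed_Collect_le continuous_intros)
  ultimately show ?thesis by simp
qed

lemma interior_K_add:
  assumes "x \<in> K" "y \<in> interior K"
  shows "x + y \<in> interior K"
proof -
  have "(+) x ` interior K \<subseteq> interior K"
    using assms(1) interior_subset[of K] K_add
    by (intro interior_maximal) (auto simp: open_translation)
  then show ?thesis using assms(2) by blast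
qed

lemma interior_K_scale:
  assumes "y \<in> interior K" "c > 0"
  shows "c *\<^sub>R y \<in> interior K"
proof -
  have "(*\<^sub>R) c ` interior K \<subseteq> interior K"
    using assms(2) interior_subset[of K] K_scale
    by (intro interior_maximal open_scaling) (auto simp: subset_iff)
  then show ?thesis using assms(1) by blast
qed

text \<open>The idempotents span the space, so the cone has an interior point \<open>z\<close>; and \<open>t e - z \<in> K\<close> as soon as
  \<open>t\<close> exceeds the eigenvalues of \<open>z\<close>, so \<open>t e = (t e - z) + z\<close> is an interior point as well.\<close>

lemma e_in_interior_K: "e \<in> interior K"
proof -
  have "span K = UNIV"
  proof -
    have "x \<in> span K" for x
    proof -
      obtain D l where D: "frame D" "x = (\<Sum>d\<in>D. l d *\<^sub>R d)" using spectral_theorem by blast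
      have "d \<in> span K" if "d \<in> D" for d
        using D(1) that frame_primitive primitive_idem idem_in_K span_base by metis
      then show ?thesis unfolding D(2) by (intro span_sum span_scale)
    qed
    then show ?thesis by blast
  qed
  moreover have "0 \<in> K" using K_scale[OF e_in_K, of 0] by simp
  ultimately have "affine hull K = UNIV" by (simp add: affine_hull_span_0 hull_inc)
  then have "interior K \<noteq> {}"
    using rel_interior_eq_empty[OF convex_K] e_in_K rel_interior_interior by blast
  then obtain z where z: "z \<in> interior K" by blast
  obtain D l where D: "frame D" "z = (\<Sum>d\<in>D. l d *\<^sub>R d)" using spectral_theorem by blast
  have os: "orthosystem e D" by (rule frame_orthosystem[OF D(1)])
  define t where "t = 1 + (\<Sum>d\<in>D. \<bar>l d\<bar>)"
  have fin: "finite D" using os by (simp add: orthosystem_def)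
  have t: "t > 0" unfolding t_def by (simp add: add_pos_nonneg sum_nonneg)
  have le: "l d \<le> t" if "d \<in> D" for d
  proof -
    have "\<bar>l d\<bar> \<le> (\<Sum>d\<in>D. \<bar>l d\<bar>)" using fin that by (intro member_le_sum) auto
    then show ?thesis unfolding t_def by linarith
  qed
  have "t *\<^sub>R e - z = (\<Sum>d\<in>D. (t - l d) *\<^sub>R d)"
    using os unfolding D(2) orthosystem_def by (auto simp: scaleR_diff_left sum_subtractf scaleR_right.sum)
  then have "t *\<^sub>R e - z \<in> K" using K_iff_coeff_nonneg[OF os, of "t *\<^sub>R e - z" "\<lambda>d. t - l d"] le by auto
  then have "t *\<^sub>R e \<in> interior K" using interior_K_add[OF _ z] by force
  then show ?thesis using interior_K_scale[of "t *\<^sub>R e" "1 / t"] t by simp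
qed

lemma interior_K_iff: "x \<in> interior K \<longleftrightarrow> (\<exists>\<epsilon>>0. x - \<epsilon> *\<^sub>R e \<in> K)"
proof
  assume "x \<in> interior K"
  then obtain r where r: "r > 0" "ball x r \<subseteq> K" by (metis mem_interior)
  define \<epsilon> where "\<epsilon> = r / (2 * (norm e + 1))"
  have den: "norm e + 1 > 0" by (simp add: add_nonneg_pos)
  have "\<epsilon> > 0" using r den by (simp add: \<epsilon>_def)
  moreover have "\<epsilon> * norm e < r"
  proof -
    have "\<epsilon> * norm e \<le> \<epsilon> * (norm e + 1)" using \<open>\<epsilon> > 0\<close> by simp
    also have "\<dots> = r / 2" using den unfolding \<epsilon>_def by (simp add: divide_simps)
    finally show ?thesis using r by simp
  qed
  ultimately have "x - \<epsilon> *\<^sub>R e \<in> ball x r" by (simp add: dist_norm)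
  then show "\<exists>\<epsilon>>0. x - \<epsilon> *\<^sub>R e \<in> K" using r \<open>\<epsilon> > 0\<close> by blast
next
  assume "\<exists>\<epsilon>>0. x - \<epsilon> *\<^sub>R e \<in> K"
  then obtain \<epsilon> where "\<epsilon> > 0" "x - \<epsilon> *\<^sub>R e \<in> K" by blast
  then show "x \<in> interior K"
    using interior_K_add[OF _ interior_K_scale[OF e_in_interior_K], of "x - \<epsilon> *\<^sub>R e" \<epsilon>] by simp
qed

lemma interior_K_iff_coeff_pos:
  assumes D: "orthosystem e D" and x: "x = (\<Sum>d\<in>D. l d *\<^sub>R d)"
  shows "x \<in> interior K \<longleftrightarrow> (\<forall>d\<in>D. l d > 0)"
proof -
  have fin: "finite D" using D by (simp add: orthosystem_def)
  have "x - \<epsilon> *\<^sub>R e = (\<Sum>d\<in>D. (l d - \<epsilon>) *\<^sub>R d)" for \<epsilon>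
    using D unfolding x orthosystem_def by (auto simp: scaleR_diff_left sum_subtractf scaleR_right.sum)
  then have *: "x - \<epsilon> *\<^sub>R e \<in> K \<longleftrightarrow> (\<forall>d\<in>D. l d \<ge> \<epsilon>)" for \<epsilon>
    using K_iff_coeff_nonneg[OF D, of "x - \<epsilon> *\<^sub>R e" "\<lambda>d. l d - \<epsilon>"] by auto
  show ?thesis unfolding interior_K_iff *
  proof
    assume pos: "\<forall>d\<in>D. l d > 0"
    show "\<exists>\<epsilon>>0. \<forall>d\<in>D. \<epsilon> \<le> l d"
    proof (cases "D = {}")
      case True
      then show ?thesis by (intro exI[of _ 1]) auto
    next
      case False
      then show ?thesis using pos fin by (intro exI[of _ "Min (l ` D)"]) auto
    qed
  qed force
qed

lemma B_lower_bound: "\<exists>\<delta>>0. \<forall>x. B x x \<ge> \<delta> * (norm x)\<^sup>2"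
proof -
  have "compact (sphere (0::'a) 1)" "sphere (0::'a) 1 \<noteq> {}" by auto
  moreover have "continuous_on (sphere 0 1) (\<lambda>x. B x x)" by (intro continuous_intros)
  ultimately obtain z where z: "norm z = 1" "\<And>x. norm x = 1 \<Longrightarrow> B z z \<le> B x x"
    using continuous_attains_inf[of "sphere (0::'a) 1" "\<lambda>x. B x x"] by auto
  have "B x x \<ge> B z z * (norm x)\<^sup>2" for x
  proof (cases "x = 0")
    case False
    have "B z z \<le> B ((1 / norm x) *\<^sub>R x) ((1 / norm x) *\<^sub>R x)"
      by (rule z(2)) (use False in simp)
    then show ?thesis using False by (simp add: B_linear power2_eq_square field_simps)
  qed (simp add: B_linear)
  moreover have "B z z > 0" using z(1) by (intro B_pos) auto
  ultimately show ?thesis by blast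
qed

text \<open>The norm of an idempotent is bounded below because \<open>d = d \<odot> d\<close> has norm at most
  a constant times the square of the norm of \<open>d\<close>.\<close>

lemma idem_lower_bound: "\<exists>\<delta>>0. \<forall>d. idem d \<and> d \<noteq> 0 \<longrightarrow> B d d \<ge> \<delta>"
proof -
  obtain C where C: "C > 0" "\<And>x y. norm (x \<odot> y) \<le> norm x * norm y * C"
    using bounded_bilinear.pos_bounded[OF bounded_bilinear_P] by blast
  obtain \<delta> where \<delta>: "\<delta> > 0" "\<And>x. B x x \<ge> \<delta> * (norm x)\<^sup>2" using B_lower_bound by blast
  have "B d d \<ge> \<delta> * (1 / C)\<^sup>2" if d: "idem d" "d \<noteq> 0" for d
  proof -
    have "norm d \<le> norm d * norm d * C" using C(2)[of d d] d by simp
    then have "1 \<le> norm d * C" using d by (simp add: mult.assoc)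
    then have "1 / C \<le> norm d" using C(1) by (simp add: divide_le_eq)
    then have "(1 / C)\<^sup>2 \<le> (norm d)\<^sup>2" using C(1) by (intro power_mono) auto
    then have "\<delta> * (1 / C)\<^sup>2 \<le> \<delta> * (norm d)\<^sup>2" using \<delta>(1) by simp
    then show ?thesis using \<delta>(2)[of d] by linarith
  qed
  moreover have "\<delta> * (1 / C)\<^sup>2 > 0" using \<delta>(1) C(1) by simp
  ultimately show ?thesis by blast
qed

subsection \<open>The weighted logarithm\<close>

lemma orthosystem_B_self:
  assumes "orthosystem u D" "c \<in> D"
  shows "B c u = B c c"
proof -
  have "idem c" "u \<odot> c = c"
    using orthosystem_mult[OF assms, of "\<lambda>_. 1"] assms by (simp_all add: orthosystem_def)
  then show ?thesis using B_assoc[of c u c] comm[of u c] B_sym[of u c] by simp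
qed

lemma orthosystem_B_total: "orthosystem u D \<Longrightarrow> (\<Sum>d\<in>D. B d d) = B u u"
  using B_sum_left[of "\<lambda>d. d" D u] orthosystem_B_self[of u D] by (simp add: orthosystem_def)

text \<open>For \<open>c \<in> D\<close> and \<open>d \<in> D'\<close>, associativity gives \<open>l c * B c d = l' d * B c d\<close>. So whenever \<open>B c d \<noteq> 0\<close> the
  two eigenvalues agree, and both sides equal the sum of \<open>f (l c) * B c d\<close> over all pairs.\<close>

lemma spectral_sum_unique:
  assumes D: "orthosystem u D" and D': "orthosystem u D'"
    and eq: "(\<Sum>d\<in>D. l d *\<^sub>R d) = (\<Sum>d\<in>D'. l' d *\<^sub>R d)"
  shows "(\<Sum>d\<in>D. f (l d) * B d d) = (\<Sum>d\<in>D'. f (l' d) * B d d)"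
proof -
  define x where "x = (\<Sum>d\<in>D. l d *\<^sub>R d)"
  have *: "f (l c) * B c d = f (l' d) * B c d" if "c \<in> D" "d \<in> D'" for c d
  proof -
    have "l c * B c d = B (x \<odot> c) d"
      using orthosystem_mult[OF D that(1)] by (simp add: x_def B_linear)
    also have "\<dots> = l' d * B c d"
      using orthosystem_mult[OF D' that(2), of l'] by (simp add: B_assoc x_def eq B_linear)
    finally show ?thesis by (cases "B c d = 0") auto
  qed
  have 1: "B c c = (\<Sum>d\<in>D'. B c d)" if "c \<in> D" for c
  proof -
    have "B c c = B c (\<Sum>d\<in>D'. d)"
      using orthosystem_B_self[OF D that] D' by (simp add: orthosystem_def)
    then show ?thesis by (simp only: B_sum_right)
  qed
  have 2: "B d d = (\<Sum>c\<in>D. B c d)" if "d \<in> D'" for d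
  proof -
    have "B d d = B (\<Sum>c\<in>D. c) d"
      using orthosystem_B_self[OF D' that] D B_sym[of d u] by (simp add: orthosystem_def)
    then show ?thesis by (simp only: B_sum_left)
  qed
  have "(\<Sum>c\<in>D. f (l c) * B c c) = (\<Sum>c\<in>D. \<Sum>d\<in>D'. f (l c) * B c d)"
    by (simp add: 1 sum_distrib_left)
  also have "\<dots> = (\<Sum>c\<in>D. \<Sum>d\<in>D'. f (l' d) * B c d)"
    by (intro sum.cong refl *)
  also have "\<dots> = (\<Sum>d\<in>D'. \<Sum>c\<in>D. f (l' d) * B c d)" by (rule sum.swap)
  also have "\<dots> = (\<Sum>d\<in>D'. f (l' d) * B d d)"
    by (simp add: 2 sum_distrib_left)
  finally show ?thesis .
qed

text \<open>If all primitive idempotents have length 1, this is the logarithm of the Jordan determinant. In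
  general the eigenvalues are weighted by the squared lengths of their idempotents. The value does not
  depend on the chosen frame, by \<open>spectral_sum_unique\<close>.\<close>

definition logdet :: "'a \<Rightarrow> real" where
  "logdet x = (SOME s. \<exists>D l. frame D \<and> x = (\<Sum>d\<in>D. l d *\<^sub>R d) \<and> s = (\<Sum>d\<in>D. ln (l d) * B d d))"

lemma logdet_orthosystem:
  assumes "orthosystem e D" "x = (\<Sum>d\<in>D. l d *\<^sub>R d)"
  shows "logdet x = (\<Sum>d\<in>D. ln (l d) * B d d)"
proof -
  obtain D' l' where "frame D'" "x = (\<Sum>d\<in>D'. l' d *\<^sub>R d)" using spectral_theorem by blast
  then have "\<exists>s. \<exists>D l. frame D \<and> x = (\<Sum>d\<in>D. l d *\<^sub>R d) \<and> s = (\<Sum>d\<in>D. ln (l d) * B d d)"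
    by blast
  then have "\<exists>D l. frame D \<and> x = (\<Sum>d\<in>D. l d *\<^sub>R d) \<and> logdet x = (\<Sum>d\<in>D. ln (l d) * B d d)"
    unfolding logdet_def by (rule someI_ex)
  then obtain D' l' where D': "frame D'" "x = (\<Sum>d\<in>D'. l' d *\<^sub>R d)"
    "logdet x = (\<Sum>d\<in>D'. ln (l' d) * B d d)"
    by blast
  then show ?thesis
    using spectral_sum_unique[OF assms(1) frame_orthosystem[OF D'(1)], of l l' ln] assms(2) by simp
qed

text \<open>Klein's inequality: with \<open>x = \<Sum>l\<^sub>c c\<close> and \<open>y = \<Sum>k\<^sub>d d\<close>, the difference of the two sides
  is \<open>\<Sum> B c d (t - 1 - ln t)\<close> at \<open>t = k\<^sub>d / l\<^sub>c\<close>, and all the weights \<open>B c d\<close> are nonnegative.\<close>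

lemma klein_inequality:
  assumes C: "orthosystem e C" "x = (\<Sum>c\<in>C. l c *\<^sub>R c)" "x \<in> interior K" and y: "y \<in> interior K"
  shows "logdet y \<le> logdet x + B (\<Sum>c\<in>C. (1 / l c) *\<^sub>R c) y - B e e"
proof -
  obtain D k where D: "frame D" "y = (\<Sum>d\<in>D. k d *\<^sub>R d)" using spectral_theorem by blast
  have os: "orthosystem e D" by (rule frame_orthosystem[OF D(1)])
  have l: "l c > 0" if "c \<in> C" for c
    using interior_K_iff_coeff_pos[OF C(1,2)] C(3) that by blast
  have k: "k d > 0" if "d \<in> D" for d
    using interior_K_iff_coeff_pos[OF os D(2)] y that by blast
  have e: "(\<Sum>c\<in>C. c) = e" "(\<Sum>d\<in>D. d) = e" using C(1) os by (simp_all add: orthosystem_def)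
  have Bc: "B c e = B c c" if "c \<in> C" for c using orthosystem_B_self[OF C(1) that] .
  have Bd: "B e d = B d d" if "d \<in> D" for d using orthosystem_B_self[OF os that] B_sym[of e d] by simp
  have "0 \<le> (\<Sum>c\<in>C. \<Sum>d\<in>D. B c d * (k d / l c - 1 - (ln (k d) - ln (l c))))"
  proof (intro sum_nonneg mult_nonneg_nonneg)
    fix c d assume cd: "c \<in> C" "d \<in> D"
    show "B c d \<ge> 0" using cd C(1) os by (simp add: idem_nonneg orthosystem_def)
    have "ln (k d / l c) \<le> k d / l c - 1" using l k cd by (intro ln_le_minus_one) auto
    then show "0 \<le> k d / l c - 1 - (ln (k d) - ln (l c))"
      using l[OF cd(1)] k[OF cd(2)] by (simp add: ln_div)
  qed
  also have "\<dots> = (\<Sum>c\<in>C. \<Sum>d\<in>D. (1 / l c) * k d * B c d) - (\<Sum>c\<in>C. \<Sum>d\<in>D. B c d)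
      - (\<Sum>c\<in>C. \<Sum>d\<in>D. ln (k d) * B c d) + (\<Sum>c\<in>C. \<Sum>d\<in>D. ln (l c) * B c d)"
    by (simp add: sum_subtractf[symmetric] sum.distrib[symmetric] algebra_simps)
  also have "(\<Sum>c\<in>C. \<Sum>d\<in>D. (1 / l c) * k d * B c d) = B (\<Sum>c\<in>C. (1 / l c) *\<^sub>R c) y"
    unfolding D(2) B_sum_left by (simp add: B_sum_right B_linear sum_distrib_left mult.assoc)
  also have "(\<Sum>c\<in>C. \<Sum>d\<in>D. B c d) = B e e"
  proof -
    have "B e e = B (\<Sum>c\<in>C. c) (\<Sum>d\<in>D. d)" by (simp only: e)
    also have "\<dots> = (\<Sum>c\<in>C. \<Sum>d\<in>D. B c d)" unfolding B_sum_left by (simp only: B_sum_right)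
    finally show ?thesis by simp
  qed
  also have "(\<Sum>c\<in>C. \<Sum>d\<in>D. ln (k d) * B c d) = logdet y"
  proof -
    have "(\<Sum>c\<in>C. \<Sum>d\<in>D. ln (k d) * B c d) = (\<Sum>d\<in>D. ln (k d) * (\<Sum>c\<in>C. B c d))"
      by (subst sum.swap) (simp add: sum_distrib_left)
    also have "\<dots> = (\<Sum>d\<in>D. ln (k d) * B d d)"
      by (simp add: B_sum_left[symmetric] e Bd)
    finally show ?thesis using logdet_orthosystem[OF os D(2)] by simp
  qed
  also have "(\<Sum>c\<in>C. \<Sum>d\<in>D. ln (l c) * B c d) = logdet x"
  proof -
    have "(\<Sum>c\<in>C. \<Sum>d\<in>D. ln (l c) * B c d) = (\<Sum>c\<in>C. ln (l c) * B c (\<Sum>d\<in>D. d))"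
      by (simp add: B_sum_right sum_distrib_left)
    also have "\<dots> = (\<Sum>c\<in>C. ln (l c) * B c c)" by (simp add: e Bc)
    finally show ?thesis using logdet_orthosystem[OF C(1,2)] by simp
  qed
  finally show ?thesis by simp
qed

subsection \<open>The Jordan inverse\<close>

lemma mult_lower_bound:
  assumes "x - \<epsilon> *\<^sub>R e \<in> K"
  shows "B (x \<odot> v) v \<ge> \<epsilon> * B v v"
proof -
  obtain D l where D: "frame D" "x - \<epsilon> *\<^sub>R e = (\<Sum>d\<in>D. l d *\<^sub>R d)" using spectral_theorem by blast
  have os: "orthosystem e D" by (rule frame_orthosystem[OF D(1)])
  have "B ((x - \<epsilon> *\<^sub>R e) \<odot> v) v = (\<Sum>d\<in>D. l d * B (d \<odot> v) v)"
    unfolding D(2) P_sum_left B_sum_left by (simp add: P_linear B_linear)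
  also have "\<dots> \<ge> 0"
    using K_iff_coeff_nonneg[OF os D(2)] assms os
    by (intro sum_nonneg mult_nonneg_nonneg idem_mult_nonneg) (auto simp: orthosystem_def)
  finally show ?thesis by (simp add: P_linear B_linear unit)
qed

definition solve :: "'a \<Rightarrow> 'a \<Rightarrow> 'a" where
  "solve x = inv (P x)"

abbreviation jinv :: "'a \<Rightarrow> 'a" where
  "jinv x \<equiv> solve x e"

lemma bij_mult: "x \<in> interior K \<Longrightarrow> bij (P x)"
proof -
  assume "x \<in> interior K"
  then obtain \<epsilon> where \<epsilon>: "\<epsilon> > 0" "x - \<epsilon> *\<^sub>R e \<in> K" using interior_K_iff by blast
  have "v = 0" if "x \<odot> v = 0" for v
  proof (rule ccontr)
    assume "v \<noteq> 0"
    then show False using mult_lower_bound[OF \<epsilon>(2), of v] that \<epsilon>(1) B_pos[of v]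
      by (simp add: B_linear mult_le_0_iff)
  qed
  then have "inj (P x)" using linear_injective_0[OF linear_P_right, of x] by simp
  then show ?thesis using linear_injective_imp_surjective[OF linear_P_right, of x] by (simp add: bij_def)
qed

lemma solve_right: "x \<in> interior K \<Longrightarrow> x \<odot> solve x v = v"
  unfolding solve_def by (rule surj_f_inv_f) (simp add: bij_mult bij_is_surj)

lemma solve_left: "x \<in> interior K \<Longrightarrow> solve x (x \<odot> v) = v"
  unfolding solve_def by (rule inv_f_f) (simp add: bij_mult bij_is_inj)

lemma solve_unique: "x \<in> interior K \<Longrightarrow> x \<odot> w = v \<Longrightarrow> solve x v = w"
  using solve_left[of x w] by simp

lemma linear_solve: "x \<in> interior K \<Longrightarrow> linear (solve x)"
  by (rule linearI; rule solve_unique) (simp_all add: P_linear solve_right)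

lemma solve_unit: "solve e v = v"
  by (rule solve_unique[OF e_in_interior_K]) (rule unit)

lemma jinv_orthosystem:
  assumes D: "orthosystem e D" "x = (\<Sum>d\<in>D. l d *\<^sub>R d)" "x \<in> interior K"
  shows "jinv x = (\<Sum>d\<in>D. (1 / l d) *\<^sub>R d)"
proof (rule solve_unique[OF D(3)])
  have "l d > 0" if "d \<in> D" for d using interior_K_iff_coeff_pos[OF D(1,2)] D(3) that by blast
  then have "(\<Sum>d\<in>D. (l d * (1 / l d)) *\<^sub>R d) = (\<Sum>d\<in>D. d)" by (intro sum.cong) force+
  then show "x \<odot> (\<Sum>d\<in>D. (1 / l d) *\<^sub>R d) = e"
    unfolding D(2) orthosystem_mult_sum[OF D(1)] using D(1) by (simp add: orthosystem_def)
qed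

lemma solve_locally_bounded:
  assumes "x \<in> interior K"
  shows "\<exists>r>0. \<exists>M>0. \<forall>y. dist y x < r \<longrightarrow> y \<in> interior K \<and> (\<forall>v. norm (solve y v) \<le> M * norm v)"
proof -
  obtain \<epsilon> where \<epsilon>: "\<epsilon> > 0" "x - \<epsilon> *\<^sub>R e \<in> K" using assms interior_K_iff by blast
  have "(x - \<epsilon> *\<^sub>R e) + (\<epsilon>/2) *\<^sub>R e \<in> interior K"
    using \<epsilon> by (intro interior_K_add interior_K_scale e_in_interior_K) auto
  moreover have "(x - \<epsilon> *\<^sub>R e) + (\<epsilon>/2) *\<^sub>R e = x - (\<epsilon>/2) *\<^sub>R e"
    using scaleR_add_left[of "\<epsilon>/2" "\<epsilon>/2" e] by simp
  ultimately obtain r where r: "r > 0" "ball (x - (\<epsilon>/2) *\<^sub>R e) r \<subseteq> K"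
    by (metis mem_interior)
  obtain C where C: "C > 0" "\<And>x y. norm (B x y) \<le> norm x * norm y * C"
    using bounded_bilinear.pos_bounded[OF bounded_bilinear_B] by blast
  obtain \<delta> where \<delta>: "\<delta> > 0" "\<And>x. B x x \<ge> \<delta> * (norm x)\<^sup>2" using B_lower_bound by blast
  define M where "M = C / (\<epsilon> / 2 * \<delta>)"
  have "y \<in> interior K \<and> (\<forall>v. norm (solve y v) \<le> M * norm v)" if "dist y x < r" for y
  proof -
    have "y - (\<epsilon>/2) *\<^sub>R e \<in> ball (x - (\<epsilon>/2) *\<^sub>R e) r" using that by (simp add: dist_norm norm_minus_commute)
    then have yK: "y - (\<epsilon>/2) *\<^sub>R e \<in> K" using r by blast
    then have yi: "y \<in> interior K" using \<epsilon>(1) by (auto simp: interior_K_iff intro!: exI[of _ "\<epsilon>/2"])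
    have "norm (solve y v) \<le> M * norm v" for v
    proof (cases "solve y v = 0")
      case False
      define w where "w = solve y v"
      have w: "norm w > 0" "y \<odot> w = v" using False solve_right[OF yi] by (simp_all add: w_def)
      have "\<epsilon> / 2 * (\<delta> * (norm w)\<^sup>2) \<le> \<epsilon> / 2 * B w w" using \<delta>(2)[of w] \<epsilon>(1) by simp
      also have "\<dots> \<le> B v w" using mult_lower_bound[OF yK, of w] w by simp
      also have "\<dots> \<le> norm v * norm w * C" using C(2)[of v w] by simp
      finally have "norm w * (\<epsilon> / 2 * \<delta> * norm w) \<le> norm w * (C * norm v)"
        by (simp add: power2_eq_square algebra_simps)
      then have "\<epsilon> / 2 * \<delta> * norm w \<le> C * norm v" using w by simp
      moreover have "\<epsilon> / 2 * \<delta> > 0" using \<epsilon> \<delta> by simp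
      ultimately show ?thesis unfolding M_def w_def by (simp add: field_simps)
    next
      case True
      have "M \<ge> 0" using C \<epsilon> \<delta> by (simp add: M_def)
      then show ?thesis using True by simp
    qed
    then show ?thesis using yi by blast
  qed
  moreover have "M > 0" using C \<epsilon> \<delta> by (simp add: M_def)
  ultimately show ?thesis using r(1) by blast
qed

text \<open>With \<open>w = solve x (g x)\<close> one has exactly \<open>solve y (g y) - w = solve y (g y - y \<odot> w)\<close>, and \<open>g y - y \<odot> w\<close>
  vanishes at \<open>y = x\<close>. So only the derivative of this function and a local bound for \<open>solve y\<close> matter.\<close>

lemma has_derivative_solve:
  fixes g :: "'a \<Rightarrow> 'a"
  assumes x: "x \<in> interior K" and g: "(g has_derivative g') (at x)"
  shows "((\<lambda>y. solve y (g y)) has_derivative (\<lambda>h. solve x (g' h) - solve x (h \<odot> solve x (g x)))) (at x)"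
proof -
  define w where "w = solve x (g x)"
  define G where "G = (\<lambda>y. g y - y \<odot> w)"
  define G' where "G' = (\<lambda>h. g' h - h \<odot> w)"
  obtain r M where r: "r > 0" "M > 0" "\<And>y. dist y x < r \<Longrightarrow> y \<in> interior K"
    and M: "\<And>y v. dist y x < r \<Longrightarrow> norm (solve y v) \<le> M * norm v"
    using solve_locally_bounded[OF x] by blast
  obtain C where C: "C > 0" "\<And>x y. norm (x \<odot> y) \<le> norm x * norm y * C"
    using bounded_bilinear.pos_bounded[OF bounded_bilinear_P] by blast
  have "bounded_linear (\<lambda>y. y \<odot> w)"
    using bounded_bilinear_P by (rule bounded_bilinear.bounded_linear_left)
  then have dG: "(G has_derivative G') (at x)"
    unfolding G_def G'_def by (intro has_derivative_diff g bounded_linear_imp_has_derivative)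
  have Gx: "G x = 0" by (simp add: G_def w_def solve_right[OF x])
  have linG': "linear G'" using dG has_derivative_linear by blast
  obtain L where L: "L > 0" "\<And>h. norm (G' h) \<le> norm h * L"
    using has_derivative_bounded_linear[OF dG] bounded_linear.pos_bounded by blast
  have diff: "solve y (g y) - w = solve y (G y)" if "dist y x < r" for y
    using solve_left[OF r(3)[OF that], of w] linear_diff[OF linear_solve[OF r(3)[OF that]], of "g y" "y \<odot> w"]
    by (simp add: G_def)
  have sdiff: "solve y u - solve x u = - solve y ((y - x) \<odot> solve x u)" if "dist y x < r" for y u
    using solve_left[OF r(3)[OF that], of "solve x u"] linear_diff[OF linear_solve[OF r(3)[OF that]]]
    by (simp add: P_linear solve_right[OF x])
  have "((\<lambda>y. solve y (g y)) has_derivative (\<lambda>h. solve x (G' h))) (at x)"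
  proof (rule has_derivativeI_sandwich[OF r(1)])
    show "bounded_linear (\<lambda>h. solve x (G' h))"
      using linear_compose[OF linG' linear_solve[OF x]] by (simp add: o_def linear_conv_bounded_linear)
    show "((\<lambda>y. M * (norm (G y - G x - G' (y - x)) / norm (y - x)) + M * C * M * L * norm (y - x)) \<longlongrightarrow> 0) (at x)"
    proof -
      have 1: "((\<lambda>y. norm (G y - G x - G' (y - x)) / norm (y - x)) \<longlongrightarrow> 0) (at x)"
        using dG by (simp add: has_derivative_iff_norm)
      have 2: "((\<lambda>y. norm (y - x)) \<longlongrightarrow> 0) (at x)"
        using tendsto_norm_zero[of "\<lambda>y. y - x" "at x"] by (simp add: LIM_zero_iff)
      show ?thesis
        using tendsto_add[OF tendsto_mult_left[OF 1, of M] tendsto_mult_left[OF 2, of "M * C * M * L"]] by simp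
    qed
    fix y assume y: "y \<noteq> x" "dist y x < r"
    define u where "u = G' (y - x)"
    have "solve y (g y) - solve x (g x) - solve x u = solve y (G y - u) + (solve y u - solve x u)"
      using diff[OF y(2)] linear_diff[OF linear_solve[OF r(3)[OF y(2)]], of "G y" u] by (simp add: w_def)
    also have "norm \<dots> \<le> norm (solve y (G y - u)) + norm (solve y u - solve x u)"
      by (rule norm_triangle_ineq)
    also have "\<dots> \<le> M * norm (G y - u) + M * C * M * L * norm (y - x) * norm (y - x)"
    proof (rule add_mono)
      show "norm (solve y (G y - u)) \<le> M * norm (G y - u)" using M y by blast
      have "norm (solve y u - solve x u) \<le> M * norm ((y - x) \<odot> solve x u)"
        unfolding sdiff[OF y(2)] norm_minus_cancel using M y by blast
      also have "\<dots> \<le> M * (norm (y - x) * norm (solve x u) * C)"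
        using C(2)[of "y - x" "solve x u"] r(2) by (intro mult_left_mono) simp_all
      also have "\<dots> \<le> M * (norm (y - x) * (M * (norm (y - x) * L)) * C)"
      proof -
        have "norm (solve x u) \<le> M * norm u" using M[of x] r(1) by simp
        also have "\<dots> \<le> M * (norm (y - x) * L)" using L(2) r(2) by (simp add: u_def)
        finally show ?thesis using C(1) r(2) by (intro mult_left_mono mult_right_mono) auto
      qed
      finally show "norm (solve y u - solve x u) \<le> M * C * M * L * norm (y - x) * norm (y - x)"
        by (simp add: algebra_simps)
    qed
    finally have "norm (solve y (g y) - solve x (g x) - solve x u) / norm (y - x)
        \<le> (M * norm (G y - u) + M * C * M * L * norm (y - x) * norm (y - x)) / norm (y - x)"
      by (rule divide_right_mono) simp
    also have "\<dots> = M * (norm (G y - G x - u) / norm (y - x)) + M * C * M * L * norm (y - x)"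
      using y(1) by (simp add: Gx add_divide_distrib)
    finally show "norm (solve y (g y) - solve x (g x) - solve x (G' (y - x))) / norm (y - x)
        \<le> M * (norm (G y - G x - G' (y - x)) / norm (y - x)) + M * C * M * L * norm (y - x)"
      by (simp add: u_def)
  qed
  moreover have "solve x (G' h) = solve x (g' h) - solve x (h \<odot> solve x (g x))" for h
    unfolding G'_def w_def by (rule linear_diff[OF linear_solve[OF x]])
  ultimately show ?thesis by simp
qed

lemma continuous_on_solve:
  fixes g :: "'a \<Rightarrow> 'a"
  assumes "\<And>x. x \<in> interior K \<Longrightarrow> g differentiable (at x)"
  shows "continuous_on (interior K) (\<lambda>y. solve y (g y))"
  using has_derivative_solve has_derivative_continuous assms
  unfolding differentiable_def continuous_at_imp_continuous_on continuous_on_eq_continuous_within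
  by (meson continuous_at_imp_continuous_at_within)

subsection \<open>Derivatives of the logarithm of the determinant\<close>

lemma has_derivative_jinv:
  assumes "x \<in> interior K"
  shows "(jinv has_derivative (\<lambda>h. - solve x (h \<odot> jinv x))) (at x)"
  using has_derivative_solve[OF assms, of "\<lambda>_. e" "\<lambda>_. 0"] linear_0[OF linear_solve[OF assms]]
  by simp

lemma klein_inequality_jinv:
  assumes x: "x \<in> interior K" and y: "y \<in> interior K"
  shows "logdet y \<le> logdet x + B (jinv x) y - B e e"
proof -
  obtain D l where D: "frame D" "x = (\<Sum>d\<in>D. l d *\<^sub>R d)" using spectral_theorem by blast
  show ?thesis
    using klein_inequality[OF frame_orthosystem[OF D(1)] D(2) x y]
      jinv_orthosystem[OF frame_orthosystem[OF D(1)] D(2) x] by simp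
qed

lemma B_jinv_mult: "x \<in> interior K \<Longrightarrow> B (jinv x) (c \<odot> x) = B c e"
  using B_assoc[of x c "jinv x"] by (simp add: solve_right comm[of c x] B_sym[of "jinv x"])

lemma B_jinv_self: "x \<in> interior K \<Longrightarrow> B (jinv x) x = B e e"
  using B_jinv_mult[of x e] by (simp add: unit)

text \<open>Klein's inequality at \<open>x\<close> and at \<open>y\<close> squeezes the remainder of the first-order expansion between
  \<open>B (jinv y - jinv x) (y - x)\<close> and 0.\<close>

lemma has_derivative_logdet:
  assumes x: "x \<in> interior K"
  shows "(logdet has_derivative B (jinv x)) (at x)"
proof -
  have "\<exists>r>0. \<forall>y. dist y x < r \<longrightarrow> y \<in> interior K"
    using open_interior[of K] x unfolding open_dist by blast
  then obtain r where r: "r > 0" "\<And>y. dist y x < r \<Longrightarrow> y \<in> interior K" by blast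
  obtain C where C: "C > 0" "\<And>x y. norm (B x y) \<le> norm x * norm y * C"
    using bounded_bilinear.pos_bounded[OF bounded_bilinear_B] by blast
  show ?thesis
  proof (rule has_derivativeI_sandwich[OF r(1)])
    show "bounded_linear (B (jinv x))"
      using bounded_bilinear.bounded_linear_right[OF bounded_bilinear_B] .
    have "isCont jinv x" using has_derivative_jinv[OF x] has_derivative_continuous by blast
    then have "((\<lambda>y. jinv y - jinv x) \<longlongrightarrow> 0) (at x)" unfolding isCont_def by (rule LIM_zero)
    then show "((\<lambda>y. norm (jinv y - jinv x) * C) \<longlongrightarrow> 0) (at x)"
      by (intro tendsto_mult_left_zero tendsto_norm_zero)
    fix y assume y: "y \<noteq> x" "dist y x < r"
    have yi: "y \<in> interior K" using r y by blast
    have "logdet y - logdet x - B (jinv x) (y - x) \<le> 0"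
      using klein_inequality_jinv[OF x yi] B_jinv_self[OF x] by (simp add: B_linear)
    moreover have "logdet y - logdet x - B (jinv x) (y - x) \<ge> B (jinv y - jinv x) (y - x)"
      using klein_inequality_jinv[OF yi x] B_jinv_self[OF yi] by (simp add: B_linear)
    ultimately have "norm (logdet y - logdet x - B (jinv x) (y - x)) \<le> norm (B (jinv y - jinv x) (y - x))"
      by simp
    also have "\<dots> \<le> norm (jinv y - jinv x) * norm (y - x) * C" by (rule C(2))
    finally show "norm (logdet y - logdet x - B (jinv x) (y - x)) / norm (y - x) \<le> norm (jinv y - jinv x) * C"
      using y(1) by (simp add: divide_le_eq mult_ac)
  qed
qed

lemma D1_logdet: "x \<in> interior K \<Longrightarrow> D1 logdet x u = B (jinv x) u"
  by (rule D1_eqI) (rule has_derivative_logdet)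

lemma has_derivative_D1_logdet:
  assumes x: "x \<in> interior K"
  shows "((\<lambda>y. D1 logdet y u) has_derivative (\<lambda>h. - B (solve x (h \<odot> jinv x)) u)) (at x)"
proof -
  have "bounded_linear (\<lambda>v. B v u)"
    using bounded_bilinear.bounded_linear_left[OF bounded_bilinear_B] .
  from bounded_linear.has_derivative[OF this has_derivative_jinv[OF x]]
  have "((\<lambda>y. B (jinv y) u) has_derivative (\<lambda>h. - B (solve x (h \<odot> jinv x)) u)) (at x)"
    by (simp add: bilinear_lneg[OF bilinear_B])
  then show ?thesis
    by (rule has_derivative_transform_within_open[OF _ open_interior x]) (simp add: D1_logdet)
qed

lemma D2_logdet: "x \<in> interior K \<Longrightarrow> D2 logdet x u v = - B (solve x (v \<odot> jinv x)) u"
  unfolding D2_def by (rule D1_eqI) (rule has_derivative_D1_logdet)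

lemma has_derivative_mult_jinv:
  assumes "x \<in> interior K"
  shows "((\<lambda>y. v \<odot> jinv y) has_derivative (\<lambda>h. - (v \<odot> solve x (h \<odot> jinv x)))) (at x)"
  using bounded_linear.has_derivative[OF bounded_bilinear.bounded_linear_right[OF bounded_bilinear_P]
      has_derivative_jinv[OF assms], of v]
  by (simp add: bilinear_rneg[OF bilinear_P])

lemma has_derivative_D2_logdet:
  assumes x: "x \<in> interior K"
  shows "((\<lambda>y. D2 logdet y u v) has_derivative
    (\<lambda>h. B (solve x (v \<odot> solve x (h \<odot> jinv x))) u + B (solve x (h \<odot> solve x (v \<odot> jinv x))) u)) (at x)"
proof -
  have "bounded_linear (\<lambda>v. B v u)"
    using bounded_bilinear.bounded_linear_left[OF bounded_bilinear_B] .
  from bounded_linear.has_derivative[OF this has_derivative_solve[OF x has_derivative_mult_jinv[OF x, of v]]]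
  have "((\<lambda>y. - B (solve y (v \<odot> jinv y)) u) has_derivative
    (\<lambda>h. - B (solve x (- (v \<odot> solve x (h \<odot> jinv x))) - solve x (h \<odot> solve x (v \<odot> jinv x))) u)) (at x)"
    by (rule has_derivative_minus)
  then have "((\<lambda>y. - B (solve y (v \<odot> jinv y)) u) has_derivative
    (\<lambda>h. B (solve x (v \<odot> solve x (h \<odot> jinv x))) u + B (solve x (h \<odot> solve x (v \<odot> jinv x))) u)) (at x)"
    by (simp add: B_linear linear_neg[OF linear_solve[OF x]] bilinear_lneg[OF bilinear_B] add.commute)
  then show ?thesis
    by (rule has_derivative_transform_within_open[OF _ open_interior x]) (simp add: D2_logdet)
qed

lemma D3_logdet: "x \<in> interior K \<Longrightarrow> D3 logdet x u v w =
    B (solve x (v \<odot> solve x (w \<odot> jinv x))) u + B (solve x (w \<odot> solve x (v \<odot> jinv x))) u"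
  unfolding D3_def by (rule D1_eqI) (rule has_derivative_D2_logdet)

lemma Ck_on_logdet: "Ck_on 3 logdet (interior K)"
proof -
  have jd: "jinv differentiable (at x)" "(\<lambda>y. v \<odot> jinv y) differentiable (at x)"
    "(\<lambda>y. solve y (v \<odot> jinv y)) differentiable (at x)"
    if "x \<in> interior K" for x v
    using has_derivative_jinv[OF that] has_derivative_mult_jinv[OF that]
      has_derivative_solve[OF that has_derivative_mult_jinv[OF that]]
    unfolding differentiable_def by blast+
  have jd2: "(\<lambda>y. w \<odot> solve y (v \<odot> jinv y)) differentiable (at x)" if "x \<in> interior K" for x v w
    using jd(3)[OF that, of v] bounded_linear.has_derivative[OF bounded_bilinear.bounded_linear_right[OF bounded_bilinear_P]]
    unfolding differentiable_def by blast
  have "continuous_on (interior K) (\<lambda>x. B (solve x (v \<odot> solve x (w \<odot> jinv x))) u + B (solve x (w \<odot> solve x (v \<odot> jinv x))) u)" for u v w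
    by (intro continuous_intros continuous_on_solve jd2)
  then have "continuous_on (interior K) (\<lambda>x. D3 logdet x u v w)" for u v w
    by (subst continuous_on_cong[OF refl D3_logdet])
  then show ?thesis
    using has_derivative_logdet has_derivative_D1_logdet has_derivative_D2_logdet
    unfolding differentiable_def numeral_3_eq_3 Ck_on.simps D3_def D2_def by blast
qed

lemma concave_logdet: "convex_on (interior K) (\<lambda>x. - logdet x)"
proof (rule convex_onI)
  fix t :: real and x y assume t: "0 < t" "t < 1" and x: "x \<in> interior K" and y: "y \<in> interior K"
  define z where "z = (1 - t) *\<^sub>R x + t *\<^sub>R y"
  have z: "z \<in> interior K"
    unfolding z_def using convexD[OF convex_interior[OF convex_K] x y, of "1 - t" t] t by simp
  have "(1 - t) * logdet x \<le> (1 - t) * (logdet z + B (jinv z) x - B e e)"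
    using klein_inequality_jinv[OF z x] t by (intro mult_left_mono) auto
  moreover have "t * logdet y \<le> t * (logdet z + B (jinv z) y - B e e)"
    using klein_inequality_jinv[OF z y] t by (intro mult_left_mono) auto
  moreover have "(1 - t) * B (jinv z) x + t * B (jinv z) y = B e e"
    using B_jinv_self[OF z] by (simp add: z_def B_linear)
  ultimately have "(1 - t) * logdet x + t * logdet y \<le> logdet z"
    by (simp add: algebra_simps)
  then show "- logdet ((1 - t) *\<^sub>R x + t *\<^sub>R y) \<le> (1 - t) * - logdet x + t * - logdet y"
    by (simp add: z_def)
qed (rule convex_interior[OF convex_K])

lemma logdet_scale:
  assumes x: "x \<in> interior K" and t: "t > 0"
  shows "logdet (t *\<^sub>R x) = logdet x + B e e * ln t"
proof -
  obtain D l where D: "frame D" "x = (\<Sum>d\<in>D. l d *\<^sub>R d)" using spectral_theorem by blast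
  have os: "orthosystem e D" by (rule frame_orthosystem[OF D(1)])
  have l: "l d > 0" if "d \<in> D" for d using interior_K_iff_coeff_pos[OF os D(2)] x that by blast
  have "t *\<^sub>R x = (\<Sum>d\<in>D. (t * l d) *\<^sub>R d)" unfolding D(2) by (simp add: scaleR_right.sum)
  then have "logdet (t *\<^sub>R x) = (\<Sum>d\<in>D. ln (t * l d) * B d d)" by (rule logdet_orthosystem[OF os])
  also have "\<dots> = (\<Sum>d\<in>D. ln (l d) * B d d + ln t * B d d)"
    using l t by (intro sum.cong) (force simp: ln_mult algebra_simps)+
  also have "\<dots> = logdet x + ln t * (\<Sum>d\<in>D. B d d)"
    using logdet_orthosystem[OF os D(2)] by (simp add: sum.distrib sum_distrib_left)
  also have "(\<Sum>d\<in>D. B d d) = B e e" by (rule orthosystem_B_total[OF os])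
  finally show ?thesis by (simp add: mult.commute)
qed

subsection \<open>Behaviour at the boundary\<close>

text \<open>Some eigenvalue is less than \<open>\<epsilon>\<close> because \<open>x - \<epsilon> e\<close> is outside the cone; its weight is at least \<open>\<delta>\<close>.
  The other eigenvalues are at most \<open>M\<close>.\<close>

lemma logdet_upper_bound:
  assumes x: "x \<in> interior K" and \<delta>: "\<delta> > 0" "\<And>d. idem d \<Longrightarrow> d \<noteq> 0 \<Longrightarrow> B d d \<ge> \<delta>"
    and M: "M \<ge> 1" "B x x \<le> \<delta> * M\<^sup>2" and \<epsilon>: "0 < \<epsilon>" "\<epsilon> \<le> 1" "x - \<epsilon> *\<^sub>R e \<notin> K"
  shows "logdet x \<le> \<delta> * ln \<epsilon> + ln M * B e e"
proof -
  obtain D l where D: "frame D" "x = (\<Sum>d\<in>D. l d *\<^sub>R d)" using spectral_theorem by blast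
  have os: "orthosystem e D" by (rule frame_orthosystem[OF D(1)])
  have fin: "finite D" using os by (simp add: orthosystem_def)
  have l: "l d > 0" if "d \<in> D" for d using interior_K_iff_coeff_pos[OF os D(2)] x that by simp
  have \<delta>D: "B d d \<ge> \<delta>" if "d \<in> D" for d using \<delta>(2) os that by (simp add: orthosystem_def)
  have lM: "l d \<le> M" if d: "d \<in> D" for d
  proof -
    have "B x x = (\<Sum>c\<in>D. (l c)\<^sup>2 * B c c)"
    proof -
      have "B x x = B x (\<Sum>c\<in>D. l c *\<^sub>R c)" by (simp only: D(2)[symmetric])
      also have "\<dots> = (\<Sum>c\<in>D. l c * B x c)"
        by (simp only: B_sum_right bilinear_rmul[OF bilinear_B] real_scaleR_def)
      also have "\<dots> = (\<Sum>c\<in>D. l c * (l c * B c c))"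
        by (intro sum.cong refl) (simp only: D(2) orthosystem_B_sum[OF os])
      finally show ?thesis by (simp add: power2_eq_square mult.assoc)
    qed
    moreover have "(l d)\<^sup>2 * B d d \<le> (\<Sum>c\<in>D. (l c)\<^sup>2 * B c c)"
      using fin d by (intro member_le_sum) (auto simp: B_ge_0)
    moreover have "(l d)\<^sup>2 * \<delta> \<le> (l d)\<^sup>2 * B d d" using \<delta>D[OF d] by (intro mult_left_mono) auto
    ultimately have "\<delta> * (l d)\<^sup>2 \<le> \<delta> * M\<^sup>2" using M(2) by (simp add: mult.commute)
    then have "(l d)\<^sup>2 \<le> M\<^sup>2" using \<delta>(1) by simp
    then show ?thesis by (rule power2_le_imp_le) (use M(1) in simp)
  qed
  have "x - \<epsilon> *\<^sub>R e = (\<Sum>d\<in>D. (l d - \<epsilon>) *\<^sub>R d)"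
    using os unfolding D(2) orthosystem_def by (auto simp: scaleR_diff_left sum_subtractf scaleR_right.sum)
  then obtain d where d: "d \<in> D" "l d < \<epsilon>"
    using K_iff_coeff_nonneg[OF os, of "x - \<epsilon> *\<^sub>R e" "\<lambda>d. l d - \<epsilon>"] \<epsilon>(3) by fastforce
  have "logdet x = ln (l d) * B d d + (\<Sum>c\<in>D-{d}. ln (l c) * B c c)"
    unfolding logdet_orthosystem[OF os D(2)] using fin d(1) by (rule sum.remove)
  also have "\<dots> \<le> ln \<epsilon> * \<delta> + (\<Sum>c\<in>D-{d}. ln M * B c c)"
  proof (intro add_mono sum_mono mult_right_mono)
    have "ln (l d) \<le> ln \<epsilon>" using d l \<epsilon> by simp
    moreover have "ln \<epsilon> \<le> 0" using \<epsilon> by simp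
    ultimately have "ln (l d) * B d d \<le> ln \<epsilon> * B d d" "ln \<epsilon> * B d d \<le> ln \<epsilon> * \<delta>"
      using \<delta>D[OF d(1)] B_ge_0[of d] by (auto intro: mult_right_mono mult_left_mono_neg)
    then show "ln (l d) * B d d \<le> ln \<epsilon> * \<delta>" by linarith
    fix c assume "c \<in> D - {d}"
    then show "ln (l c) \<le> ln M" "B c c \<ge> 0" using l lM B_ge_0 M(1) by auto
  qed
  also have "(\<Sum>c\<in>D-{d}. ln M * B c c) \<le> (\<Sum>c\<in>D. ln M * B c c)"
    using fin M(1) B_ge_0 by (intro sum_mono2) auto
  also have "\<dots> = ln M * B e e" by (simp add: orthosystem_B_total[OF os] flip: sum_distrib_left)
  finally show ?thesis by (simp add: mult.commute)
qed

lemma logdet_boundary: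
  assumes X: "\<And>k::nat. X k \<in> interior K" and lim: "X \<longlonglongrightarrow> z" and z: "z \<in> frontier K"
  shows "filterlim (\<lambda>k. - logdet (X k)) at_top sequentially"
proof -
  obtain \<delta> where \<delta>: "\<delta> > 0" "\<And>d. idem d \<Longrightarrow> d \<noteq> 0 \<Longrightarrow> B d d \<ge> \<delta>"
    using idem_lower_bound by blast
  have "(\<lambda>k. B (X k) (X k)) \<longlonglongrightarrow> B z z"
    by (rule bounded_bilinear.tendsto[OF bounded_bilinear_B lim lim])
  then have "\<exists>b. \<forall>k. norm (B (X k) (X k)) \<le> b"
    using Bseq_def convergent_imp_Bseq convergentI by metis
  then obtain b where b: "\<And>k. B (X k) (X k) \<le> b" by (metis real_norm_def abs_le_D1)
  \<comment> \<open>the summand 1 makes \<open>ln M\<close> nonnegative and \<open>M \<le> M\<^sup>2\<close>\<close>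
  define M where "M = 1 + \<bar>b\<bar> / \<delta>"
  have M: "M \<ge> 1" using \<delta>(1) by (simp add: M_def)
  have bM: "B (X k) (X k) \<le> \<delta> * M\<^sup>2" for k
  proof -
    have "B (X k) (X k) \<le> \<bar>b\<bar>" using b[of k] by linarith
    also have "\<dots> \<le> \<delta> * M" using \<delta>(1) by (simp add: M_def distrib_left)
    also have "\<dots> \<le> \<delta> * M\<^sup>2" using M \<delta>(1) by (simp add: power2_eq_square)
    finally show ?thesis .
  qed
  show ?thesis
    unfolding filterlim_at_top
  proof
    fix Z :: real
    \<comment> \<open>chosen such that \<open>\<delta> * ln \<epsilon> + ln M * B e e \<le> - Z\<close>\<close>
    define \<epsilon> where "\<epsilon> = exp (- \<bar>Z + ln M * B e e\<bar> / \<delta>)"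
    have \<epsilon>: "0 < \<epsilon>" "\<epsilon> \<le> 1" using \<delta>(1) by (simp_all add: \<epsilon>_def)
    have "z \<notin> interior K" using z by (simp add: frontier_def)
    then have zK: "z - \<epsilon> *\<^sub>R e \<in> - K" using interior_K_iff \<epsilon>(1) by auto
    have "(\<lambda>k. X k - \<epsilon> *\<^sub>R e) \<longlonglongrightarrow> z - \<epsilon> *\<^sub>R e" by (intro tendsto_intros lim)
    then have "eventually (\<lambda>k. X k - \<epsilon> *\<^sub>R e \<in> - K) sequentially"
      using closed_K zK by (intro topological_tendstoD) auto
    then show "eventually (\<lambda>k. Z \<le> - logdet (X k)) sequentially"
    proof eventually_elim
      case (elim k)
      have "logdet (X k) \<le> \<delta> * ln \<epsilon> + ln M * B e e"
        using logdet_upper_bound[OF X \<delta> M bM \<epsilon>] elim by simp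
      also have "\<delta> * ln \<epsilon> = - \<bar>Z + ln M * B e e\<bar>" using \<delta>(1) by (simp add: \<epsilon>_def)
      finally show ?case by linarith
    qed
  qed
qed

subsection \<open>Automorphisms that change the logarithm by a constant\<close>

definition logdet_shift :: "('a \<Rightarrow> 'a) \<Rightarrow> real \<Rightarrow> bool" where
  "logdet_shift A k \<longleftrightarrow> linear A \<and> bij A \<and> A ` interior K = interior K \<and>
     (\<forall>x\<in>interior K. logdet (A x) = logdet x + k)"

lemma logdet_shift_compose:
  assumes "logdet_shift A k" "logdet_shift A' k'"
  shows "logdet_shift (A \<circ> A') (k + k')"
  unfolding logdet_shift_def
proof (intro conjI ballI)
  show "linear (A \<circ> A')" "bij (A \<circ> A')"
    using assms by (simp_all add: logdet_shift_def linear_compose bij_comp)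
  have "(A \<circ> A') ` interior K = A ` (A' ` interior K)" by (rule image_comp[symmetric])
  then show "(A \<circ> A') ` interior K = interior K" using assms by (simp add: logdet_shift_def)
  fix x assume "x \<in> interior K"
  moreover from this have "A' x \<in> interior K" using assms(2) unfolding logdet_shift_def by blast
  ultimately show "logdet ((A \<circ> A') x) = logdet x + (k + k')"
    using assms by (simp add: logdet_shift_def)
qed

text \<open>This is the quadratic representation of \<open>a c + (e - c)\<close>, written in Peirce components.\<close>

definition peirce_scale :: "'a \<Rightarrow> real \<Rightarrow> 'a \<Rightarrow> 'a" where
  "peirce_scale c a v = a\<^sup>2 *\<^sub>R peirce1 c v + a *\<^sub>R peirce_half c v + peirce0 c v"

lemma linear_peirce_scale: "linear (peirce_scale c a)"
  by (rule linearI) (simp_all add: peirce_scale_def peirce_defs P_linear algebra_simps)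

lemma mult_peirce_scale:
  assumes "idem c"
  shows "c \<odot> peirce_scale c a v = a\<^sup>2 *\<^sub>R peirce1 c v + (a / 2) *\<^sub>R peirce_half c v"
  by (simp add: peirce_scale_def P_linear peirce_eigen[OF assms])

lemma peirce_scale_mult:
  assumes "idem c"
  shows "peirce_scale c a (peirce_scale c b v) = peirce_scale c (a * b) v"
proof -
  define p q r where pqr: "p = peirce1 c v" "q = peirce_half c v" "r = peirce0 c v"
  have cw: "c \<odot> (\<alpha> *\<^sub>R p + \<beta> *\<^sub>R q + \<gamma> *\<^sub>R r) = \<alpha> *\<^sub>R p + (\<beta> / 2) *\<^sub>R q" for \<alpha> \<beta> \<gamma>
    by (simp add: pqr P_linear peirce_eigen[OF assms])
  have cw': "c \<odot> (\<alpha> *\<^sub>R p + \<beta> *\<^sub>R q) = \<alpha> *\<^sub>R p + (\<beta> / 2) *\<^sub>R q" for \<alpha> \<beta>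
    by (simp add: pqr P_linear peirce_eigen[OF assms])
  have v: "peirce_scale c b v = b\<^sup>2 *\<^sub>R p + b *\<^sub>R q + 1 *\<^sub>R r"
    by (simp add: peirce_scale_def pqr)
  have "peirce1 c (peirce_scale c b v) = b\<^sup>2 *\<^sub>R p"
    "peirce_half c (peirce_scale c b v) = b *\<^sub>R q"
    "peirce0 c (peirce_scale c b v) = r"
    unfolding v peirce_defs cw cw'
    by (auto simp: euclidean_eq_iff[where 'a='a] inner_simps algebra_simps)
  then show ?thesis
    by (simp add: peirce_scale_def pqr power_mult_distrib)
qed

lemma peirce_scale_1: "peirce_scale c 1 v = v"
  by (simp add: peirce_scale_def peirce_sum)

text \<open>The curve \<open>y(t) = peirce_scale c (exp (\<sigma> t)) x\<close> solves \<open>y' = 2 \<sigma> c \<odot> y\<close>, along which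
  the logarithm grows linearly, since its derivative is
  \<open>2 \<sigma> B (jinv y) (c \<odot> y) = 2 \<sigma> B c e\<close>. So it stays bounded, and the curve
  cannot reach the boundary.\<close>

lemma peirce_scale_flow:
  assumes c: "idem c" and x: "x \<in> interior K"
  shows "peirce_scale c (exp \<sigma>) x \<in> interior K"
    and "logdet (peirce_scale c (exp \<sigma>) x) = logdet x + 2 * \<sigma> * B c e"
proof -
  define y where "y = (\<lambda>t. peirce_scale c (exp (\<sigma> * t)) x)"
  have y0: "y 0 = x" by (simp add: y_def peirce_scale_1)
  have dy: "(y has_derivative (\<lambda>h. h *\<^sub>R ((2 * \<sigma>) *\<^sub>R (c \<odot> y t)))) (at t)" for t
  proof -
    have cy: "c \<odot> y t = exp (2 * (\<sigma> * t)) *\<^sub>R peirce1 c x + (exp (\<sigma> * t) / 2) *\<^sub>R peirce_half c x"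
      by (simp add: y_def mult_peirce_scale[OF c] exp_double)
    have y: "y = (\<lambda>t. exp (2 * (\<sigma> * t)) *\<^sub>R peirce1 c x + exp (\<sigma> * t) *\<^sub>R peirce_half c x + peirce0 c x)"
      by (simp add: y_def peirce_scale_def exp_double)
    show ?thesis
      unfolding cy unfolding y
      by (auto intro!: derivative_eq_intros simp: algebra_simps)
  qed
  have conty: "continuous_on A y" for A
    by (intro continuous_at_imp_continuous_on ballI has_derivative_continuous[OF dy])
  have const: "logdet (y s) = logdet x + 2 * \<sigma> * s * B c e"
    if s: "s \<ge> 0" and mem: "\<And>t. 0 \<le> t \<Longrightarrow> t \<le> s \<Longrightarrow> y t \<in> interior K" for s
  proof (cases "s = 0")
    case False
    define g where "g = (\<lambda>t. logdet (y t) - 2 * \<sigma> * B c e * t)"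
    have dg: "(g has_real_derivative 0) (at t)" if t: "0 \<le> t" "t \<le> s" for t
    proof -
      have "(logdet \<circ> y has_derivative B (jinv (y t)) \<circ> (\<lambda>h. h *\<^sub>R ((2 * \<sigma>) *\<^sub>R (c \<odot> y t)))) (at t)"
        by (rule diff_chain_at[OF dy has_derivative_logdet[OF mem[OF t]]])
      then have "((\<lambda>t. logdet (y t)) has_derivative (\<lambda>h. h * (2 * \<sigma> * B c e))) (at t)"
        by (simp add: o_def B_linear B_jinv_mult[OF mem[OF t]] mult.assoc)
      then have "((\<lambda>t. logdet (y t)) has_real_derivative (2 * \<sigma> * B c e)) (at t)"
        by (simp add: has_field_derivative_def mult_commute_abs)
      then show ?thesis unfolding g_def by (auto intro!: derivative_eq_intros)
    qed
    have "\<exists>z>0. z < s \<and> g s - g 0 = (s - 0) * 0"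
      by (rule MVT2) (use s False dg in simp_all)
    then have "g s = g 0" by auto
    then show ?thesis by (simp add: g_def y0 algebra_simps)
  qed (simp add: y0)
  have inside: "y t \<in> interior K" if t: "0 \<le> t" for t
  proof (rule ccontr)
    assume out: "y t \<notin> interior K"
    define S where "S = {0..t} \<inter> y -` (- interior K)"
    have "closed S" unfolding S_def by (rule continuous_closed_preimage[OF conty]) auto
    moreover have "t \<in> S" using t out by (simp add: S_def)
    moreover have bdd: "bdd_below S" by (rule bdd_belowI[of _ 0]) (simp add: S_def)
    ultimately have "Inf S \<in> S" using closed_contains_Inf by blast
    define r where "r = Inf S"
    have r: "0 \<le> r" "y r \<notin> interior K" using \<open>Inf S \<in> S\<close> by (auto simp: r_def S_def)
    have before: "y s \<in> interior K" if "0 \<le> s" "s < r" for s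
    proof (rule ccontr)
      assume "y s \<notin> interior K"
      moreover have "r \<le> t" using \<open>Inf S \<in> S\<close> by (simp add: r_def S_def)
      ultimately have "s \<in> S" using that by (simp add: S_def)
      then have "r \<le> s" unfolding r_def by (rule cInf_lower[OF _ bdd])
      then show False using that by simp
    qed
    have "r > 0" using r y0 x by (cases "r = 0") auto
    define s where "s = (\<lambda>k::nat. r - r / real (Suc k))"
    have s: "0 \<le> s k" "s k < r" for k
      using \<open>r > 0\<close> by (simp_all add: s_def field_simps)
    have "(\<lambda>k. r * inverse (real (Suc k))) \<longlonglongrightarrow> r * 0"
      by (intro tendsto_mult_left LIMSEQ_inverse_real_of_nat)
    then have "s \<longlonglongrightarrow> r - r * 0"
      unfolding s_def divide_inverse by (intro tendsto_diff tendsto_const)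
    then have "s \<longlonglongrightarrow> r" by simp
    then have lim: "(\<lambda>k. y (s k)) \<longlonglongrightarrow> y r"
      by (rule isCont_tendsto_compose[OF has_derivative_continuous[OF dy]])
    have X: "y (s k) \<in> interior K" for k using before s by blast
    have "y r \<in> K"
      using closed_sequentially[OF closed_K _ lim] X interior_subset by blast
    then have "y r \<in> frontier K" using r(2) closed_K by (simp add: frontier_def)
    from logdet_boundary[OF X lim this]
    have "eventually (\<lambda>k. \<bar>logdet x\<bar> + 2 * \<bar>\<sigma>\<bar> * r * \<bar>B c e\<bar> + 1 \<le> - logdet (y (s k))) sequentially"
      unfolding filterlim_at_top by blast
    then obtain k where "\<bar>logdet x\<bar> + 2 * \<bar>\<sigma>\<bar> * r * \<bar>B c e\<bar> + 1 \<le> - logdet (y (s k))"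
      using eventually_happens sequentially_bot by blast
    moreover have "logdet (y (s k)) = logdet x + 2 * \<sigma> * s k * B c e"
      using s[of k] before by (intro const) auto
    moreover have "\<bar>2 * \<sigma> * s k * B c e\<bar> \<le> 2 * \<bar>\<sigma>\<bar> * r * \<bar>B c e\<bar>"
      unfolding abs_mult using s[of k] by (intro mult_mono) auto
    ultimately show False by linarith
  qed
  show "peirce_scale c (exp \<sigma>) x \<in> interior K" using inside[of 1] by (simp add: y_def)
  show "logdet (peirce_scale c (exp \<sigma>) x) = logdet x + 2 * \<sigma> * B c e"
    using const[of 1] inside by (simp add: y_def)
qed

lemma logdet_shift_peirce_scale:
  assumes c: "idem c" and a: "a > 0"
  shows "logdet_shift (peirce_scale c a) (2 * ln a * B c e)"
proof -
  have inv: "peirce_scale c a (peirce_scale c (1 / a) v) = v" "peirce_scale c (1 / a) (peirce_scale c a v) = v" for v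
    using a by (simp_all add: peirce_scale_mult[OF c] peirce_scale_1)
  have "bij (peirce_scale c a)"
    using inv by (intro o_bij[of "peirce_scale c (1 / a)"]) (auto simp: o_def id_def)
  moreover have mem: "peirce_scale c b x \<in> interior K" if "b > 0" "x \<in> interior K" for b x
    using peirce_scale_flow(1)[OF c that(2), of "ln b"] that(1) by simp
  have "peirce_scale c a ` interior K = interior K"
  proof
    show "peirce_scale c a ` interior K \<subseteq> interior K" using mem[OF a] by blast
    show "interior K \<subseteq> peirce_scale c a ` interior K"
    proof
      fix x assume "x \<in> interior K"
      then have "peirce_scale c (1 / a) x \<in> interior K" using mem a by simp
      then show "x \<in> peirce_scale c a ` interior K" using inv(1)[of x] by (metis imageI)
    qed
  qed
  moreover have "logdet (peirce_scale c a x) = logdet x + 2 * ln a * B c e" if "x \<in> interior K" for x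
    using peirce_scale_flow(2)[OF c that, of "ln a"] a by simp
  ultimately show ?thesis unfolding logdet_shift_def using linear_peirce_scale by blast
qed

text \<open>The scalings belonging to the single idempotents are composed; each one fixes the other
  idempotents of the system.\<close>

lemma logdet_shift_diagonal:
  assumes D: "orthosystem u D" and l: "\<And>d. d \<in> D \<Longrightarrow> l d > 0"
  shows "\<exists>A k. logdet_shift A k \<and> (\<forall>d\<in>D. A d = l d *\<^sub>R d)"
proof -
  have step: "\<exists>A k. logdet_shift A k \<and> (\<forall>d\<in>S. A d = l d *\<^sub>R d) \<and> (\<forall>d\<in>D-S. A d = d)"
    if "finite S" "S \<subseteq> D" for S
    using that
  proof (induction S)
    case empty
    have "logdet_shift id 0" by (simp add: logdet_shift_def linear_id)
    then show ?case by (intro exI[of _ id] exI[of _ 0] conjI) (simp_all add: id_def)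
  next
    case (insert c S)
    then obtain A k where A: "logdet_shift A k" "\<forall>d\<in>S. A d = l d *\<^sub>R d" "\<forall>d\<in>D-S. A d = d" by auto
    define T where "T = peirce_scale c (sqrt (l c))"
    have c: "idem c" "c \<in> D" "l c > 0" using insert D l by (auto simp: orthosystem_def)
    have T: "logdet_shift T (2 * ln (sqrt (l c)) * B c e)"
      unfolding T_def using c by (intro logdet_shift_peirce_scale) auto
    have Tc: "T c = l c *\<^sub>R c"
    proof -
      have "peirce1 c c = c" "peirce_half c c = 0" "peirce0 c c = 0"
        unfolding peirce_defs c(1) by (auto simp: euclidean_eq_iff[where 'a='a] inner_simps)
      then show ?thesis using c(3) by (simp add: T_def peirce_scale_def)
    qed
    have Td: "T d = d" if "d \<in> D" "d \<noteq> c" for d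
    proof -
      have "c \<odot> d = 0" using D that c(2) by (auto simp: orthosystem_def)
      then show ?thesis by (simp add: T_def peirce_scale_def peirce_defs P_linear)
    qed
    have linA: "linear A" using A(1) by (simp add: logdet_shift_def)
    have "(A \<circ> T) c = l c *\<^sub>R c"
      using A(3) insert c by (simp add: Tc linear_cmul[OF linA])
    moreover have "(A \<circ> T) d = l d *\<^sub>R d" if "d \<in> S" for d
    proof -
      have "d \<in> D" "d \<noteq> c" using that insert.prems insert.hyps by auto
      then show ?thesis using that A(2) Td[of d] by simp
    qed
    moreover have "(A \<circ> T) d = d" if "d \<in> D - insert c S" for d
      using that A(3) Td[of d] by auto
    ultimately show ?case using logdet_shift_compose[OF A(1) T] by blast
  qed
  have "finite D" using D by (simp add: orthosystem_def)
  then show ?thesis using step[of D] by blast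
qed

lemma logdet_shift_transitive:
  assumes "w \<in> interior K"
  shows "\<exists>A k. logdet_shift A k \<and> A e = w"
proof -
  obtain D l where D: "frame D" "w = (\<Sum>d\<in>D. l d *\<^sub>R d)" using spectral_theorem by blast
  have os: "orthosystem e D" by (rule frame_orthosystem[OF D(1)])
  have "l d > 0" if "d \<in> D" for d using interior_K_iff_coeff_pos[OF os D(2)] assms that by blast
  from logdet_shift_diagonal[of e D l, OF os this] obtain A k where
    A: "logdet_shift A k" "\<forall>d\<in>D. A d = l d *\<^sub>R d" by blast
  have "linear A" using A(1) by (simp add: logdet_shift_def)
  then have "A (\<Sum>d\<in>D. d) = w" using A(2) D(2) by (simp add: linear_sum)
  then show ?thesis using A(1) os by (auto simp: orthosystem_def)
qed

subsection \<open>The barrier given by the logarithm of the determinant\<close>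

lemma logdet_e: "logdet e = 0"
proof -
  obtain D l where "frame D" "e = (\<Sum>d\<in>D. l d *\<^sub>R d)" using spectral_theorem by blast
  then have D: "orthosystem e D" using frame_orthosystem by blast
  then have "e = (\<Sum>d\<in>D. 1 *\<^sub>R d)" by (simp add: orthosystem_def)
  from logdet_orthosystem[OF D this] show ?thesis by simp
qed

lemma jinv_interior:
  assumes x: "x \<in> interior K"
  shows "jinv x \<in> interior K" "jinv (jinv x) = x" "logdet (jinv x) = - logdet x"
proof -
  obtain D l where D: "frame D" "x = (\<Sum>d\<in>D. l d *\<^sub>R d)" using spectral_theorem by blast
  have os: "orthosystem e D" by (rule frame_orthosystem[OF D(1)])
  have l: "l d > 0" if "d \<in> D" for d using interior_K_iff_coeff_pos[OF os D(2)] x that by simp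
  have jx: "jinv x = (\<Sum>d\<in>D. (1 / l d) *\<^sub>R d)" by (rule jinv_orthosystem[OF os D(2) x])
  show mem: "jinv x \<in> interior K" unfolding interior_K_iff_coeff_pos[OF os jx] using l by simp
  show "jinv (jinv x) = x" by (rule solve_unique[OF mem]) (simp add: comm[of "jinv x" x] solve_right[OF x])
  have "logdet (jinv x) = (\<Sum>d\<in>D. ln (1 / l d) * B d d)" by (rule logdet_orthosystem[OF os jx])
  also have "\<dots> = (\<Sum>d\<in>D. - (ln (l d) * B d d))"
    using l by (intro sum.cong) (auto simp: ln_div)
  finally show "logdet (jinv x) = - logdet x" by (simp add: logdet_orthosystem[OF os D(2)] sum_negf)
qed

lemma logdet_shift_interior_iff:
  assumes "logdet_shift A k"
  shows "A x \<in> interior K \<longleftrightarrow> x \<in> interior K"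
proof
  assume "A x \<in> interior K"
  then obtain y where y: "y \<in> interior K" "A y = A x"
    using assms unfolding logdet_shift_def by (metis imageE)
  moreover have "inj A" using assms by (simp add: logdet_shift_def bij_is_inj)
  ultimately show "x \<in> interior K" by (metis injD)
qed (use assms in \<open>auto simp: logdet_shift_def\<close>)

lemma K_limit:
  assumes w: "w \<in> K" and "\<And>t. t > 0 \<Longrightarrow> y + t *\<^sub>R w \<in> K"
  shows "y \<in> K"
  unfolding K_self_dual
proof
  fix s assume s: "s \<in> K"
  have "B w s \<ge> 0" using w s by (rule K_pairing_nonneg)
  show "B y s \<ge> 0"
  proof (rule field_le_epsilon)
    fix \<epsilon> :: real assume \<epsilon>: "\<epsilon> > 0"
    define t where "t = \<epsilon> / (B w s + 1)"
    have "t > 0" using \<epsilon> \<open>B w s \<ge> 0\<close> by (simp add: t_def)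
    then have "0 \<le> B (y + t *\<^sub>R w) s" using assms(2) s K_pairing_nonneg by blast
    also have "\<dots> = B y s + t * B w s" by (simp add: B_linear)
    also have "t * B w s \<le> \<epsilon>" using \<epsilon> \<open>B w s \<ge> 0\<close> by (simp add: t_def field_simps)
    finally show "0 \<le> B y s + \<epsilon>" by simp
  qed
qed

lemma logdet_shift_K_iff:
  assumes A: "logdet_shift A k"
  shows "A x \<in> K \<longleftrightarrow> x \<in> K"
proof -
  have linA: "linear A" using A by (simp add: logdet_shift_def)
  have Ae: "A e \<in> interior K" using logdet_shift_interior_iff[OF A] e_in_interior_K by blast
  have eq: "A (x + t *\<^sub>R e) = A x + t *\<^sub>R A e" for t by (simp add: linear_add[OF linA] linear_cmul[OF linA])
  show ?thesis
  proof
    assume x: "A x \<in> K"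
    have "x + t *\<^sub>R e \<in> interior K" if "t > 0" for t
      using interior_K_add[OF x interior_K_scale[OF Ae that]] logdet_shift_interior_iff[OF A, of "x + t *\<^sub>R e"]
      by (simp add: eq)
    then show "x \<in> K" using K_limit[OF e_in_K] interior_subset by blast
  next
    assume x: "x \<in> K"
    have "A x + t *\<^sub>R A e \<in> interior K" if "t > 0" for t
      using interior_K_add[OF x interior_K_scale[OF e_in_interior_K that]]
        logdet_shift_interior_iff[OF A, of "x + t *\<^sub>R e"] by (simp add: eq)
    then show "A x \<in> K" using K_limit[of "A e" "A x"] Ae interior_subset by blast
  qed
qed

text \<open>Differentiation of \<open>logdet (A y) = logdet y + k\<close>.\<close>

lemma logdet_shift_derivatives:
  assumes A: "logdet_shift A k" and x: "x \<in> interior K"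
  shows "D1 logdet (A x) (A u) = D1 logdet x u"
    "D2 logdet (A x) (A u) (A v) = D2 logdet x u v"
    "D3 logdet (A x) (A u) (A v) (A w) = D3 logdet x u v w"
proof -
  have linA: "linear A" using A by (simp add: logdet_shift_def)
  have int: "A y \<in> interior K" if "y \<in> interior K" for y using logdet_shift_interior_iff[OF A] that by blast
  have 1: "D1 logdet (A y) (A u) = D1 logdet y u" if "y \<in> interior K" for y u
    using D1_affine_compose[OF open_interior that _ linA, of logdet 1 logdet "-k" u]
      Ck_on_3D(1)[OF Ck_on_logdet int[OF that]] A by (simp add: logdet_shift_def)
  have 2: "D2 logdet (A y) (A u) (A v) = D2 logdet y u v" if "y \<in> interior K" for y u v
    unfolding D2_def
    using D1_affine_compose[OF open_interior that _ linA, of "\<lambda>y. D1 logdet y u" 1 "\<lambda>y. D1 logdet y (A u)" 0 v]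
      Ck_on_3D(2)[OF Ck_on_logdet int[OF that]] 1 by simp
  have 3: "D3 logdet (A y) (A u) (A v) (A w) = D3 logdet y u v w" if "y \<in> interior K" for y u v w
    unfolding D3_def
    using D1_affine_compose[OF open_interior that _ linA, of "\<lambda>y. D2 logdet y u v" 1 "\<lambda>y. D2 logdet y (A u) (A v)" 0 w]
      Ck_on_3D(3)[OF Ck_on_logdet int[OF that]] 2 by simp
  show "D1 logdet (A x) (A u) = D1 logdet x u"
    "D2 logdet (A x) (A u) (A v) = D2 logdet x u v"
    "D3 logdet (A x) (A u) (A v) (A w) = D3 logdet x u v w"
    using 1 2 3 x by simp_all
qed

text \<open>With \<open>h = \<Sum> l\<^sub>d d\<close> the two sides are \<open>\<bar>\<Sum> l\<^sub>d\<^sup>3 B d d\<bar>\<close> and \<open>r\<^sup>3\<close> with \<open>r\<^sup>2 = \<Sum> l\<^sub>d\<^sup>2 B d d\<close>. The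
  lower bound on \<open>B d d\<close> yields \<open>\<bar>l\<^sub>d\<bar> \<le> r\<close>.\<close>

lemma cubic_form_bound:
  assumes ge1: "\<And>d. primitive d \<Longrightarrow> B d d \<ge> 1"
  shows "\<bar>B (h \<odot> h) h\<bar> \<le> (B h h) powr (3/2)"
proof -
  obtain D l where D: "frame D" "h = (\<Sum>d\<in>D. l d *\<^sub>R d)" using spectral_theorem by blast
  have os: "orthosystem e D" by (rule frame_orthosystem[OF D(1)])
  have fin: "finite D" using os by (simp add: orthosystem_def)
  have Bsum: "B (\<Sum>d\<in>D. k d *\<^sub>R d) h = (\<Sum>d\<in>D. k d * l d * B d d)" for k
  proof -
    have "B (\<Sum>d\<in>D. k d *\<^sub>R d) h = (\<Sum>d\<in>D. k d * B h d)"
      unfolding B_sum_left by (simp add: B_linear B_sym[of h])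
    also have "\<dots> = (\<Sum>d\<in>D. k d * (l d * B d d))"
      by (intro sum.cong refl) (simp only: D(2) orthosystem_B_sum[OF os])
    finally show ?thesis by (simp add: mult.assoc)
  qed
  have hh: "B h h = (\<Sum>d\<in>D. (l d)\<^sup>2 * B d d)"
    using Bsum[of l] D(2) by (simp add: power2_eq_square)
  have "h \<odot> h = (\<Sum>d\<in>D. (l d * l d) *\<^sub>R d)"
    unfolding D(2) by (rule orthosystem_mult_sum[OF os])
  then have hhh: "B (h \<odot> h) h = (\<Sum>d\<in>D. l d * ((l d)\<^sup>2 * B d d))"
    by (simp only: Bsum) (simp add: power2_eq_square mult_ac)
  define r where "r = sqrt (B h h)"
  have r: "r \<ge> 0" "r\<^sup>2 = B h h" using B_ge_0 by (simp_all add: r_def)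
  have le: "\<bar>l d\<bar> \<le> r" if d: "d \<in> D" for d
  proof -
    have "(l d)\<^sup>2 * 1 \<le> (l d)\<^sup>2 * B d d" using ge1[OF frame_primitive[OF D(1) d]] by (intro mult_left_mono) auto
    also have "\<dots> \<le> (\<Sum>c\<in>D. (l c)\<^sup>2 * B c c)" using fin d by (intro member_le_sum) (auto simp: B_ge_0)
    finally have "\<bar>l d\<bar>\<^sup>2 \<le> r\<^sup>2" using r hh by simp
    then show ?thesis by (rule power2_le_imp_le) (rule r(1))
  qed
  have "\<bar>B (h \<odot> h) h\<bar> \<le> (\<Sum>d\<in>D. \<bar>l d * ((l d)\<^sup>2 * B d d)\<bar>)" unfolding hhh by (rule sum_abs)
  also have "\<dots> \<le> (\<Sum>d\<in>D. r * ((l d)\<^sup>2 * B d d))"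
    unfolding abs_mult using le B_ge_0 r(1) by (intro sum_mono mult_mono) auto
  also have "\<dots> = r * B h h" by (simp add: hh sum_distrib_left)
  also have "\<dots> = (B h h) powr (3/2)"
  proof (cases "B h h = 0")
    case False
    then have "B h h > 0" using B_ge_0[of h] by simp
    then have "(B h h) powr (1/2 + 1) = (B h h) powr (1/2) * (B h h) powr 1" by (intro powr_add)
    then show ?thesis using \<open>B h h > 0\<close> by (simp add: r_def powr_half_sqrt)
  qed simp
  finally show ?thesis .
qed

lemma barrier_derivatives:
  assumes F: "\<And>x. x \<in> interior K \<Longrightarrow> F x = c0 - logdet x" and w: "w \<in> interior K"
  shows "D1 F w u = - D1 logdet w u" "D2 F w u v = - D2 logdet w u v" "D3 F w u v z = - D3 logdet w u v z"
proof -
  have lin: "linear (\<lambda>x::'a. x)" by (simp add: linear_iff)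
  have 1: "D1 F y u = - D1 logdet y u" if "y \<in> interior K" for y u
    using D1_affine_compose[OF open_interior that _ lin, of F "-1" logdet c0 u]
      Ck_on_3D(1)[OF Ck_on_logdet that] F by simp
  have 2: "D2 F y u v = - D2 logdet y u v" if "y \<in> interior K" for y u v
    unfolding D2_def
    using D1_affine_compose[OF open_interior that _ lin, of "\<lambda>y. D1 F y u" "-1" "\<lambda>y. D1 logdet y u" 0 v]
      Ck_on_3D(2)[OF Ck_on_logdet that] 1 by simp
  show "D1 F w u = - D1 logdet w u" "D2 F w u v = - D2 logdet w u v" using 1 2 w by simp_all
  show "D3 F w u v z = - D3 logdet w u v z"
    unfolding D3_def
    using D1_affine_compose[OF open_interior w _ lin, of "\<lambda>y. D2 F y u v" "-1" "\<lambda>y. D2 logdet y u v" 0 z]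
      Ck_on_3D(3)[OF Ck_on_logdet w] 2 by simp
qed

lemma barrier_Ck:
  assumes F: "\<And>x. x \<in> interior K \<Longrightarrow> F x = c0 - logdet x"
  shows "Ck_on 3 F (interior K)"
  by (rule Ck_on_cong[OF open_interior _ Ck_on_affine[OF open_interior Ck_on_logdet, of "-1" c0]])
    (simp add: F)

lemma barrier_normal_form:
  assumes F: "\<And>x. x \<in> interior K \<Longrightarrow> F x = c0 - logdet x" and w: "w \<in> interior K"
  shows "\<exists>A k. logdet_shift A k \<and> A e = w \<and> (\<forall>u. D1 F w (A u) = - B e u) \<and>
    (\<forall>u v. D2 F w (A u) (A v) = B u v) \<and> (\<forall>u. D3 F w (A u) (A u) (A u) = - 2 * B (u \<odot> u) u)"
proof -
  obtain A k where A: "logdet_shift A k" "A e = w" using logdet_shift_transitive[OF w] by blast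
  have e: "e \<in> interior K" by (rule e_in_interior_K)
  have "D1 F w (A u) = - B e u" for u
    using logdet_shift_derivatives(1)[OF A(1) e, of u]
    by (simp add: A(2) barrier_derivatives[OF F w] D1_logdet[OF e] solve_unit)
  moreover have "D2 F w (A u) (A v) = B u v" for u v
    using logdet_shift_derivatives(2)[OF A(1) e, of u v]
    by (simp add: A(2) barrier_derivatives[OF F w] D2_logdet[OF e] solve_unit unit_right B_sym[of v u])
  moreover have "D3 F w (A u) (A u) (A u) = - 2 * B (u \<odot> u) u" for u
    using logdet_shift_derivatives(3)[OF A(1) e, of u u u]
    by (simp add: A(2) barrier_derivatives[OF F w] D3_logdet[OF e] solve_unit unit_right)
  ultimately show ?thesis using A by blast
qed

lemma barrier_self_concordant:
  assumes F: "\<And>x. x \<in> interior K \<Longrightarrow> F x = c0 - logdet x"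
    and ge1: "\<And>d. primitive d \<Longrightarrow> B d d \<ge> 1"
  shows "self_concordant_barrier K F"
  unfolding self_concordant_barrier_def
proof (intro conjI allI impI ballI)
  show "Ck_on 3 F (interior K)" by (rule barrier_Ck[OF F])
  have "convex_on (interior K) (\<lambda>x. c0 + - logdet x)"
    by (intro convex_on_add concave_logdet)
      (simp add: convex_on_def convex_interior convex_K flip: distrib_right)
  then show "convex_on (interior K) F"
    using F by (simp add: convex_on_def convexD[OF convex_interior[OF convex_K]])
next
  fix X z assume X: "(\<forall>k::nat. X k \<in> interior K) \<and> X \<longlonglongrightarrow> z \<and> z \<in> frontier K"
  then have "filterlim (\<lambda>k. - logdet (X k)) at_top sequentially" using logdet_boundary by blast
  then have "filterlim (\<lambda>k. c0 + - logdet (X k)) at_top sequentially"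
    by (rule filterlim_tendsto_add_at_top[OF tendsto_const])
  then show "filterlim (\<lambda>k. F (X k)) at_top sequentially" using F X by simp
next
  fix x h assume "x \<in> interior K"
  then obtain A k where A: "logdet_shift A k" "\<forall>u v. D2 F x (A u) (A v) = B u v"
    "\<forall>u. D3 F x (A u) (A u) (A u) = - 2 * B (u \<odot> u) u"
    using barrier_normal_form[OF F] by blast
  obtain u where "h = A u" using A(1) unfolding logdet_shift_def by (metis bij_pointE)
  then show "\<bar>D3 F x h h h\<bar> \<le> 2 * (D2 F x h h) powr (3/2)"
    using A cubic_form_bound[OF ge1, of u] by simp
next
  show "\<exists>\<nu>. \<forall>x\<in>interior K. \<forall>h. \<bar>D1 F x h\<bar>\<^sup>2 \<le> \<nu> * D2 F x h h"
  proof (intro exI[of _ "B e e"] ballI allI)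
    fix x h assume "x \<in> interior K"
    then obtain A k where A: "logdet_shift A k" "\<forall>u v. D2 F x (A u) (A v) = B u v"
      "\<forall>u. D1 F x (A u) = - B e u"
      using barrier_normal_form[OF F] by blast
    obtain u where "h = A u" using A(1) unfolding logdet_shift_def by (metis bij_pointE)
    moreover have "(B e u)\<^sup>2 \<le> B e e * B u u"
    proof (cases "e = 0")
      case False
      \<comment> \<open>Cauchy-Schwarz: \<open>v\<close> is a multiple of the part of \<open>u\<close> orthogonal to \<open>e\<close>\<close>
      define v where "v = B e e *\<^sub>R u - B e u *\<^sub>R e"
      have "0 \<le> B v v" by (rule B_ge_0)
      also have "B v v = B e e * (B e e * B u u - (B e u)\<^sup>2)"
        by (simp add: v_def B_linear B_sym[of u e] power2_eq_square algebra_simps)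
      finally show ?thesis using B_pos[OF False] by (simp add: zero_le_mult_iff)
    qed (simp add: B_linear)
    ultimately show "\<bar>D1 F x h\<bar>\<^sup>2 \<le> B e e * D2 F x h h" using A by simp
  qed
qed

text \<open>At \<open>w = A e\<close> the Hessian is \<open>B\<close> transported by \<open>A\<close>. In the coordinates given by \<open>A\<close> the
  conjugate at the image of \<open>A x'\<close> is the supremum of \<open>- B x' y + logdet y\<close> up to a constant; by Klein's
  inequality it is attained at \<open>y = jinv x'\<close>.\<close>

theorem logdet_self_scaled:
  assumes F: "\<And>x. x \<in> interior K \<Longrightarrow> F x = c0 - logdet x"
    and ge1: "\<And>d. primitive d \<Longrightarrow> B d d \<ge> 1"
  shows "self_scaled_barrier K F"
proof -
  have bil: "bilinear (D2 F x)" if "x \<in> interior K" for x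
    by (rule bilinear_D2[OF open_interior barrier_Ck[OF F] that])
  have bij: "bij (hessian F x)" if x: "x \<in> interior K" for x
  proof -
    note H = hessian_inner[OF bil[OF x]]
    obtain A k where A: "logdet_shift A k" "\<forall>u v. D2 F x (A u) (A v) = B u v"
      using barrier_normal_form[OF F x] by blast
    have "u = 0" if "hessian F x u = 0" for u
    proof -
      obtain v where v: "u = A v" using A(1) unfolding logdet_shift_def by (metis bij_pointE)
      have "B v v = 0" using H(2)[of u u] that A(2) v by simp
      then show ?thesis using v A(1) B_eq_0_iff by (simp add: logdet_shift_def linear_0)
    qed
    then have "inj (hessian F x)" using linear_injective_0[OF H(1)] by simp
    then show ?thesis using linear_injective_imp_surjective[OF H(1)] by (simp add: bij_def)
  qed
  have e0: "e \<noteq> 0"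
  proof
    assume "e = 0"
    then have "x = 0" for x :: 'a using unit[of x] by (simp add: P_linear)
    then show False using nonzero_Basis SOME_Basis by metis
  qed
  have log_hom: "F (t *\<^sub>R x) = F x - B e e * ln t" if "x \<in> interior K" "t > 0" for x t
    using F logdet_scale[OF that] interior_K_scale[OF that] that by simp
  have main: "hessian F w x \<in> interior (dual_cone (\<bullet>) K)"
    "conjugate_barrier K F (hessian F w x) = ereal (F x - 2 * F w - B e e)"
    if x: "x \<in> interior K" and w: "w \<in> interior K" for x w
  proof -
    note H = hessian_inner[OF bil[OF w]]
    obtain A k where A: "logdet_shift A k" "A e = w" "\<forall>u v. D2 F w (A u) (A v) = B u v"
      using barrier_normal_form[OF F w] by blast
    have surj: "\<exists>v. u = A v" for u using A(1) unfolding logdet_shift_def by (metis bij_pointE)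
    have "hessian F w ` interior K \<subseteq> dual_cone (\<bullet>) K"
    proof
      fix s assume "s \<in> hessian F w ` interior K"
      then obtain y where y: "y \<in> interior K" "s = hessian F w y" by blast
      obtain y' where y': "y = A y'" using surj by blast
      have "z \<bullet> s \<ge> 0" if z: "z \<in> K" for z
      proof -
        obtain z' where z': "z = A z'" using surj by blast
        have "y \<in> K" using y(1) interior_subset by blast
        then have "y' \<in> K" "z' \<in> K" using y' z z' logdet_shift_K_iff[OF A(1)] by blast+
        then have "B y' z' \<ge> 0" by (rule K_pairing_nonneg)
        then show ?thesis using H(2)[of y z] A(3) y y' z' by (simp add: inner_commute)
      qed
      then show "s \<in> dual_cone (\<bullet>) K" by (simp add: dual_cone_def)
    qed
    moreover have "open (hessian F w ` interior K)"
      using open_surjective_linear_image[OF open_interior H(1)] bij[OF w] by (simp add: bij_is_surj)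
    ultimately have "hessian F w ` interior K \<subseteq> interior (dual_cone (\<bullet>) K)" by (rule interior_maximal)
    then show "hessian F w x \<in> interior (dual_cone (\<bullet>) K)" using x by blast
    obtain x' where x': "x = A x'" using surj by blast
    have x'i: "x' \<in> interior K" using x x' logdet_shift_interior_iff[OF A(1)] by blast
    define q where "q = jinv x'"
    have q: "q \<in> interior K" "jinv q = x'" "logdet q = - logdet x'"
      unfolding q_def using jinv_interior[OF x'i] by auto
    have FA: "F (A y) = c0 - logdet y - k" if "y \<in> interior K" for y
      using F[of "A y"] that logdet_shift_interior_iff[OF A(1)] A(1) by (simp add: logdet_shift_def)
    have pair: "A y \<bullet> hessian F w x = B x' y" for y
      using H(2)[of x "A y"] A(3) x' by (simp add: inner_commute)
    have val: "F x - 2 * F w - B e e = - c0 + k - logdet x' - B e e"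
      using FA[OF x'i] FA[OF e_in_interior_K] x' A(2) by (simp add: logdet_e)
    show "conjugate_barrier K F (hessian F w x) = ereal (F x - 2 * F w - B e e)"
      unfolding conjugate_barrier_def val
    proof (rule antisym)
      show "(SUP y\<in>interior K. ereal (- (y \<bullet> hessian F w x) - F y)) \<le> ereal (- c0 + k - logdet x' - B e e)"
      proof (rule SUP_least)
        fix y assume y: "y \<in> interior K"
        obtain y' where y': "y = A y'" using surj by blast
        have y'i: "y' \<in> interior K" using y y' logdet_shift_interior_iff[OF A(1)] by blast
        show "ereal (- (y \<bullet> hessian F w x) - F y) \<le> ereal (- c0 + k - logdet x' - B e e)"
          using klein_inequality_jinv[OF q(1) y'i] q pair[of y'] FA[OF y'i] y' by simp
      qed
      have "B x' q = B e e" using B_jinv_self[OF q(1)] q(2) by simp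
      then have "- (A q \<bullet> hessian F w x) - F (A q) = - c0 + k - logdet x' - B e e"
        using pair[of q] FA[OF q(1)] q(3) by simp
      moreover have "A q \<in> interior K" using q(1) logdet_shift_interior_iff[OF A(1)] by blast
      ultimately show "ereal (- c0 + k - logdet x' - B e e) \<le> (SUP y\<in>interior K. ereal (- (y \<bullet> hessian F w x) - F y))"
        by (intro SUP_upper2[of "A q"]) simp_all
    qed
  qed
  show ?thesis
    unfolding self_scaled_barrier_def
    using barrier_self_concordant[OF F ge1] bij log_hom main B_pos[OF e0] by blast
qed

end

section \<open>Self-scaled barriers are weighted logarithms of determinants\<close>

lemma euclidean_jordan_transport:
  fixes A :: "'a::euclidean_space \<Rightarrow> 'a"
  assumes "euclidean_jordan P e B" and A: "linear A" "bij A"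
  shows "euclidean_jordan (\<lambda>x y. A (P (inv A x) (inv A y))) (A e) (\<lambda>x y. B (inv A x) (inv A y))"
proof -
  interpret euclidean_jordan P e B by fact
  have inv: "inv A (A x) = x" "A (inv A x) = x" for x
    using A(2) by (simp_all add: bij_is_inj bij_is_surj surj_f_inv_f)
  note li = linear_inv_bij[OF A]
  show ?thesis
  proof
    show "bilinear (\<lambda>x y. A (P (inv A x) (inv A y)))" "bilinear (\<lambda>x y. B (inv A x) (inv A y))"
      by (auto intro!: linearI simp: bilinear_def linear_add[OF li] linear_cmul[OF li]
          linear_add[OF A(1)] linear_cmul[OF A(1)] P_linear B_linear)
    fix x y z
    show "A (P (inv A x) (inv A y)) = A (P (inv A y) (inv A x))" by (simp only: comm[of "inv A x" "inv A y"])
    show "A (P (inv A (A e)) (inv A x)) = x" by (simp add: inv unit)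
    show "B (inv A x) (inv A y) = B (inv A y) (inv A x)" by (rule B_sym)
    show "A (P (inv A x) (inv A (A (P (inv A (A (P (inv A x) (inv A x)))) (inv A y)))))
      = A (P (inv A (A (P (inv A x) (inv A x)))) (inv A (A (P (inv A x) (inv A y)))))"
      by (simp add: inv jordan)
    show "B (inv A (A (P (inv A x) (inv A y)))) (inv A z) = B (inv A y) (inv A (A (P (inv A x) (inv A z))))"
      by (simp add: inv B_assoc)
    assume "x \<noteq> 0"
    then have "inv A x \<noteq> 0" using inv(2)[of x] linear_0[OF A(1)] by metis
    then show "B (inv A x) (inv A x) > 0" by (rule B_pos)
  qed
qed

context euclidean_jordan
begin

lemma self_scaled_D2:
  assumes F: "self_scaled_barrier K F" and w: "w \<in> interior K"
  shows "Ck_on 3 F (interior K)" "bilinear (D2 F w)" "D2 F w u v = D2 F w v u"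
    "linear (hessian F w)" "hessian F w u \<bullet> v = D2 F w u v" "bij (hessian F w)"
proof -
  show C: "Ck_on 3 F (interior K)"
    using F by (simp add: self_scaled_barrier_def self_concordant_barrier_def)
  show b: "bilinear (D2 F w)" by (rule bilinear_D2[OF open_interior C w])
  show "D2 F w u v = D2 F w v u" by (rule D2_symmetric[OF open_interior Ck_on_3_imp_2[OF C] w])
  show "linear (hessian F w)" "hessian F w u \<bullet> v = D2 F w u v" by (rule hessian_inner[OF b])+
  show "bij (hessian F w)" using F w by (simp add: self_scaled_barrier_def)
qed

text \<open>An interior point \<open>s\<close> of the dual cone pairs positively with \<open>y\<close>, as \<open>s - \<epsilon> y\<close> is still in the dual cone
  for small \<open>\<epsilon>\<close>.\<close>

lemma self_scaled_pairing_pos: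
  assumes F: "self_scaled_barrier K F" and w: "w \<in> interior K" and x: "x \<in> interior K" and y: "y \<in> K" "y \<noteq> 0"
  shows "D2 F w x y > 0"
proof -
  define s where "s = hessian F w x"
  have "s \<in> interior (dual_cone (\<bullet>) K)" using F w x by (auto simp: self_scaled_barrier_def s_def)
  then obtain r where r: "r > 0" "ball s r \<subseteq> dual_cone (\<bullet>) K" by (metis mem_interior)
  define \<epsilon> where "\<epsilon> = r / (2 * norm y)"
  have \<epsilon>: "\<epsilon> > 0" "\<epsilon> * norm y < r" using r y(2) by (simp_all add: \<epsilon>_def)
  then have "s - \<epsilon> *\<^sub>R y \<in> ball s r" by (simp add: dist_norm)
  then have "s - \<epsilon> *\<^sub>R y \<in> dual_cone (\<bullet>) K" using r(2) by blast
  then have "y \<bullet> (s - \<epsilon> *\<^sub>R y) \<ge> 0" using y(1) unfolding dual_cone_def by blast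
  then have "y \<bullet> s \<ge> \<epsilon> * (y \<bullet> y)" by (simp add: inner_diff_right)
  moreover have "\<epsilon> * (y \<bullet> y) > 0" using \<epsilon>(1) y(2) by simp
  moreover have "y \<bullet> s = D2 F w x y"
    using self_scaled_D2(5)[OF F w, of x y] by (simp add: s_def inner_commute)
  ultimately show ?thesis by simp
qed

lemma self_scaled_pairing_nonneg:
  assumes F: "self_scaled_barrier K F" and w: "w \<in> interior K" and x: "x \<in> K" and y: "y \<in> K"
  shows "D2 F w x y \<ge> 0"
proof (cases "y = 0")
  case True
  then show ?thesis using bilinear_rzero[OF self_scaled_D2(2)[OF F w]] by simp
next
  case False
  define b where "b = D2 F w e y"
  have b: "b > 0" unfolding b_def by (rule self_scaled_pairing_pos[OF F w e_in_interior_K y False])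
  show ?thesis
  proof (rule field_le_epsilon)
    fix \<epsilon> :: real assume "\<epsilon> > 0"
    then have "\<epsilon> / b > 0" using b by simp
    then have "x + (\<epsilon> / b) *\<^sub>R e \<in> interior K"
      using interior_K_add[OF x interior_K_scale[OF e_in_interior_K]] by blast
    from self_scaled_pairing_pos[OF F w this y False]
    show "0 \<le> D2 F w x y + \<epsilon>"
      using b bilinear_ladd[OF self_scaled_D2(2)[OF F w]] bilinear_lmul[OF self_scaled_D2(2)[OF F w]]
      by (simp add: b_def[symmetric])
  qed
qed

text \<open>Otherwise the segment from \<open>w\<close> to \<open>x\<close> leaves \<open>K\<close> at a boundary point, where \<open>F\<close> blows up. But the
  image of this part of the segment stays above the image of \<open>(1 - \<sigma>) w\<close> in the order of the dual
  cone. The conjugate is antitone for this order, so it is bounded there, and hence so is \<open>F\<close>.\<close>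

lemma self_scaled_dual_preimage:
  assumes F: "self_scaled_barrier K F" and w: "w \<in> interior K" and x: "\<And>y. y \<in> K \<Longrightarrow> D2 F w x y \<ge> 0"
  shows "x \<in> K"
proof (rule ccontr)
  assume "x \<notin> K"
  define H where "H = hessian F w"
  have linH: "linear H" and H: "H u \<bullet> v = D2 F w u v" for u v
    unfolding H_def using self_scaled_D2[OF F w] by blast+
  obtain \<nu> where \<nu>: "\<And>x. x \<in> interior K \<Longrightarrow> conjugate_barrier K F (H x) = ereal (F x - 2 * F w - \<nu>)"
    using F w unfolding self_scaled_barrier_def H_def by blast
  have wK: "w \<in> K" using w interior_subset by blast
  have "closed_segment w x \<inter> frontier K \<noteq> {}"
    using wK \<open>x \<notin> K\<close> by (intro connected_Int_frontier) auto
  then obtain y where "y \<in> closed_segment w x" "y \<in> frontier K" by blast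
  then obtain \<sigma> where y: "y = (1 - \<sigma>) *\<^sub>R w + \<sigma> *\<^sub>R x" "0 \<le> \<sigma>" "\<sigma> \<le> 1" "y \<in> frontier K"
    unfolding in_segment by blast
  have yK: "y \<in> K" using y(4) closed_K by (simp add: frontier_def)
  then have "\<sigma> < 1" using y \<open>x \<notin> K\<close> by (cases "\<sigma> = 1") auto
  define \<epsilon> where "\<epsilon> k = 1 / real (Suc k)" for k
  have \<epsilon>: "0 < \<epsilon> k" "\<epsilon> k \<le> 1" for k by (simp_all add: \<epsilon>_def)
  define X where "X k = y - \<epsilon> k *\<^sub>R (y - w)" for k
  have X: "X k \<in> interior K" for k
    unfolding X_def using mem_interior_closure_convex_shrink[OF convex_K w _ \<epsilon>(1,2)] yK closure_subset by blast
  have "\<epsilon> \<longlonglongrightarrow> 0" unfolding \<epsilon>_def using LIMSEQ_inverse_real_of_nat by (simp add: inverse_eq_divide)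
  then have "X \<longlonglongrightarrow> y - 0 *\<^sub>R (y - w)" unfolding X_def by (intro tendsto_intros)
  then have lim: "X \<longlonglongrightarrow> y" by simp
  have "\<forall>X z. (\<forall>k::nat. X k \<in> interior K) \<and> X \<longlonglongrightarrow> z \<and> z \<in> frontier K
      \<longrightarrow> filterlim (\<lambda>k. F (X k)) at_top sequentially"
    using F unfolding self_scaled_barrier_def self_concordant_barrier_def by blast
  then have "filterlim (\<lambda>k. F (X k)) at_top sequentially" using X lim y(4) by blast
  then have "eventually (\<lambda>k. F ((1 - \<sigma>) *\<^sub>R w) + 1 \<le> F (X k)) sequentially"
    unfolding filterlim_at_top by blast
  then obtain k where "F ((1 - \<sigma>) *\<^sub>R w) + 1 \<le> F (X k)"
    using eventually_happens sequentially_bot by blast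
  moreover have "F (X k) \<le> F ((1 - \<sigma>) *\<^sub>R w)"
  proof -
    define \<tau> where "\<tau> = (1 - \<epsilon> k) * \<sigma>"
    have \<tau>: "0 \<le> \<tau>" "\<tau> \<le> \<sigma>" using \<epsilon>[of k] y(2) by (simp_all add: \<tau>_def mult_left_le_one_le)
    have Xk: "X k = (1 - \<tau>) *\<^sub>R w + \<tau> *\<^sub>R x"
      by (simp add: X_def y(1) \<tau>_def algebra_simps)
    have scaled: "(1 - \<sigma>) *\<^sub>R w \<in> interior K" using interior_K_scale[OF w] \<open>\<sigma> < 1\<close> by simp
    have "z \<bullet> H ((1 - \<sigma>) *\<^sub>R w) \<le> z \<bullet> H (X k)" if z: "z \<in> K" for z
    proof -
      have "z \<bullet> H w \<ge> 0" "z \<bullet> H x \<ge> 0"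
        using self_scaled_pairing_nonneg[OF F w wK z] x[OF z] H[of w z] H[of x z] by (simp_all add: inner_commute)
      then have "(1 - \<sigma>) * (z \<bullet> H w) \<le> (1 - \<tau>) * (z \<bullet> H w)" "0 \<le> \<tau> * (z \<bullet> H x)"
        using \<tau> by (auto intro: mult_right_mono)
      then show ?thesis
        by (simp add: Xk linear_add[OF linH] linear_cmul[OF linH] inner_add_right)
    qed
    then have "conjugate_barrier K F (H (X k)) \<le> conjugate_barrier K F (H ((1 - \<sigma>) *\<^sub>R w))"
      unfolding conjugate_barrier_def using interior_subset by (intro SUP_mono) force
    then show ?thesis using \<nu>[OF X] \<nu>[OF scaled] by simp
  qed
  ultimately show False by simp
qed

text \<open>Euler's identities for \<open>DF\<close> and \<open>D\<^sup>2F\<close>, which are homogeneous of degrees -1 and -2 because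
  \<open>F(t x) = F(x) - \<nu> ln t\<close>.\<close>

lemma self_scaled_homogeneous:
  assumes F: "self_scaled_barrier K F" and x: "x \<in> interior K"
  shows "D1 F x u = - D2 F x u x" "D3 F x u v x = - 2 * D2 F x u v"
proof -
  obtain \<nu> where \<nu>: "\<And>x t. x \<in> interior K \<Longrightarrow> t > 0 \<Longrightarrow> F (t *\<^sub>R x) = F x - \<nu> * ln t"
    using F unfolding self_scaled_barrier_def by blast
  note C = self_scaled_D2(1)[OF F x]
  note d = Ck_on_3D[OF C]
  have lin: "linear ((*\<^sub>R) t)" for t by simp
  have 1: "D1 F y u = t * D1 F (t *\<^sub>R y) u" if "y \<in> interior K" "t > 0" for y t u
  proof -
    note ty = interior_K_scale[OF that]
    have "D1 F y u = 1 * D1 F (t *\<^sub>R y) (t *\<^sub>R u)"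
      by (rule D1_affine_compose[OF open_interior that(1) _ lin d(1)[OF ty], where k = "\<nu> * ln t"])
        (simp add: \<nu> that)
    then show ?thesis by (simp add: linear_cmul[OF linear_D1[OF d(1)[OF ty]]])
  qed
  have 2: "D2 F y u v = t\<^sup>2 * D2 F (t *\<^sub>R y) u v" if "y \<in> interior K" "t > 0" for y t u v
  proof -
    note ty = interior_K_scale[OF that]
    have "D1 (\<lambda>y. D1 F y u) y v = t * D1 (\<lambda>y. D1 F y u) (t *\<^sub>R y) (t *\<^sub>R v)"
      by (rule D1_affine_compose[OF open_interior that(1) _ lin d(2)[OF ty], where k = 0])
        (use 1 that in simp)
    then show ?thesis
      by (simp add: D2_def linear_cmul[OF linear_D1[OF d(2)[OF ty]]] power2_eq_square mult.assoc)
  qed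
  have line: "((\<lambda>t. t *\<^sub>R x) has_derivative (\<lambda>h. h *\<^sub>R x)) (at 1)"
    by (auto intro!: derivative_eq_intros)
  have "((\<lambda>t. D1 F (t *\<^sub>R x) u) has_real_derivative D2 F x u x) (at 1)"
    using DERIV_along_curve[OF line, of "\<lambda>y. D1 F y u"] d(2)[OF x] by (simp add: D2_def)
  then have "((\<lambda>t. t * D1 F (t *\<^sub>R x) u) has_real_derivative D1 F x u + D2 F x u x) (at 1)"
    by (auto intro!: derivative_eq_intros)
  then have "D1 F x u + D2 F x u x = 0"
    by (rule DERIV_local_const[where d=1]) (use 1[OF x] in auto)
  then show "D1 F x u = - D2 F x u x" by simp
  have "((\<lambda>t. D2 F (t *\<^sub>R x) u v) has_real_derivative D3 F x u v x) (at 1)"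
    using DERIV_along_curve[OF line, of "\<lambda>y. D2 F y u v"] d(3)[OF x] by (simp add: D3_def)
  then have "((\<lambda>t. t\<^sup>2 * D2 F (t *\<^sub>R x) u v) has_real_derivative 2 * D2 F x u v + D3 F x u v x) (at 1)"
    by (auto intro!: derivative_eq_intros)
  then have "2 * D2 F x u v + D3 F x u v x = 0"
    by (rule DERIV_local_const[where d=1]) (use 2[OF x] in auto)
  then show "D3 F x u v x = - 2 * D2 F x u v" by simp
qed

text \<open>Let \<open>\<tau>(h,u,v)\<close> be the difference of the two sides at \<open>y = Z v\<close>, where \<open>D\<^sup>2F(e)[Z v,-] = B v -\<close>. It is
  symmetric in \<open>h\<close> and \<open>u\<close>, and it vanishes for \<open>u = e\<close> by homogeneity. For orthogonal
  idempotents \<open>c\<close>, \<open>d\<close> one has \<open>\<tau>(h,c,d) = 0\<close>, since \<open>v \<mapsto> D\<^sup>2F(v)[c,Z d]\<close> has a minimum at \<open>e\<close>. With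
  \<open>e\<close> expanded in a frame also \<open>\<tau>(h,d,d) = 0\<close>, and the spectral theorem gives \<open>\<tau>(h,x,x) = 0\<close> for all \<open>x\<close>. So \<open>\<tau>\<close>
  is alternating in its last two arguments and therefore zero.\<close>

lemma self_scaled_third_derivative:
  assumes F: "self_scaled_barrier K F"
  shows "D3 F e h u y = - 2 * D2 F e (h \<odot> u) y"
proof -
  have e: "e \<in> interior K" by (rule e_in_interior_K)
  define H where "H = hessian F e"
  define R where "R v = (\<Sum>i\<in>Basis. B v i *\<^sub>R i)" for v
  have C: "Ck_on 3 F (interior K)" and bil: "bilinear (D2 F e)" and sym: "D2 F e u v = D2 F e v u"
    and linH: "linear H" and H: "H u \<bullet> v = D2 F e u v" and bijH: "bij H" for u v
    unfolding H_def using self_scaled_D2[OF F e] by blast+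
  have R: "R v \<bullet> u = B v u" for v u
  proof -
    have "B v u = B v (\<Sum>i\<in>Basis. (u \<bullet> i) *\<^sub>R i)" by (simp add: euclidean_representation)
    also have "\<dots> = (\<Sum>i\<in>Basis. (u \<bullet> i) * B v i)" by (simp add: B_sum_right B_linear)
    also have "\<dots> = R v \<bullet> u"
      unfolding R_def inner_sum_left by (intro sum.cong) (simp_all add: inner_commute mult.commute)
    finally show ?thesis by simp
  qed
  have linR: "linear R"
    unfolding R_def by (rule linearI) (simp_all add: B_linear scaleR_add_left sum.distrib scaleR_right.sum)
  have "inj R"
    using linear_injective_0[OF linR] R B_eq_0_iff by (metis inner_zero_left)
  then have surjR: "surj R" using linear_injective_imp_surjective[OF linR] by simp
  define Z where "Z = inv H \<circ> R"
  have HZ: "H (Z v) = R v" for v by (simp add: Z_def surj_f_inv_f bijH bij_is_surj)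
  have Z: "D2 F e (Z v) u = B v u" for v u by (simp add: HZ R flip: H)
  have "linear (inv H)" by (rule linear_inv_bij[OF linH bijH])
  then have linZ: "linear Z" unfolding Z_def by (rule linear_compose[OF linR])
  have surjZ: "surj Z" unfolding Z_def
    by (rule comp_surj[OF surjR bij_is_surj[OF bij_imp_bij_inv[OF bijH]]])
  have ZK: "Z v \<in> K" if "v \<in> K" for v
    using self_scaled_dual_preimage[OF F e, of "Z v"] that K_pairing_nonneg by (simp add: Z)
  define \<tau> where "\<tau> h u v = D3 F e h u (Z v) + 2 * D2 F e (h \<odot> u) (Z v)" for h u v
  have D3sym: "D3 F e u v z = D3 F e v u z" "D3 F e u v z = D3 F e u z v" for u v z
    using D3_symmetric[OF open_interior C e] by blast+
  have lin2: "linear (\<lambda>u. \<tau> h u v)" for h v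
    unfolding \<tau>_def using linear_D3(2)[OF open_interior C e]
    by (intro linear_compose_add linear_compose_scale_right)
      (auto simp: linear_iff P_linear bilinear_ladd[OF bil] bilinear_lmul[OF bil])
  have lin3: "linear (\<lambda>v. \<tau> h u v)" for h u
    using linear_compose[OF linZ linear_D3(3)[OF open_interior C e, of h u]]
      linear_compose[OF linZ, of "D2 F e (h \<odot> u)"] bil
    unfolding \<tau>_def by (simp add: o_def linear_iff bilinear_def algebra_simps)
  have sym12: "\<tau> h u v = \<tau> u h v" for h u v
    unfolding \<tau>_def by (simp add: D3sym(1)[of h u] comm[of h u])
  have unit0: "\<tau> h e v = 0" for h v
    unfolding \<tau>_def
    using self_scaled_homogeneous(2)[OF F e, of h "Z v"] D3sym(2)[of h e "Z v"] by (simp add: unit_right)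
  have orth: "\<tau> h c d = 0" if c: "idem c" and d: "idem d" and cd: "c \<odot> d = 0" for h c d
  proof -
    define \<phi> where "\<phi> = (\<lambda>v. D2 F v c (Z d))"
    have "\<phi> v \<ge> 0" if "v \<in> interior K" for v
      unfolding \<phi>_def by (rule self_scaled_pairing_nonneg[OF F that idem_in_K[OF c] ZK[OF idem_in_K[OF d]]])
    moreover have "\<phi> e = 0"
      unfolding \<phi>_def by (subst sym) (simp add: Z B_sym[of d c] idem_orthogonal_B[OF c cd])
    moreover have "(\<phi> has_derivative D1 \<phi> e) (at e)"
      unfolding \<phi>_def by (rule has_derivative_D1) (rule Ck_on_3D(3)[OF C e])
    ultimately have "D1 \<phi> e = (\<lambda>v. 0)"
      using e by (intro differential_zero_maxmin[of e "interior K" \<phi>]) auto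
    then have "D3 F e c (Z d) h = 0" by (simp add: D3_def \<phi>_def)
    then have "D3 F e h c (Z d) = 0" using D3sym(1)[of h c] D3sym(2)[of c h] by simp
    moreover have "D2 F e (h \<odot> c) (Z d) = 0"
    proof -
      have "D2 F e (h \<odot> c) (Z d) = B d (h \<odot> c)" by (subst sym) (rule Z)
      also have "\<dots> = B (c \<odot> h) d" by (simp add: B_sym[of d] comm[of h c])
      also have "\<dots> = B h (c \<odot> d)" by (rule B_assoc)
      finally show ?thesis by (simp add: cd B_linear)
    qed
    ultimately show ?thesis by (simp add: \<tau>_def)
  qed
  have diag: "\<tau> h x x = 0" for h x
  proof -
    obtain D l where D: "frame D" "x = (\<Sum>d\<in>D. l d *\<^sub>R d)" using spectral_theorem by blast
    have os: "orthosystem e D" by (rule frame_orthosystem[OF D(1)])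
    have fin: "finite D" using os by (simp add: orthosystem_def)
    have cd: "\<tau> h c d = 0" if "c \<in> D" "d \<in> D" "c \<noteq> d" for c d
      using os that by (intro orth) (auto simp: orthosystem_def)
    have dd: "\<tau> h d d = 0" if d: "d \<in> D" for d
    proof -
      have "0 = \<tau> h (\<Sum>c\<in>D. c) d" using os unit0 by (simp add: orthosystem_def)
      also have "\<dots> = (\<Sum>c\<in>D. \<tau> h c d)" by (rule linear_sum[OF lin2])
      also have "\<dots> = (\<Sum>c\<in>D. if c = d then \<tau> h d d else 0)" using cd d by (intro sum.cong) auto
      also have "\<dots> = \<tau> h d d" using fin d by simp
      finally show ?thesis by simp
    qed
    have "\<tau> h x d = 0" if d: "d \<in> D" for d
    proof -
      have "\<tau> h x d = (\<Sum>c\<in>D. l c * \<tau> h c d)"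
        unfolding D(2) by (simp add: linear_sum[OF lin2] linear_cmul[OF lin2])
      also have "\<dots> = 0"
      proof (intro sum.neutral ballI)
        fix c assume "c \<in> D"
        then show "l c * \<tau> h c d = 0" using cd[of c d] dd[OF d] d by (cases "c = d") auto
      qed
      finally show ?thesis .
    qed
    then have "(\<Sum>d\<in>D. l d * \<tau> h x d) = 0" by simp
    moreover have "\<tau> h x (\<Sum>d\<in>D. l d *\<^sub>R d) = (\<Sum>d\<in>D. l d * \<tau> h x d)"
      by (simp add: linear_sum[OF lin3] linear_cmul[OF lin3])
    ultimately show ?thesis using D(2) by simp
  qed
  have alt: "\<tau> h u v = - \<tau> h v u" for h u v
  proof -
    have "\<tau> h (u + v) (u + v) = \<tau> h u u + \<tau> h u v + (\<tau> h v u + \<tau> h v v)"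
      by (simp add: linear_add[OF lin2] linear_add[OF lin3])
    then show ?thesis by (simp add: diag)
  qed
  obtain v where "y = Z v" using surjZ by (metis surjD)
  then show ?thesis
    using symmetric_alternating_zero[of \<tau> h u v, OF sym12 alt] by (simp add: \<tau>_def)
qed

lemma self_scaled_associative:
  assumes F: "self_scaled_barrier K F"
  shows "D2 F e (h \<odot> u) y = D2 F e u (h \<odot> y)"
proof -
  have e: "e \<in> interior K" by (rule e_in_interior_K)
  have "D3 F e h u y = D3 F e h y u" using D3_symmetric(2)[OF open_interior self_scaled_D2(1)[OF F e] e] .
  then show ?thesis
    using self_scaled_third_derivative[OF F, of h u y] self_scaled_third_derivative[OF F, of h y u]
      self_scaled_D2(3)[OF F e, of "h \<odot> y" u] by simp
qed

lemma self_scaled_idem_pos: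
  assumes F: "self_scaled_barrier K F" and d: "idem d" "d \<noteq> 0"
  shows "D2 F e d d > 0" "D2 F e d e = D2 F e d d"
proof -
  show "D2 F e d e = D2 F e d d"
    using self_scaled_associative[OF F, of d d e] d by (simp add: unit_right)
  then show "D2 F e d d > 0"
    using self_scaled_pairing_pos[OF F e_in_interior_K e_in_interior_K idem_in_K[OF d(1)] d(2)]
      self_scaled_D2(3)[OF F e_in_interior_K, of e d] by simp
qed

lemma self_scaled_euclidean_jordan:
  assumes F: "self_scaled_barrier K F"
  shows "euclidean_jordan P e (D2 F e)"
proof
  note e = e_in_interior_K
  note D2 = self_scaled_D2[OF F e]
  show "bilinear P" "bilinear (D2 F e)" by (rule bilinear_P D2)+
  fix x y z
  show "x \<odot> y = y \<odot> x" "e \<odot> x = x" by (rule comm unit)+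
  show "x \<odot> ((x \<odot> x) \<odot> y) = (x \<odot> x) \<odot> (x \<odot> y)" by (rule jordan)
  show "D2 F e x y = D2 F e y x" by (rule D2)
  show "D2 F e (x \<odot> y) z = D2 F e y (x \<odot> z)" by (rule self_scaled_associative[OF F])
  assume "x \<noteq> 0"
  obtain D l where D: "frame D" "x = (\<Sum>d\<in>D. l d *\<^sub>R d)" using spectral_theorem by blast
  have os: "orthosystem e D" by (rule frame_orthosystem[OF D(1)])
  have fin: "finite D" using os by (simp add: orthosystem_def)
  have idem: "idem d" "d \<noteq> 0" if "d \<in> D" for d using os that by (auto simp: orthosystem_def)
  have orth: "D2 F e c d = 0" if "c \<in> D" "d \<in> D" "c \<noteq> d" for c d
  proof -
    have "c \<odot> d = 0" using os that by (simp add: orthosystem_def)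
    then show ?thesis
      using self_scaled_associative[OF F, of c c d] idem(1)[OF that(1)] bilinear_rzero[OF D2(2)] by simp
  qed
  have lin: "linear (D2 F e u)" for u using D2(2) by (simp add: bilinear_def)
  have xd: "D2 F e x d = l d * D2 F e d d" if "d \<in> D" for d
  proof -
    have "D2 F e x d = D2 F e d x" by (rule D2(3))
    also have "\<dots> = D2 F e d (\<Sum>c\<in>D. l c *\<^sub>R c)" by (simp only: D(2)[symmetric])
    also have "\<dots> = (\<Sum>c\<in>D. l c * D2 F e d c)" by (simp add: linear_sum[OF lin] linear_cmul[OF lin])
    also have "\<dots> = (\<Sum>c\<in>D. if c = d then l d * D2 F e d d else 0)"
      using orth that by (intro sum.cong) auto
    finally show ?thesis using fin that by simp
  qed
  have "D2 F e x (\<Sum>d\<in>D. l d *\<^sub>R d) = (\<Sum>d\<in>D. l d * D2 F e x d)"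
    by (simp add: linear_sum[OF lin] linear_cmul[OF lin])
  then have "D2 F e x x = (\<Sum>d\<in>D. (l d)\<^sup>2 * D2 F e d d)"
    using xd D(2) by (simp add: power2_eq_square mult.assoc)
  moreover obtain d where "d \<in> D" "l d \<noteq> 0"
  proof (rule ccontr)
    assume "\<not> thesis"
    then have "\<forall>d\<in>D. l d = 0" using that by blast
    then show False using \<open>x \<noteq> 0\<close> D(2) by simp
  qed
  moreover have "(\<Sum>d\<in>D. (l d)\<^sup>2 * D2 F e d d) > 0"
    using fin \<open>d \<in> D\<close> \<open>l d \<noteq> 0\<close> self_scaled_idem_pos(1)[OF F idem]
    by (intro sum_pos2[of D d]) (auto simp: less_imp_le)
  ultimately show "D2 F e x x > 0" by simp
qed

text \<open>At an idempotent the third derivative is \<open>- 2 b\<close> with \<open>b = D\<^sup>2F(e)[d,d]\<close>, so self-concordance reads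
  \<open>b \<le> b powr (3/2)\<close>.\<close>

lemma self_scaled_idem_ge_1:
  assumes F: "self_scaled_barrier K F" and d: "idem d" "d \<noteq> 0"
  shows "D2 F e d d \<ge> 1"
proof (rule ccontr)
  define b where "b = D2 F e d d"
  assume "\<not> D2 F e d d \<ge> 1"
  then have b: "0 < b" "b < 1" using self_scaled_idem_pos(1)[OF F d] by (simp_all add: b_def)
  have "\<bar>D3 F e d d d\<bar> \<le> 2 * b powr (3/2)"
    using F e_in_interior_K by (simp add: b_def self_scaled_barrier_def self_concordant_barrier_def)
  then have "b \<le> b powr (3/2)"
    using b self_scaled_third_derivative[OF F, of d d d] by (simp add: d b_def)
  moreover have "b powr (3/2) < b powr 1" using b by (intro powr_less_mono') auto
  ultimately show False using b by simp
qed

text \<open>Associativity of the Hessian at an arbitrary point \<open>A e\<close> follows by applying the result at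
  the unit to the algebra transported along the automorphism \<open>A\<close>, which has the same cone.\<close>

lemma self_scaled_associative_transported:
  assumes F: "self_scaled_barrier K F" and A: "logdet_shift A k"
  shows "D2 F (A e) (A (h \<odot> u)) (A y) = D2 F (A e) (A u) (A (h \<odot> y))"
proof -
  have linA: "linear A" and bijA: "bij A" using A by (simp_all add: logdet_shift_def)
  have inv: "inv A (A x) = x" "A (inv A x) = x" for x
    using bijA by (simp_all add: bij_is_inj bij_is_surj surj_f_inv_f)
  interpret T: euclidean_jordan "\<lambda>x y. A (P (inv A x) (inv A y))" "A e" "\<lambda>x y. B (inv A x) (inv A y)"
    by (rule euclidean_jordan_transport[OF euclidean_jordan_axioms linA bijA])
  have "T.K = K"
  proof (rule set_eqI)
    fix x
    have "x \<in> T.K \<longleftrightarrow> inv A x \<in> K"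
    proof
      assume "x \<in> T.K"
      then obtain y where "x = A (P (inv A y) (inv A y))" unfolding cone_of_squares_def by blast
      then show "inv A x \<in> K" using square_in_K inv(1) by simp
    next
      assume "inv A x \<in> K"
      then obtain z where z: "inv A x = z \<odot> z" unfolding cone_of_squares_def by blast
      have "x = A (z \<odot> z)" using inv(2)[of x] z by simp
      then show "x \<in> T.K" using T.square_in_K[of "A z"] inv(1) by simp
    qed
    also have "\<dots> \<longleftrightarrow> x \<in> K" using logdet_shift_K_iff[OF A, of "inv A x"] by (simp add: inv)
    finally show "x \<in> T.K \<longleftrightarrow> x \<in> K" .
  qed
  then have "self_scaled_barrier T.K F" using F by simp
  from T.self_scaled_associative[OF this, of "A h" "A u" "A y"] show ?thesis by (simp add: inv)
qed

lemma self_scaled_flat_orthogonal: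
  assumes F: "self_scaled_barrier K F" and D: "orthosystem e D" and l: "\<And>d. d \<in> D \<Longrightarrow> l d > 0"
    and cd: "c \<in> D" "d \<in> D" "c \<noteq> d"
  shows "D2 F (\<Sum>d\<in>D. l d *\<^sub>R d) c d = 0"
proof -
  obtain A k where A: "logdet_shift A k" "\<And>d. d \<in> D \<Longrightarrow> A d = l d *\<^sub>R d"
    using logdet_shift_diagonal[where l=l, OF D l] by blast
  have linA: "linear A" using A(1) by (simp add: logdet_shift_def)
  define w where "w = (\<Sum>d\<in>D. l d *\<^sub>R d)"
  have "A e = (\<Sum>d\<in>D. A d)" using D by (auto simp: orthosystem_def linear_sum[OF linA])
  then have w: "A e = w" by (simp add: w_def A(2))
  then have wi: "w \<in> interior K" using logdet_shift_interior_iff[OF A(1), of e] e_in_interior_K by simp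
  have "idem c" "c \<odot> d = 0" using D cd by (auto simp: orthosystem_def)
  then have "D2 F w (A c) (A d) = D2 F w (A c) 0"
    using self_scaled_associative_transported[OF F A(1), of c c d] by (simp add: w linear_0[OF linA])
  then have "l c * (l d * D2 F w c d) = 0"
    using A(2)[OF cd(1)] A(2)[OF cd(2)] self_scaled_D2(2)[OF F wi]
    by (simp add: bilinear_lmul bilinear_rmul bilinear_rzero)
  then show ?thesis using l[OF cd(1)] l[OF cd(2)] by (simp add: w_def)
qed

text \<open>Along the curve \<open>w(t) = \<Sum> exp(t a\<^sub>d) d\<close> the quantities \<open>exp(t a\<^sub>d) DF(w(t))[d]\<close> are constant,
  because the Hessian is diagonal on the span of \<open>D\<close> and \<open>D\<^sup>2F(w)[d,w] = - DF(w)[d]\<close>.\<close>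

theorem self_scaled_imp_logdet:
  assumes F: "self_scaled_barrier K F" and x: "x \<in> interior K"
  shows "F x = F e - euclidean_jordan.logdet P e (D2 F e) x"
proof -
  interpret J: euclidean_jordan P e "D2 F e" by (rule self_scaled_euclidean_jordan[OF F])
  obtain D l where D: "frame D" "x = (\<Sum>d\<in>D. l d *\<^sub>R d)" using spectral_theorem by blast
  have os: "orthosystem e D" by (rule frame_orthosystem[OF D(1)])
  have fin: "finite D" using os by (simp add: orthosystem_def)
  have l: "l d > 0" if "d \<in> D" for d using interior_K_iff_coeff_pos[OF os D(2)] x that by simp
  define a where "a d = ln (l d)" for d
  define w where "w t = (\<Sum>d\<in>D. exp (t * a d) *\<^sub>R d)" for t
  define w' where "w' t = (\<Sum>d\<in>D. (a d * exp (t * a d)) *\<^sub>R d)" for t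
  have w0: "w 0 = e" using os by (simp add: w_def orthosystem_def)
  have w1: "w 1 = x" using l by (simp add: w_def D(2) a_def)
  have wi: "w t \<in> interior K" for t
    using interior_K_iff_coeff_pos[OF os, of "w t" "\<lambda>d. exp (t * a d)"] by (simp add: w_def)
  have dw: "(w has_derivative (\<lambda>h. h *\<^sub>R w' t)) (at t)" for t
    unfolding w_def[abs_def] w'_def
    by (auto intro!: derivative_eq_intros sum.cong simp: scaleR_right.sum mult_ac)
  note C = self_scaled_D2(1)[OF F e_in_interior_K]
  have lin: "linear (D2 F (w t) u)" for t u using self_scaled_D2(2)[OF F wi] by (simp add: bilinear_def)
  have off: "D2 F (w t) c d = 0" if "c \<in> D" "d \<in> D" "c \<noteq> d" for t c d
    unfolding w_def by (rule self_scaled_flat_orthogonal[OF F os _ that]) simp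
  have diagonal: "D2 F (w t) d (\<Sum>c\<in>D. k c *\<^sub>R c) = k d * D2 F (w t) d d" if "d \<in> D" for t d k
  proof -
    have "D2 F (w t) d (\<Sum>c\<in>D. k c *\<^sub>R c) = (\<Sum>c\<in>D. k c * D2 F (w t) d c)"
      by (simp add: linear_sum[OF lin] linear_cmul[OF lin])
    also have "\<dots> = (\<Sum>c\<in>D. if c = d then k d * D2 F (w t) d d else 0)"
      using off that by (intro sum.cong) auto
    finally show ?thesis using fin that by simp
  qed
  have D1w: "D1 F (w t) d = - (exp (t * a d) * D2 F (w t) d d)" if "d \<in> D" for t d
    using self_scaled_homogeneous(1)[OF F wi, of t d] diagonal[OF that, of t "\<lambda>d. exp (t * a d)"]
    by (simp add: w_def)
  define b where "b d = D2 F e d d" for d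
  have const: "exp (t * a d) * D1 F (w t) d = - b d" if d: "d \<in> D" for t d
  proof -
    define \<theta> where "\<theta> t = exp (t * a d) * D1 F (w t) d" for t
    have "(\<theta> has_real_derivative 0) (at t)" for t
    proof -
      have "((\<lambda>t. D1 F (w t) d) has_real_derivative D2 F (w t) d (w' t)) (at t)"
        using DERIV_along_curve[OF dw, of "\<lambda>y. D1 F y d"] Ck_on_3D(2)[OF C wi] by (simp add: D2_def)
      then have "(\<theta> has_real_derivative a d * exp (t * a d) * D1 F (w t) d + exp (t * a d) * D2 F (w t) d (w' t)) (at t)"
        unfolding \<theta>_def by (auto intro!: derivative_eq_intros)
      moreover have "D2 F (w t) d (w' t) = a d * exp (t * a d) * D2 F (w t) d d"
        unfolding w'_def by (rule diagonal[OF d])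
      ultimately show ?thesis by (simp add: D1w[OF d] algebra_simps)
    qed
    then have "\<theta> t = \<theta> 0" using DERIV_isconst_all by blast
    also have "\<theta> 0 = - b d" using D1w[OF d, of 0] by (simp add: \<theta>_def w0 b_def)
    finally show ?thesis by (simp add: \<theta>_def)
  qed
  have dF: "((\<lambda>t. F (w t)) has_real_derivative - (\<Sum>d\<in>D. a d * b d)) (at t)" for t
  proof -
    have linD1: "linear (D1 F (w t))" by (rule linear_D1[OF Ck_on_3D(1)[OF C wi]])
    have "D1 F (w t) (w' t) = (\<Sum>d\<in>D. a d * (exp (t * a d) * D1 F (w t) d))"
      by (simp add: w'_def linear_sum[OF linD1] linear_cmul[OF linD1] mult.assoc)
    also have "\<dots> = - (\<Sum>d\<in>D. a d * b d)" by (simp add: const sum_negf)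
    finally show ?thesis using DERIV_along_curve[OF dw Ck_on_3D(1)[OF C wi], of t] by simp
  qed
  have "\<exists>z>0::real. z < 1 \<and> F (w 1) - F (w 0) = (1 - 0) * - (\<Sum>d\<in>D. a d * b d)"
    using MVT2[of 0 1 "\<lambda>t. F (w t)" "\<lambda>_. - (\<Sum>d\<in>D. a d * b d)", OF _ dF] by simp
  then have "F x = F e - (\<Sum>d\<in>D. a d * b d)" by (auto simp: w0 w1)
  moreover have "J.logdet x = (\<Sum>d\<in>D. a d * b d)"
    using J.logdet_orthosystem[OF J.frame_orthosystem[OF D(1)] D(2)] by (simp add: a_def b_def)
  ultimately show ?thesis by simp
qed

end

section \<open>Decomposed algebras\<close>

locale jordan_direct_sum =
  fixes K :: "'a::euclidean_space set" and m :: nat and E C :: "nat \<Rightarrow> 'a set"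
    and P :: "nat \<Rightarrow> 'a \<Rightarrow> 'a \<Rightarrow> 'a" and e :: "nat \<Rightarrow> 'a"
  assumes decomposition: "irreducible_decomposition K m E C"
    and jordan_algebra: "\<And>i. i \<in> {1..m} \<Longrightarrow> euclidean_jordan_algebra (E i) (P i) (e i)"
    and squares: "\<And>i. i \<in> {1..m} \<Longrightarrow> cone_of_squares (E i) (P i) = C i"
begin

definition I :: "nat set" where "I = {1..m}"

lemma finite_I: "finite I" by (simp add: I_def)

lemmas decomposition_defs = irreducible_decomposition_def cone_decomposition_def direct_sum_of_def I_def[symmetric]
lemmas decomposition_facts = decomposition[unfolded decomposition_defs]

lemma component_subspace: "i \<in> I \<Longrightarrow> subspace (E i)" "i \<in> I \<Longrightarrow> E i \<noteq> {0}" "i \<in> I \<Longrightarrow> C i \<subseteq> E i"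
  using decomposition_facts by blast+

lemma K_sum: "x \<in> K \<longleftrightarrow> (\<exists>xs. (\<forall>i\<in>I. xs i \<in> C i) \<and> x = (\<Sum>i\<in>I. xs i))"
proof -
  have "K = (\<Sum>i\<in>I. C i)" using decomposition_facts by blast
  then show ?thesis by (auto simp: set_sum_alt[OF finite_I])
qed

lemma parts_exist: "\<exists>xs. (\<forall>i\<in>I. xs i \<in> E i) \<and> x = (\<Sum>i\<in>I. xs i)"
proof -
  have "UNIV = (\<Sum>i\<in>I. E i)" using decomposition_facts by blast
  then have "x \<in> (\<Sum>i\<in>I. E i)" by blast
  then show ?thesis by (auto simp: set_sum_alt[OF finite_I])
qed

lemma parts_zero:
  assumes "\<And>i. i \<in> I \<Longrightarrow> xs i \<in> E i" "(\<Sum>i\<in>I. xs i) = 0" "i \<in> I"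
  shows "xs i = 0"
proof -
  have "\<forall>x. (\<forall>i\<in>I. x i \<in> E i) \<and> (\<Sum>i\<in>I. x i) = 0 \<longrightarrow> (\<forall>i\<in>I. x i = 0)"
    using decomposition_facts by blast
  then show ?thesis using assms by blast
qed

definition proj :: "nat \<Rightarrow> 'a \<Rightarrow> 'a" where
  "proj i x = (SOME xs. (\<forall>i\<in>I. xs i \<in> E i) \<and> x = (\<Sum>i\<in>I. xs i)) i"

lemma proj_in: "i \<in> I \<Longrightarrow> proj i x \<in> E i" and proj_sum: "(\<Sum>i\<in>I. proj i x) = x"
  unfolding proj_def using someI_ex[OF parts_exist[of x]] by auto

lemma proj_unique:
  assumes "\<And>i. i \<in> I \<Longrightarrow> xs i \<in> E i" "x = (\<Sum>i\<in>I. xs i)" "i \<in> I"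
  shows "proj i x = xs i"
proof -
  have "proj i x - xs i = 0"
  proof (rule parts_zero[of "\<lambda>i. proj i x - xs i"])
    show "proj j x - xs j \<in> E j" if "j \<in> I" for j
      using that component_subspace(1) proj_in assms(1) by (simp add: subspace_diff)
    show "(\<Sum>j\<in>I. proj j x - xs j) = 0" using proj_sum[of x] assms(2) by (simp add: sum_subtractf)
  qed (rule assms(3))
  then show ?thesis by simp
qed

lemma proj_add: "i \<in> I \<Longrightarrow> proj i (x + y) = proj i x + proj i y"
  by (rule proj_unique) (simp_all add: subspace_add component_subspace proj_in proj_sum sum.distrib)

lemma proj_scale: "i \<in> I \<Longrightarrow> proj i (c *\<^sub>R x) = c *\<^sub>R proj i x"
  by (rule proj_unique) (simp_all add: subspace_scale component_subspace proj_in proj_sum flip: scaleR_right.sum)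

lemma linear_proj: "i \<in> I \<Longrightarrow> linear (proj i)"
  by (rule linearI) (simp_all add: proj_add proj_scale)

lemma proj_component:
  assumes "j \<in> I" "x \<in> E j" "i \<in> I"
  shows "proj i x = (if i = j then x else 0)"
  using assms by (intro proj_unique[of "\<lambda>i. if i = j then x else 0"]) (auto simp: subspace_0 component_subspace finite_I)

lemma eq_iff_proj: "x = y \<longleftrightarrow> (\<forall>i\<in>I. proj i x = proj i y)"
  by (metis (no_types, lifting) proj_sum sum.cong)

lemma in_component_iff: "i \<in> I \<Longrightarrow> x \<in> E i \<longleftrightarrow> proj i x = x"
  using proj_component proj_in by metis

lemma component_algebra:
  assumes "i \<in> I" "x \<in> E i" "y \<in> E i"
  shows "P i x y \<in> E i" "P i x y = P i y x" "P i (c *\<^sub>R x) y = c *\<^sub>R P i x y"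
    "P i x (P i (P i x x) y) = P i (P i x x) (P i x y)"
  using jordan_algebra[folded I_def, OF assms(1)] assms(2-) unfolding euclidean_jordan_algebra_def by blast+

lemma component_mult_unit: "i \<in> I \<Longrightarrow> x \<in> E i \<Longrightarrow> P i (e i) x = x"
  using jordan_algebra[folded I_def] unfolding euclidean_jordan_algebra_def by blast

lemma component_mult_add:
  assumes "i \<in> I" "x \<in> E i" "y \<in> E i" "z \<in> E i"
  shows "P i (x + y) z = P i x z + P i y z"
  using jordan_algebra[folded I_def, OF assms(1)] assms(2-) unfolding euclidean_jordan_algebra_def by blast

lemma unit_in: "i \<in> I \<Longrightarrow> e i \<in> E i"
  using jordan_algebra[folded I_def] unfolding euclidean_jordan_algebra_def by blast

definition component_form :: "nat \<Rightarrow> 'a \<Rightarrow> 'a \<Rightarrow> real" where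
  "component_form i = (SOME B. inner_product_on (E i) B \<and>
     (\<forall>x\<in>E i. \<forall>y\<in>E i. \<forall>z\<in>E i. B (P i x y) z = B y (P i x z)))"

lemma component_form_spec:
  assumes "i \<in> I"
  shows "inner_product_on (E i) (component_form i)"
    "\<And>x y z. x \<in> E i \<Longrightarrow> y \<in> E i \<Longrightarrow> z \<in> E i \<Longrightarrow> component_form i (P i x y) z = component_form i y (P i x z)"
proof -
  have "\<exists>B. inner_product_on (E i) B \<and> (\<forall>x\<in>E i. \<forall>y\<in>E i. \<forall>z\<in>E i. B (P i x y) z = B y (P i x z))"
    using jordan_algebra[folded I_def, OF assms] unfolding euclidean_jordan_algebra_def by blast
  from someI_ex[OF this]
  show "inner_product_on (E i) (component_form i)"
    "\<And>x y z. x \<in> E i \<Longrightarrow> y \<in> E i \<Longrightarrow> z \<in> E i \<Longrightarrow> component_form i (P i x y) z = component_form i y (P i x z)"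
    unfolding component_form_def by blast+
qed

lemma component_form_simps:
  assumes "i \<in> I" "x \<in> E i" "y \<in> E i"
  shows "component_form i x y = component_form i y x" "component_form i (c *\<^sub>R x) y = c * component_form i x y"
  using component_form_spec(1)[OF assms(1)] assms(2-) unfolding inner_product_on_def by blast+

lemma component_form_pos: "i \<in> I \<Longrightarrow> x \<in> E i \<Longrightarrow> x \<noteq> 0 \<Longrightarrow> component_form i x x > 0"
  using component_form_spec(1) unfolding inner_product_on_def by blast

lemma component_form_add:
  assumes "i \<in> I" "x \<in> E i" "y \<in> E i" "z \<in> E i"
  shows "component_form i (x + y) z = component_form i x z + component_form i y z"
  using component_form_spec(1)[OF assms(1)] assms(2-) unfolding inner_product_on_def by blast

definition mult :: "'a \<Rightarrow> 'a \<Rightarrow> 'a" where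
  "mult x y = (\<Sum>i\<in>I. P i (proj i x) (proj i y))"

definition total_unit :: 'a where
  "total_unit = (\<Sum>i\<in>I. e i)"

text \<open>The weights \<open>c\<close> allow the lengths of primitive idempotents to be prescribed in each component.\<close>

definition total_form :: "(nat \<Rightarrow> real) \<Rightarrow> 'a \<Rightarrow> 'a \<Rightarrow> real" where
  "total_form c x y = (\<Sum>i\<in>I. c i * component_form i (proj i x) (proj i y))"

lemma proj_mult: "i \<in> I \<Longrightarrow> proj i (mult x y) = P i (proj i x) (proj i y)"
  by (rule proj_unique) (auto simp: mult_def component_algebra proj_in)

lemma proj_total_unit: "i \<in> I \<Longrightarrow> proj i total_unit = e i"
  by (rule proj_unique) (auto simp: total_unit_def unit_in)

lemma component_mult_right:
  assumes "i \<in> I" "x \<in> E i" "y \<in> E i"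
  shows "P i y (c *\<^sub>R x) = c *\<^sub>R P i y x" "z \<in> E i \<Longrightarrow> P i z (x + y) = P i z x + P i z y"
proof -
  have xy: "x + y \<in> E i" "c *\<^sub>R x \<in> E i" using assms component_subspace by (simp_all add: subspace_add subspace_scale)
  show "P i y (c *\<^sub>R x) = c *\<^sub>R P i y x"
    using component_algebra(2)[OF assms(1,3) xy(2)] component_algebra(2)[OF assms(1,3,2)] component_algebra(3)[OF assms, of c] by simp
  assume z: "z \<in> E i"
  show "P i z (x + y) = P i z x + P i z y"
    using component_algebra(2)[OF assms(1) z xy(1)] component_algebra(2)[OF assms(1) z assms(2)] component_algebra(2)[OF assms(1) z assms(3)]
      component_mult_add[OF assms z] by simp
qed

lemma component_form_right:
  assumes "i \<in> I" "x \<in> E i" "y \<in> E i"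
  shows "component_form i y (c *\<^sub>R x) = c * component_form i y x" "z \<in> E i \<Longrightarrow> component_form i z (x + y) = component_form i z x + component_form i z y"
proof -
  have xy: "x + y \<in> E i" "c *\<^sub>R x \<in> E i" using assms component_subspace by (simp_all add: subspace_add subspace_scale)
  show "component_form i y (c *\<^sub>R x) = c * component_form i y x"
    using component_form_simps(1)[OF assms(1,3) xy(2)] component_form_simps(1)[OF assms(1,3,2)] component_form_simps(2)[OF assms, of c] by simp
  assume z: "z \<in> E i"
  show "component_form i z (x + y) = component_form i z x + component_form i z y"
    using component_form_simps(1)[OF assms(1) z xy(1)] component_form_simps(1)[OF assms(1) z assms(2)]
      component_form_simps(1)[OF assms(1) z assms(3)] component_form_add[OF assms z] by simp
qed

lemma total_algebra:
  assumes c: "\<And>i. i \<in> I \<Longrightarrow> c i > 0"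
  shows "euclidean_jordan mult total_unit (total_form c)"
proof
  show "bilinear mult"
    unfolding bilinear_def
    by (intro conjI allI linearI; subst eq_iff_proj)
      (simp_all add: proj_mult proj_add proj_scale component_algebra(3) component_mult_add component_mult_right proj_in)
  show "bilinear (total_form c)"
    unfolding bilinear_def total_form_def
    by (intro conjI allI linearI)
      (simp_all add: proj_add proj_scale component_form_simps(2) component_form_add component_form_right proj_in sum.distrib
        sum_distrib_left algebra_simps)
  fix x y z
  show "mult x y = mult y x"
    unfolding mult_def by (intro sum.cong refl component_algebra(2)[OF _ proj_in proj_in])
  show "mult x (mult (mult x x) y) = mult (mult x x) (mult x y)"
    by (subst eq_iff_proj) (auto simp: proj_mult proj_in intro!: component_algebra(4))
  show "mult total_unit x = x"
    by (subst eq_iff_proj) (auto simp: proj_mult proj_total_unit proj_in component_mult_unit)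
  show "total_form c x y = total_form c y x"
    unfolding total_form_def
    by (intro sum.cong refl arg_cong2[where f="(*)"] component_form_simps(1)[OF _ proj_in proj_in])
  show "total_form c (mult x y) z = total_form c y (mult x z)"
    unfolding total_form_def
    by (intro sum.cong refl arg_cong2[where f="(*)"]) (simp_all add: proj_mult component_form_spec(2) proj_in)
  assume "x \<noteq> 0"
  have nonneg: "component_form i (proj i x) (proj i x) \<ge> 0" if "i \<in> I" for i
  proof (cases "proj i x = 0")
    case True
    then show ?thesis
      using component_form_simps(2)[OF that proj_in[OF that] proj_in[OF that], of 0 x x] by simp
  qed (simp add: component_form_pos that proj_in less_imp_le)
  obtain i where i: "i \<in> I" "proj i x \<noteq> 0"
    using \<open>x \<noteq> 0\<close> proj_sum[of x] by (metis sum.neutral)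
  have "c i * component_form i (proj i x) (proj i x) > 0"
    using c i component_form_pos[OF i(1) proj_in[OF i(1)] i(2)] by simp
  then show "total_form c x x > 0"
    unfolding total_form_def using i nonneg c
    by (intro sum_pos2[of I i]) (auto simp: less_imp_le finite_I)
qed

lemma total_squares: "cone_of_squares UNIV mult = K"
proof (rule set_eqI)
  fix x
  show "x \<in> cone_of_squares UNIV mult \<longleftrightarrow> x \<in> K"
  proof
    assume "x \<in> cone_of_squares UNIV mult"
    then obtain y where y: "x = mult y y" by (auto simp: cone_of_squares_def)
    have "P i (proj i y) (proj i y) \<in> C i" if "i \<in> I" for i
      using squares[folded I_def, OF that] proj_in[OF that] by (auto simp: cone_of_squares_def)
    then show "x \<in> K"
      unfolding K_sum y mult_def by (intro exI[of _ "\<lambda>i. P i (proj i y) (proj i y)"]) simp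
  next
    assume "x \<in> K"
    then obtain xs where xs: "\<And>i. i \<in> I \<Longrightarrow> xs i \<in> C i" "x = (\<Sum>i\<in>I. xs i)" using K_sum by blast
    have "\<forall>i\<in>I. \<exists>y. y \<in> E i \<and> xs i = P i y y"
      using xs(1) squares[folded I_def] unfolding cone_of_squares_def by blast
    then obtain ys where ys: "\<And>i. i \<in> I \<Longrightarrow> ys i \<in> E i \<and> xs i = P i (ys i) (ys i)" by metis
    define y where "y = (\<Sum>i\<in>I. ys i)"
    have py: "proj i y = ys i" if "i \<in> I" for i
      by (rule proj_unique[OF _ y_def that]) (simp add: ys)
    have "mult y y = (\<Sum>i\<in>I. xs i)" unfolding mult_def by (intro sum.cong refl) (simp add: py ys)
    then show "x \<in> cone_of_squares UNIV mult" unfolding cone_of_squares_def xs(2)[symmetric] by blast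
  qed
qed

lemma C_iff: "i \<in> I \<Longrightarrow> x \<in> C i \<longleftrightarrow> x \<in> E i \<and> x \<in> K"
proof
  assume i: "i \<in> I" and x: "x \<in> C i"
  have "(if j = i then x else 0) \<in> C j" if "j \<in> I" for j
  proof -
    have "P j 0 0 = 0"
      using component_algebra(3)[OF that subspace_0[OF component_subspace(1)[OF that]] subspace_0[OF component_subspace(1)[OF that]], of 0] by simp
    then have "0 \<in> C j"
      using squares[folded I_def, OF that] subspace_0[OF component_subspace(1)[OF that]] unfolding cone_of_squares_def by force
    then show ?thesis using x by auto
  qed
  moreover have "x = (\<Sum>j\<in>I. if j = i then x else 0)" using i finite_I by simp
  ultimately have "x \<in> K" unfolding K_sum by (intro exI[of _ "\<lambda>j. if j = i then x else 0"]) auto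
  then show "x \<in> E i \<and> x \<in> K" using x component_subspace(3) i by blast
next
  assume i: "i \<in> I" and x: "x \<in> E i \<and> x \<in> K"
  then obtain xs where xs: "\<And>i. i \<in> I \<Longrightarrow> xs i \<in> C i" "x = (\<Sum>i\<in>I. xs i)" using K_sum by blast
  have "proj i x = xs i" by (rule proj_unique) (use xs component_subspace(3) i in auto)
  then show "x \<in> C i" using x i xs(1) in_component_iff by auto
qed

lemma proj_image_K: "i \<in> I \<Longrightarrow> proj i ` K = C i"
proof
  assume i: "i \<in> I"
  show "proj i ` K \<subseteq> C i"
  proof
    fix y assume "y \<in> proj i ` K"
    then obtain x where x: "x \<in> K" "y = proj i x" by blast
    then obtain xs where xs: "\<And>i. i \<in> I \<Longrightarrow> xs i \<in> C i" "x = (\<Sum>i\<in>I. xs i)" using K_sum by blast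
    have "proj i x = xs i" by (rule proj_unique) (use xs component_subspace(3) i in auto)
    then show "y \<in> C i" using xs(1) i x(2) by simp
  qed
  show "C i \<subseteq> proj i ` K"
  proof
    fix y assume "y \<in> C i"
    then have "y \<in> K" "proj i y = y" using C_iff[OF i] in_component_iff[OF i] by blast+
    then show "y \<in> proj i ` K" by force
  qed
qed

subsection \<open>Idempotents and frames of the components\<close>

abbreviation prim :: "'a \<Rightarrow> bool" where
  "prim d \<equiv> primitive_idempotent UNIV mult d"

lemma P_zero: "i \<in> I \<Longrightarrow> P i 0 0 = 0"
  using component_algebra(3)[of i 0 0 0] component_subspace(1)[of i] by (simp add: subspace_0)

lemma mult_component:
  assumes i: "i \<in> I" and xy: "x \<in> E i" "y \<in> E i"
  shows "mult x y = P i x y"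
proof -
  have "mult x y = (\<Sum>j\<in>I. if j = i then P i x y else 0)"
    unfolding mult_def
    by (intro sum.cong refl) (simp add: proj_component[OF i xy(1)] proj_component[OF i xy(2)] P_zero)
  then show ?thesis using i finite_I by simp
qed

lemma component_intro:
  assumes "i \<in> I" "\<And>j. j \<in> I \<Longrightarrow> j \<noteq> i \<Longrightarrow> proj j x = 0"
  shows "x \<in> E i"
proof -
  have "x = (\<Sum>j\<in>I. if j = i then proj i x else 0)"
    by (subst (1) proj_sum[symmetric]) (auto intro!: sum.cong simp: assms(2))
  then have "x = proj i x" using assms(1) finite_I by simp
  then show ?thesis using proj_in[OF assms(1), of x] by simp
qed

lemma component_unique: "i \<in> I \<Longrightarrow> j \<in> I \<Longrightarrow> d \<in> E i \<Longrightarrow> d \<in> E j \<Longrightarrow> d \<noteq> 0 \<Longrightarrow> i = j"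
  using proj_component[of i d i] proj_component[of j d i] by (auto split: if_splits)

lemma idem_proj: "mult d d = d \<Longrightarrow> i \<in> I \<Longrightarrow> P i (proj i d) (proj i d) = proj i d"
  using proj_mult[of i d d] by simp

lemma prim_component:
  assumes d: "prim d"
  shows "\<exists>i\<in>I. d \<in> E i"
proof -
  have dd: "mult d d = d" "d \<noteq> 0" using d by (auto simp: primitive_idempotent_def idempotent_in_def)
  obtain i where i: "i \<in> I" "proj i d \<noteq> 0"
  proof (rule ccontr)
    assume "\<not> thesis"
    then have "\<forall>i\<in>I. proj i d = 0" using that by blast
    then show False using dd(2) proj_sum[of d] by simp
  qed
  define a where "a = proj i d"
  have a: "a \<in> E i" unfolding a_def by (rule proj_in[OF i(1)])
  have pa: "proj j a = (if j = i then a else 0)" if "j \<in> I" for j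
    by (rule proj_component[OF i(1) a that])
  have aa: "mult a a = a" using idem_proj[OF dd(1) i(1)] mult_component[OF i(1) a a] by (simp add: a_def)
  have pd: "proj j (d - a) = (if j = i then 0 else proj j d)" if "j \<in> I" for j
    using linear_diff[OF linear_proj[OF that], of d a] pa[OF that] by (simp add: a_def)
  have "mult (d - a) (d - a) = d - a"
    by (subst eq_iff_proj) (simp add: proj_mult pd P_zero idem_proj[OF dd(1)])
  moreover have "d = a + (d - a)" by simp
  ultimately have "d - a = 0"
    using d aa i(2) unfolding primitive_idempotent_def idempotent_in_def a_def by (metis UNIV_I)
  then show ?thesis using a i(1) by auto
qed

text \<open>In a decomposition \<open>d = a + b\<close> into idempotents of the direct sum, the components of \<open>a\<close> and \<open>b\<close> outside
  \<open>E i\<close> are idempotents with \<open>b\<^sub>j = - a\<^sub>j\<close>, so \<open>b\<^sub>j = b\<^sub>j\<^sup>2 = a\<^sub>j\<^sup>2 = a\<^sub>j\<close> and both vanish.\<close>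

lemma prim_iff:
  assumes i: "i \<in> I" and d: "d \<in> E i"
  shows "primitive_idempotent (E i) (P i) d \<longleftrightarrow> prim d"
proof
  assume p: "prim d"
  have "\<not> (P i a a = a \<and> a \<noteq> 0 \<and> P i b b = b \<and> b \<noteq> 0 \<and> d = a + b)"
    if "a \<in> E i" "b \<in> E i" for a b
    using p mult_component[OF i that(1,1)] mult_component[OF i that(2,2)]
    unfolding primitive_idempotent_def idempotent_in_def by force
  then show "primitive_idempotent (E i) (P i) d"
    using p d mult_component[OF i d d] unfolding primitive_idempotent_def idempotent_in_def by auto
next
  assume p: "primitive_idempotent (E i) (P i) d"
  have False if ab: "mult a a = a" "a \<noteq> 0" "mult b b = b" "b \<noteq> 0" "d = a + b" for a b
  proof -
    have zero: "proj j a = 0 \<and> proj j b = 0" if j: "j \<in> I" "j \<noteq> i" for j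
    proof -
      have "proj j a + proj j b = 0"
        using proj_add[OF j(1), of a b] proj_component[OF i d j(1)] j(2) ab(5) by simp
      then have b: "proj j b = (-1) *\<^sub>R proj j a" by (simp add: eq_neg_iff_add_eq_0 add.commute)
      have "proj j b = P j (proj j b) (proj j b)" using idem_proj[OF ab(3) j(1)] by simp
      also have "\<dots> = P j (proj j a) (proj j a)"
        unfolding b using component_algebra(3)[OF j(1) proj_in[OF j(1)], of "(-1) *\<^sub>R proj j a" "-1" a]
          component_mult_right(1)[OF j(1) proj_in[OF j(1)] proj_in[OF j(1)], of a "-1" a]
          subspace_scale[OF component_subspace(1)[OF j(1)] proj_in[OF j(1)], of "-1" a] by simp
      also have "\<dots> = proj j a" by (rule idem_proj[OF ab(1) j(1)])
      finally have "proj j a = - proj j a" using b by simp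
      then have "2 *\<^sub>R proj j a = 0" unfolding scaleR_2 by (simp only: eq_neg_iff_add_eq_0)
      then have "proj j a = 0" by simp
      then show ?thesis using b by simp
    qed
    have "a \<in> E i" "b \<in> E i" using component_intro[OF i] zero by blast+
    then show False
      using p ab mult_component[OF i, of a a] mult_component[OF i, of b b]
      unfolding primitive_idempotent_def idempotent_in_def by auto
  qed
  then show "prim d"
    using p mult_component[OF i d d] unfolding primitive_idempotent_def idempotent_in_def by auto
qed

lemma frame_split:
  assumes D: "jordan_frame UNIV mult total_unit D" and x: "x = (\<Sum>d\<in>D. l d *\<^sub>R d)" and i: "i \<in> I"
  shows "jordan_frame (E i) (P i) (e i) {d \<in> D. d \<in> E i}"
    and "proj i x = (\<Sum>d\<in>{d \<in> D. d \<in> E i}. l d *\<^sub>R d)"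
proof -
  have fin: "finite D" and prim: "\<And>d. d \<in> D \<Longrightarrow> prim d"
    and orth: "\<And>c d. c \<in> D \<Longrightarrow> d \<in> D \<Longrightarrow> c \<noteq> d \<Longrightarrow> mult c d = 0" and sum: "(\<Sum>d\<in>D. d) = total_unit"
    using D by (auto simp: jordan_frame_def)
  have pd: "proj i d = (if d \<in> E i then d else 0)" if d: "d \<in> D" for d
  proof -
    obtain j where j: "j \<in> I" "d \<in> E j" using prim_component[OF prim[OF d]] by blast
    have "d \<noteq> 0" using prim[OF d] by (simp add: primitive_idempotent_def)
    show ?thesis
    proof (cases "i = j")
      case False
      then have "d \<notin> E i" using component_unique[OF i j(1) _ j(2) \<open>d \<noteq> 0\<close>] by blast
      then show ?thesis using proj_component[OF j i] False by simp
    qed (use j proj_component[OF j i] in simp)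
  qed
  have key: "proj i (\<Sum>d\<in>D. k d *\<^sub>R d) = (\<Sum>d\<in>{d \<in> D. d \<in> E i}. k d *\<^sub>R d)" for k
  proof -
    have "proj i (\<Sum>d\<in>D. k d *\<^sub>R d) = (\<Sum>d\<in>D. k d *\<^sub>R proj i d)"
      by (simp add: linear_sum[OF linear_proj[OF i]] linear_cmul[OF linear_proj[OF i]])
    also have "\<dots> = (\<Sum>d\<in>D. if d \<in> E i then k d *\<^sub>R d else 0)"
      by (intro sum.cong refl) (simp add: pd)
    finally show ?thesis using fin by (simp add: sum.inter_filter)
  qed
  show "proj i x = (\<Sum>d\<in>{d \<in> D. d \<in> E i}. l d *\<^sub>R d)" unfolding x by (rule key)
  have "(\<Sum>d\<in>{d \<in> D. d \<in> E i}. d) = e i"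
    using key[of "\<lambda>_. 1"] sum proj_total_unit[OF i] by simp
  then show "jordan_frame (E i) (P i) (e i) {d \<in> D. d \<in> E i}"
    unfolding jordan_frame_def using fin prim orth prim_iff[OF i]
    by (auto simp: mult_component[OF i, symmetric])
qed

lemma frame_embed:
  assumes J: "euclidean_jordan mult total_unit B" and i: "i \<in> I" and D: "jordan_frame (E i) (P i) (e i) D"
  shows "D \<subseteq> E i" "\<And>d. d \<in> D \<Longrightarrow> prim d" "euclidean_jordan.orthosystem mult (e i) D"
proof -
  interpret J: euclidean_jordan mult total_unit B by fact
  show DE: "D \<subseteq> E i"
    using D by (auto simp: jordan_frame_def primitive_idempotent_def idempotent_in_def)
  then show p: "\<And>d. d \<in> D \<Longrightarrow> prim d" using D prim_iff[OF i] by (auto simp: jordan_frame_def)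
  have "mult c d = 0" if "c \<in> D" "d \<in> D" "c \<noteq> d" for c d
    using D that DE mult_component[OF i, of c d] by (auto simp: jordan_frame_def)
  then show "J.orthosystem (e i) D"
    using D p J.primitive_idem unfolding J.orthosystem_def jordan_frame_def by blast
qed

lemma total_algebra_1: "euclidean_jordan mult total_unit (total_form (\<lambda>_. 1))"
  by (rule total_algebra) simp

lemma prim_exists:
  assumes i: "i \<in> I"
  shows "\<exists>d\<in>E i. prim d"
proof -
  interpret J: euclidean_jordan mult total_unit "total_form (\<lambda>_. 1)" by (rule total_algebra_1)
  obtain D l where D: "J.frame D" "total_unit = (\<Sum>d\<in>D. l d *\<^sub>R d)" using J.spectral_theorem by blast
  have fr: "jordan_frame (E i) (P i) (e i) {d \<in> D. d \<in> E i}" by (rule frame_split(1)[OF D i])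
  have "e i \<noteq> 0"
  proof
    assume z: "e i = 0"
    have "x = 0" if "x \<in> E i" for x
    proof -
      have "x = P i (0 *\<^sub>R e i) x" using component_mult_unit[OF i that] z by simp
      then show ?thesis using component_algebra(3)[OF i unit_in[OF i] that, of 0] by simp
    qed
    then show False using component_subspace(2)[OF i] subspace_0[OF component_subspace(1)[OF i]] by blast
  qed
  then have "{d \<in> D. d \<in> E i} \<noteq> {}" using fr unfolding jordan_frame_def by fastforce
  then show ?thesis using D(1) by (auto simp: jordan_frame_def)
qed

text \<open>Primitive idempotents of different length are orthogonal, so the primitive idempotents of
  \<open>E i\<close> of a given length and the other ones span orthogonal subspaces. By the spectral theorem
  this decomposes \<open>C i\<close> unless one of the two classes is empty.\<close>

lemma prim_norm_const:
  assumes J: "euclidean_jordan mult total_unit B" and i: "i \<in> I"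
    and c: "prim c" "c \<in> E i" and d: "prim d" "d \<in> E i"
  shows "B c c = B d d"
proof (rule ccontr)
  assume neq: "B c c \<noteq> B d d"
  interpret J: euclidean_jordan mult total_unit B by fact
  define S where "S k = (if k = 1 then {b \<in> E i. prim b \<and> B b b = B c c}
      else {b \<in> E i. prim b \<and> B b b \<noteq> B c c})" for k :: nat
  define V where "V k = span (S k)" for k
  define G where "G k = C i \<inter> V k" for k
  have SE: "S k \<subseteq> E i" for k by (auto simp: S_def)
  then have VE: "V k \<subseteq> E i" for k unfolding V_def using component_subspace(1)[OF i] by (simp add: span_minimal)
  have orth: "B x y = 0" if "x \<in> V 1" "y \<in> V 2" for x y
  proof -
    have ab: "B a b = 0" if "a \<in> S 1" "b \<in> S 2" for a b
      using J.primitive_norm_eq[of a b] that by (auto simp: S_def)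
    have ay: "B a y = 0" if "a \<in> S 1" for a
      using \<open>y \<in> V 2\<close> unfolding V_def
      by (induction rule: span_induct_alt) (auto simp: J.B_linear ab[OF that])
    show ?thesis
      using \<open>x \<in> V 1\<close> unfolding V_def
      by (induction rule: span_induct_alt) (auto simp: J.B_linear ay)
  qed
  have range2: "{1..2} = {1, 2::nat}" by auto
  have split: "\<exists>x1 x2. x = x1 + x2 \<and> x1 \<in> V 1 \<and> x2 \<in> V 2 \<and> (x \<in> C i \<longrightarrow> x1 \<in> C i \<and> x2 \<in> C i)"
    if x: "x \<in> E i" for x
  proof -
    obtain D l where D: "J.frame D" "x = (\<Sum>d\<in>D. l d *\<^sub>R d)" using J.spectral_theorem by blast
    define Di where "Di = {d \<in> D. d \<in> E i}"
    have os: "J.orthosystem total_unit D" by (rule J.frame_orthosystem[OF D(1)])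
    have fin: "finite Di" using D(1) by (simp add: Di_def jordan_frame_def)
    have "x = (\<Sum>d\<in>Di. l d *\<^sub>R d)"
      using frame_split(2)[OF D i] x in_component_iff[OF i] by (simp add: Di_def)
    also have "\<dots> = (\<Sum>d\<in>Di \<inter> S 1. l d *\<^sub>R d) + (\<Sum>d\<in>Di - S 1. l d *\<^sub>R d)"
      by (rule sum.Int_Diff[OF fin])
    finally have eq: "x = (\<Sum>d\<in>Di \<inter> S 1. l d *\<^sub>R d) + (\<Sum>d\<in>Di - S 1. l d *\<^sub>R d)" .
    have "Di - S 1 \<subseteq> S 2" using D(1) by (auto simp: Di_def S_def jordan_frame_def)
    then have mem2: "(\<Sum>d\<in>Di - S 1. l d *\<^sub>R d) \<in> V 2"
      unfolding V_def by (intro span_sum span_scale span_base) blast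
    have mem1: "(\<Sum>d\<in>Di \<inter> S 1. l d *\<^sub>R d) \<in> V 1"
      unfolding V_def by (intro span_sum span_scale span_base) blast
    have "(\<Sum>d\<in>A. l d *\<^sub>R d) \<in> C i" if "x \<in> C i" "A \<subseteq> Di" for A
    proof -
      have "x \<in> J.K" using that(1) C_iff[OF i] by (simp add: total_squares)
      then have l: "l d \<ge> 0" if "d \<in> D" for d using J.K_iff_coeff_nonneg[OF os D(2)] that by blast
      have "finite A" using that(2) fin finite_subset by blast
      then have "(\<Sum>d\<in>A. l d *\<^sub>R d) \<in> K \<and> (\<Sum>d\<in>A. l d *\<^sub>R d) \<in> E i" using that(2)
      proof (induction A)
        case empty
        have "0 \<in> J.K" using J.K_scale[OF J.e_in_K, of 0] by simp
        then show ?case using subspace_0[OF component_subspace(1)[OF i]] by (simp add: total_squares)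
      next
        case (insert b A)
        have b: "b \<in> D" "b \<in> E i" using insert by (auto simp: Di_def)
        have "b \<in> J.K"
          using J.idem_in_K[OF J.primitive_idem(1)[OF J.frame_primitive[OF D(1) b(1)]]] .
        then have "l b *\<^sub>R b \<in> K" using J.K_scale l[OF b(1)] by (simp add: total_squares)
        moreover have "l b *\<^sub>R b \<in> E i" using b component_subspace(1)[OF i] by (simp add: subspace_scale)
        ultimately show ?case
          using insert J.K_add component_subspace(1)[OF i] by (simp add: subspace_add total_squares)
      qed
      then show ?thesis using C_iff[OF i] by blast
    qed
    then show ?thesis using eq mem1 mem2 by blast
  qed
  have "cone_decomposition (E i) (C i) 2 V G"
    unfolding cone_decomposition_def direct_sum_of_def
  proof (intro conjI ballI allI impI)
    show "subspace (V k)" for k by (simp add: V_def)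
    show "E i = (\<Sum>k = 1..2. V k)"
    proof
      show "E i \<subseteq> (\<Sum>k = 1..2. V k)"
        unfolding range2 using split by (auto intro: set_plus_intro)
      show "(\<Sum>k = 1..2. V k) \<subseteq> E i"
        unfolding range2 using VE component_subspace(1)[OF i] by (auto elim!: set_plus_elim intro!: subspace_add)
    qed
    show "x k = 0" if x: "(\<forall>k\<in>{1..2}. x k \<in> V k) \<and> (\<Sum>k = 1..2. x k) = 0" and k: "k \<in> {1..2}" for x k
    proof -
      have x12: "x 1 \<in> V 1" "x 2 \<in> V 2" "x 1 + x 2 = 0" using x unfolding range2 by auto
      then have "x 1 = - x 2" by (simp add: eq_neg_iff_add_eq_0)
      then have "B (x 1) (x 1) = - B (x 1) (x 2)"
        using bilinear_rneg[OF J.bilinear_B, of "x 1" "x 2"] by simp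
      then have "x 1 = 0" using orth[OF x12(1,2)] J.B_eq_0_iff by simp
      then show ?thesis using x12(3) k unfolding range2 by auto
    qed
    show "V k \<noteq> {0}" if "k \<in> {1..2}" for k
    proof -
      have "c \<in> V 1" "d \<in> V 2" using c d neq by (auto simp: V_def S_def intro!: span_base)
      moreover have "c \<noteq> 0" "d \<noteq> 0" using c d J.primitive_idem(2) by blast+
      ultimately show ?thesis using that unfolding range2 by auto
    qed
    have "a *\<^sub>R x \<in> C i" if "x \<in> C i" "a \<ge> 0" for a x
      using that C_iff[OF i] J.K_scale subspace_scale[OF component_subspace(1)[OF i]] by (simp add: total_squares)
    then show "cone (G k)" for k
      unfolding cone_def G_def V_def by (simp add: span_scale)
    show "G k \<subseteq> V k" for k by (simp add: G_def)
    show "C i = (\<Sum>k = 1..2. G k)"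
    proof
      show "C i \<subseteq> (\<Sum>k = 1..2. G k)"
      proof
        fix x assume x: "x \<in> C i"
        then obtain x1 x2 where "x = x1 + x2" "x1 \<in> G 1" "x2 \<in> G 2"
          using split[of x] component_subspace(3)[OF i] unfolding G_def by blast
        then show "x \<in> (\<Sum>k = 1..2. G k)" unfolding range2 by (auto intro: set_plus_intro)
      qed
      have "x + y \<in> C i" if "x \<in> C i" "y \<in> C i" for x y
        using that C_iff[OF i] J.K_add subspace_add[OF component_subspace(1)[OF i]] by (simp add: total_squares)
      then show "(\<Sum>k = 1..2. G k) \<subseteq> C i"
        unfolding range2 G_def by (auto elim!: set_plus_elim)
    qed
  qed
  moreover have "irreducible_cone_in (E i) (C i)" using decomposition_facts i by blast
  ultimately show False unfolding irreducible_cone_in_def by (metis order_refl)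
qed

subsection \<open>Determinants of the components\<close>

text \<open>As all primitive idempotents of \<open>E i\<close> have the same length, \<open>spectral_sum_unique\<close> shows that
  \<open>\<Sum> f (l d)\<close> does not depend on the frame, for any \<open>f\<close>. The indicator function of the nonpositive numbers
  yields the positivity of all other representations, and \<open>ln\<close> yields the equality of the products.\<close>

lemma jordan_det_eq:
  assumes i: "i \<in> I" and D: "jordan_frame (E i) (P i) (e i) D" and x: "x = (\<Sum>d\<in>D. l d *\<^sub>R d)"
    and l: "\<And>d. d \<in> D \<Longrightarrow> l d > 0"
  shows "jordan_det (E i) (P i) (e i) x = (\<Prod>d\<in>D. l d)"
  unfolding jordan_det_def
proof (rule the_equality)
  fix t assume "\<exists>D l. jordan_frame (E i) (P i) (e i) D \<and> x = (\<Sum>d\<in>D. l d *\<^sub>R d) \<and> t = (\<Prod>d\<in>D. l d)"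
  then obtain D' l' where D': "jordan_frame (E i) (P i) (e i) D'" "x = (\<Sum>d\<in>D'. l' d *\<^sub>R d)"
    and t: "t = (\<Prod>d\<in>D'. l' d)" by blast
  interpret J: euclidean_jordan mult total_unit "total_form (\<lambda>_. 1)" by (rule total_algebra_1)
  let ?B = "total_form (\<lambda>_. 1)"
  note emb = frame_embed[OF total_algebra_1 i D] and emb' = frame_embed[OF total_algebra_1 i D'(1)]
  have fin: "finite D" "finite D'" using D D'(1) by (simp_all add: jordan_frame_def)
  obtain c where c: "c \<in> E i" "prim c" using prim_exists[OF i] by blast
  define b where "b = ?B c c"
  have b: "b > 0" unfolding b_def using J.B_pos J.primitive_idem(2) c(2) by blast
  have Bd: "?B d d = b" if "d \<in> D" for d
    unfolding b_def using prim_norm_const[OF total_algebra_1 i emb(2)[OF that] _ c(2,1)] emb(1) that by blast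
  have Bd': "?B d d = b" if "d \<in> D'" for d
    unfolding b_def using prim_norm_const[OF total_algebra_1 i emb'(2)[OF that] _ c(2,1)] emb'(1) that by blast
  have unique: "(\<Sum>d\<in>D. f (l d)) = (\<Sum>d\<in>D'. f (l' d))" for f :: "real \<Rightarrow> real"
  proof -
    have "(\<Sum>d\<in>D. f (l d) * ?B d d) = (\<Sum>d\<in>D'. f (l' d) * ?B d d)"
      by (rule J.spectral_sum_unique[OF emb(3) emb'(3)]) (use x D'(2) in simp)
    then have "(\<Sum>d\<in>D. f (l d)) * b = (\<Sum>d\<in>D'. f (l' d)) * b"
      by (simp add: Bd Bd' sum_distrib_right)
    then show ?thesis using b by simp
  qed
  have l': "l' d > 0" if "d \<in> D'" for d
  proof (rule ccontr)
    assume neg: "\<not> l' d > 0"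
    define f :: "real \<Rightarrow> real" where "f t = (if t > 0 then 0 else 1)" for t
    have "f (l' d) \<le> (\<Sum>d\<in>D'. f (l' d))"
      using fin(2) that by (intro member_le_sum) (auto simp: f_def)
    also have "\<dots> = (\<Sum>d\<in>D. f (l d))" by (rule unique[symmetric])
    also have "\<dots> = 0" using l by (simp add: f_def)
    finally show False using neg by (simp add: f_def)
  qed
  have "ln (\<Prod>d\<in>D. l d) = ln (\<Prod>d\<in>D'. l' d)"
    using unique[of ln] ln_prod[OF fin(1), of l] ln_prod[OF fin(2), of l'] l l' by force
  moreover have "(\<Prod>d\<in>D. l d) > 0" "(\<Prod>d\<in>D'. l' d) > 0" using l l' by (auto intro: prod_pos)
  ultimately show "t = (\<Prod>d\<in>D. l d)" using t by simp
qed (use D x in blast)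

text \<open>A frame of the direct sum is the union of frames of the components.\<close>

lemma logdet_eq_sum:
  assumes J: "euclidean_jordan mult total_unit B" and x: "x \<in> interior K"
    and c: "\<And>i d. i \<in> I \<Longrightarrow> d \<in> E i \<Longrightarrow> prim d \<Longrightarrow> B d d = c i"
  shows "euclidean_jordan.logdet mult total_unit B x
    = (\<Sum>i\<in>I. c i * ln (jordan_det (E i) (P i) (e i) (proj i x)))"
proof -
  interpret J: euclidean_jordan mult total_unit B by fact
  obtain D l where D: "J.frame D" "x = (\<Sum>d\<in>D. l d *\<^sub>R d)" using J.spectral_theorem by blast
  have os: "J.orthosystem total_unit D" by (rule J.frame_orthosystem[OF D(1)])
  have fin: "finite D" using D(1) by (simp add: jordan_frame_def)
  have l: "l d > 0" if "d \<in> D" for d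
    using J.interior_K_iff_coeff_pos[OF os D(2)] x that by (simp add: total_squares)
  have p: "prim d" if "d \<in> D" for d using D(1) that by (rule J.frame_primitive)
  have component: "c i * ln (jordan_det (E i) (P i) (e i) (proj i x)) = (\<Sum>d\<in>D. if d \<in> E i then ln (l d) * B d d else 0)"
    if i: "i \<in> I" for i
  proof -
    have "jordan_det (E i) (P i) (e i) (proj i x) = (\<Prod>d\<in>{d \<in> D. d \<in> E i}. l d)"
      by (rule jordan_det_eq[OF i frame_split[OF D i]]) (simp add: l)
    then have "c i * ln (jordan_det (E i) (P i) (e i) (proj i x)) = (\<Sum>d\<in>{d \<in> D. d \<in> E i}. ln (l d) * c i)"
      using l fin ln_prod[of "{d \<in> D. d \<in> E i}" l] by (force simp: sum_distrib_left mult.commute)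
    also have "\<dots> = (\<Sum>d\<in>{d \<in> D. d \<in> E i}. ln (l d) * B d d)"
      using c[OF i] p by (intro sum.cong) auto
    finally show ?thesis using fin by (simp add: sum.inter_filter)
  qed
  have one: "(\<Sum>i\<in>I. if d \<in> E i then ln (l d) * B d d else 0) = ln (l d) * B d d" if d: "d \<in> D" for d
  proof -
    obtain j where j: "j \<in> I" "d \<in> E j" using prim_component[OF p[OF d]] by blast
    have "d \<noteq> 0" using p[OF d] J.primitive_idem(2) by blast
    then have "(\<Sum>i\<in>I. if d \<in> E i then ln (l d) * B d d else 0) = (\<Sum>i\<in>I. if i = j then ln (l d) * B d d else 0)"
      using j component_unique by (intro sum.cong refl) auto
    then show ?thesis using j(1) finite_I by simp
  qed
  have "J.logdet x = (\<Sum>d\<in>D. ln (l d) * B d d)" by (rule J.logdet_orthosystem[OF os D(2)])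
  also have "\<dots> = (\<Sum>d\<in>D. \<Sum>i\<in>I. if d \<in> E i then ln (l d) * B d d else 0)" by (simp add: one)
  also have "\<dots> = (\<Sum>i\<in>I. \<Sum>d\<in>D. if d \<in> E i then ln (l d) * B d d else 0)" by (rule sum.swap)
  also have "\<dots> = (\<Sum>i\<in>I. c i * ln (jordan_det (E i) (P i) (e i) (proj i x)))"
    by (intro sum.cong refl component[symmetric])
  finally show ?thesis .
qed

lemma proj_rel_interior:
  assumes x: "x \<in> interior K" and i: "i \<in> I"
  shows "proj i x \<in> rel_interior (C i)"
proof -
  interpret J: euclidean_jordan mult total_unit "total_form (\<lambda>_. 1)" by (rule total_algebra_1)
  have "convex K" using J.convex_K by (simp add: total_squares)
  then have "proj i ` rel_interior K = rel_interior (C i)"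
    using rel_interior_convex_linear_image[OF linear_proj[OF i]] proj_image_K[OF i] by simp
  moreover have "rel_interior K = interior K" using x interior_rel_interior_gen by (metis empty_iff rel_interior_nonempty_interior)
  ultimately show ?thesis using x by blast
qed

lemma rel_interior_parts:
  assumes "\<And>i. i \<in> I \<Longrightarrow> xs i \<in> rel_interior (C i)" "x = (\<Sum>i\<in>I. xs i)" "i \<in> I"
  shows "xs i = proj i x"
  using proj_unique[OF _ assms(2,3)] assms(1) rel_interior_subset component_subspace(3) by (metis subsetD)

text \<open>From left to right, \<open>B\<close> is the Hessian at the unit. From right to left, the component inner products
  are rescaled so that primitive idempotents of \<open>E i\<close> have squared length \<open>c i\<close>.\<close>

theorem self_scaled_iff:
  "self_scaled_barrier K F \<longleftrightarrow>
    (\<exists>(c0::real) c. (\<forall>i\<in>I. c i \<ge> 1) \<and>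
       (\<forall>x\<in>interior K. F x = c0 - (\<Sum>i\<in>I. c i * ln (jordan_det (E i) (P i) (e i) (proj i x)))))"
proof
  interpret J: euclidean_jordan mult total_unit "total_form (\<lambda>_. 1)" by (rule total_algebra_1)
  assume "self_scaled_barrier K F"
  then have F: "self_scaled_barrier J.K F" by (simp add: total_squares)
  define B where "B = D2 F total_unit"
  have JB: "euclidean_jordan mult total_unit B"
    unfolding B_def by (rule J.self_scaled_euclidean_jordan[OF F])
  obtain p where p: "\<And>i. i \<in> I \<Longrightarrow> p i \<in> E i \<and> prim (p i)" using prim_exists by metis
  define c where "c i = B (p i) (p i)" for i
  have Bc: "B d d = c i" if "i \<in> I" "d \<in> E i" "prim d" for i d
    unfolding c_def using prim_norm_const[OF JB that(1,3,2)] p[OF that(1)] by blast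
  have "c i \<ge> 1" if "i \<in> I" for i
    unfolding c_def B_def using J.self_scaled_idem_ge_1[OF F] J.primitive_idem p[OF that] by blast
  moreover have "F x = F total_unit - (\<Sum>i\<in>I. c i * ln (jordan_det (E i) (P i) (e i) (proj i x)))"
    if x: "x \<in> interior K" for x
  proof -
    have "F x = F total_unit - euclidean_jordan.logdet mult total_unit B x"
      unfolding B_def by (rule J.self_scaled_imp_logdet[OF F]) (use x in \<open>simp add: total_squares\<close>)
    also have "euclidean_jordan.logdet mult total_unit B x
        = (\<Sum>i\<in>I. c i * ln (jordan_det (E i) (P i) (e i) (proj i x)))"
      by (rule logdet_eq_sum[OF JB x Bc])
    finally show ?thesis .
  qed
  ultimately show "\<exists>(c0::real) c. (\<forall>i\<in>I. c i \<ge> 1) \<and>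
       (\<forall>x\<in>interior K. F x = c0 - (\<Sum>i\<in>I. c i * ln (jordan_det (E i) (P i) (e i) (proj i x))))"
    by blast
next
  interpret J: euclidean_jordan mult total_unit "total_form (\<lambda>_. 1)" by (rule total_algebra_1)
  assume "\<exists>(c0::real) c. (\<forall>i\<in>I. c i \<ge> 1) \<and>
       (\<forall>x\<in>interior K. F x = c0 - (\<Sum>i\<in>I. c i * ln (jordan_det (E i) (P i) (e i) (proj i x))))"
  then obtain c0 :: real and c where c: "\<And>i. i \<in> I \<Longrightarrow> c i \<ge> 1"
    and F: "\<And>x. x \<in> interior K \<Longrightarrow> F x = c0 - (\<Sum>i\<in>I. c i * ln (jordan_det (E i) (P i) (e i) (proj i x)))"
    by blast
  obtain p where p: "\<And>i. i \<in> I \<Longrightarrow> p i \<in> E i \<and> prim (p i)" using prim_exists by metis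
  define b where "b i = total_form (\<lambda>_. 1) (p i) (p i)" for i
  have b: "b i > 0" if "i \<in> I" for i
    unfolding b_def using J.B_pos J.primitive_idem(2) p[OF that] by blast
  define B where "B = total_form (\<lambda>i. c i / b i)"
  have JB: "euclidean_jordan mult total_unit B"
    unfolding B_def by (rule total_algebra) (use b c in \<open>force intro!: divide_pos_pos\<close>)
  interpret JB: euclidean_jordan mult total_unit B by (rule JB)
  have tf: "total_form k d d = k i * component_form i d d" if "i \<in> I" "d \<in> E i" for k i d
  proof -
    have "component_form j 0 0 = 0" if "j \<in> I" for j
      using component_form_simps(2)[OF that subspace_0[OF component_subspace(1)[OF that]] subspace_0[OF component_subspace(1)[OF that]], of 0] by simp
    then have "total_form k d d = (\<Sum>j\<in>I. if j = i then k i * component_form i d d else 0)"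
      unfolding total_form_def by (intro sum.cong refl) (simp add: proj_component[OF that])
    then show ?thesis using that(1) finite_I by simp
  qed
  have Bc: "B d d = c i" if "i \<in> I" "d \<in> E i" "prim d" for i d
  proof -
    have "component_form i d d = b i"
      using prim_norm_const[OF total_algebra_1 that(1,3,2), of "p i"] p[OF that(1)] tf[OF that(1,2), of "\<lambda>_. 1"]
      by (simp add: b_def)
    then show ?thesis using tf[OF that(1,2)] b[OF that(1)] by (simp add: B_def)
  qed
  have "self_scaled_barrier JB.K F"
  proof (rule JB.logdet_self_scaled)
    show "F x = c0 - JB.logdet x" if "x \<in> interior JB.K" for x
      using F[of x] logdet_eq_sum[OF JB _ Bc, of x] that by (simp add: total_squares)
    show "B d d \<ge> 1" if "prim d" for d
      using prim_component[OF that] Bc c that by force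
  qed
  then show "self_scaled_barrier K F" by (simp add: total_squares)
qed

end

theorem theorem5p5:
  fixes K :: "'a::euclidean_space set"
    and m :: nat
    and E C :: "nat \<Rightarrow> 'a set"
    and P :: "nat \<Rightarrow> 'a \<Rightarrow> 'a \<Rightarrow> 'a"
    and e :: "nat \<Rightarrow> 'a"
    and F :: "'a \<Rightarrow> real"
  assumes "symmetric_cone K"
    and "irreducible_decomposition K m E C"
    and "\<And>i. i \<in> {1..m} \<Longrightarrow> euclidean_jordan_algebra (E i) (P i) (e i)"
    and "\<And>i. i \<in> {1..m} \<Longrightarrow> cone_of_squares (E i) (P i) = C i"
  shows "self_scaled_barrier K F \<longleftrightarrow>
    (\<exists>(c0::real) c :: nat \<Rightarrow> real. (\<forall>i\<in>{1..m}. c i \<ge> 1) \<and>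
       (\<forall>x\<in>interior K. \<forall>xs. (\<forall>i\<in>{1..m}. xs i \<in> rel_interior (C i)) \<and> x = (\<Sum>i=1..m. xs i)
          \<longrightarrow> F x = c0 - (\<Sum>i=1..m. c i * ln (jordan_det (E i) (P i) (e i) (xs i)))))"
proof -
  interpret jordan_direct_sum K m E C P e
    by unfold_locales (use assms in auto)
  have "(\<forall>xs. (\<forall>i\<in>I. xs i \<in> rel_interior (C i)) \<and> x = (\<Sum>i\<in>I. xs i)
          \<longrightarrow> F x = c0 - (\<Sum>i\<in>I. c i * ln (jordan_det (E i) (P i) (e i) (xs i))))
    \<longleftrightarrow> F x = c0 - (\<Sum>i\<in>I. c i * ln (jordan_det (E i) (P i) (e i) (proj i x)))" (is "?l \<longleftrightarrow> ?r")
    if x: "x \<in> interior K" for x c c0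
  proof
    assume ?l
    then show ?r using proj_rel_interior[OF x] proj_sum[of x] by metis
  next
    assume r: ?r
    show ?l
    proof (intro allI impI)
      fix xs assume xs: "(\<forall>i\<in>I. xs i \<in> rel_interior (C i)) \<and> x = (\<Sum>i\<in>I. xs i)"
      then have "xs i = proj i x" if "i \<in> I" for i using rel_interior_parts that by blast
      then show "F x = c0 - (\<Sum>i\<in>I. c i * ln (jordan_det (E i) (P i) (e i) (xs i)))"
        using r by (simp cong: sum.cong)
    qed
  qed
  then show ?thesis
    using self_scaled_iff[of F] unfolding I_def[symmetric] by (simp cong: ball_cong)
qed

end
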